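(* Let $(\mathcal V,\sigma)$ be a braided tensor category, let $\mathcal C$ be a $\mathcal V$-central tensor category via a right exact functor $G:\mathcal V\to\mathcal Z(\mathcal C)$, and let $\mathcal M$ be an exact indecomposable left $\mathcal C$-module category. Let $A_{\mathcal V,\mathcal M}=\mathcal Z_{\mathcal C}(\bar\rho)(\mathrm{Id}_{\mathcal M})$ and let $\pi_M:A_{\mathcal V,\mathcal M}\to\underline{\mathrm{Hom}}(M,M)$ be the dinatural transformations of the relative end defining it. Then: 1. The object $A_{\mathcal V,\mathcal M}\in\mathcal Z^{\mathcal V}(\mathcal C)$ is an algebra, with half-braiding $\sigma_X:A_{\mathcal V,\mathcal M}\otimes X\to X\otimes A_{\mathcal V,\mathcal M}$ such that for all $X\in\mathcal C$, $M\in\mathcal M$ $$\mathfrak a^{-1}_{X,M,M}\,(\mathrm{id}_X\otimes\pi_M)\,\sigma_X=\mathfrak b_{X,M,X\triangleright M}\,(\pi_{X\triangleright M}\otimes\mathrm{id}_X)$$ as morphisms $A_{\mathcal V,\mathcal M}\otimes X\to\underline{\mathrm{Hom}}(M,X\triangleright M)$. 2. $A_{\mathcal V,\mathcal M}$ is a commutative algebra in the braided category $\mathcal Z^{\mathcal V}(\mathcal C)$. 3. $A_{\mathcal V,\mathcal M}$ is connected, that is, $\dim\mathrm{Hom}_{\mathcal Z(\mathcal C)}(\mathbf 1,A_{\mathcal V,\mathcal M})=1$.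
   Context: Conventions: $\Bbbk$ is an algebraically closed field; all categories are finite abelian $\Bbbk$-linear; monoidal categories are strict; tensor categories are finite, rigid, with simple unit $\mathbf 1$. Duals: $\mathrm{ev}_X:X^*\otimes X\to\mathbf 1$, $\mathrm{coev}_X:\mathbf 1\to X\otimes X^*$. Associativity isomorphisms of module categories are suppressed. A module category is exact if $P\triangleright M$ is projective whenever $P\in\mathcal C$ is projective; indecomposable if it is not equivalent to a direct sum of two nontrivial module categories. Center: objects of $\mathcal Z(\mathcal C)$ are pairs $(A,\sigma_{A,-})$ with natural isomorphisms $\sigma_{A,X}:A\otimes X\to X\otimes A$, $\sigma_{A,X\otimes Y}=(\mathrm{id}_X\otimes\sigma_{A,Y})(\sigma_{A,X}\otimes\mathrm{id}_Y)$; the braiding is $\sigma_{A,B}$. $\mathcal C$ is $\mathcal V$-central if there is a faithful braided monoidal functor $G:\mathcal V\to\mathcal Z(\mathcal C)$; $\sigma_{G(V),X}$ is the half-braiding of $G(V)$; identify $G(V^* )=G(V)^*$. $\mathcal Z^{\mathcal V}(\mathcal C)$ is the full subcategory of $\mathcal Z(\mathcal C)$ of objects with $\sigma_{G(V),A}\sigma_{A,G(V)}=\mathrm{id}$ for all $V\in\mathcal V$. $\mathcal M$ is a $\mathcal V$-module category via $V\blacktriangleright M:=G(V)\triangleright M$. $\mathrm{End}_{\mathcal V}(\mathcal M)$ is the category of right exact $\mathcal V$-module endofunctors $(F,d)$, $d_{V,M}:F(V\blacktriangleright M)\to V\blacktriangleright F(M)$, with natural module transformations. It is a $\mathcal C$-bimodule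 category by $(X\triangleright F)(M)=X\triangleright F(M)$, $(F\triangleleft X)(M)=F(X\triangleright M)$, with $(X\triangleright d)_{V,M}=(\sigma_{G(V),X}^{-1}\triangleright\mathrm{id})(\mathrm{id}_X\triangleright d_{V,M})$, $(d\triangleleft X)_{V,M}=d_{V,X\triangleright M}F(\sigma_{G(V),X}^{-1}\triangleright\mathrm{id}_M)$. $\rho:\mathcal C\to\mathrm{End}_{\mathcal V}(\mathcal M)$, $\rho(X)=X\triangleright-$ with structure $\sigma_{G(V),X}^{-1}\triangleright\mathrm{id}_M$, is a monoidal $\mathcal C$-bimodule functor. Objects of $\mathcal Z_{\mathcal C}(\mathrm{End}_{\mathcal V}(\mathcal M))$ are triples $(F,c,d)$ with $(F,d)\in\mathrm{End}_{\mathcal V}(\mathcal M)$ and $(F,c)$ a $\mathcal C$-module functor, $c_{X,M}:F(X\triangleright M)\to X\triangleright F(M)$, such that each $c_X:F\triangleleft X\to X\triangleright F$ is a morphism in $\mathrm{End}_{\mathcal V}(\mathcal M)$. $\mathcal C(\mathcal V,\mathcal M)$ is its full monoidal subcategory (tensor product = composition) of objects with $c_{G(V),M}=d_{V,M}$; $\mathrm{Id}_{\mathcal M}$ is its unit object. Internal Hom: $\underline{\mathrm{Hom}}(M,N)$ represents $\mathrm{Hom}_{\mathcal M}(-\triangleright M,N)$, with natural isomorphisms $\phi^X_{M,N}:\mathrm{Hom}_{\mathcal C}(X,\underline{\mathrm{Hom}}(M,N))\to\mathrm{Hom}_{\mathcal M}(X\triangleright M,N)$ and inverses $\psi^X_{M,N}$;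 $\underline{\mathrm{coev}}_{X,M}=\psi^X_{M,X\triangleright M}(\mathrm{id}):X\to\underline{\mathrm{Hom}}(M,X\triangleright M)$, $\underline{\mathrm{ev}}_{M,N}=\phi^{\underline{\mathrm{Hom}}(M,N)}_{M,N}(\mathrm{id}):\underline{\mathrm{Hom}}(M,N)\triangleright M\to N$. The isomorphism $\mathfrak a_{X,M,N}:\underline{\mathrm{Hom}}(M,X\triangleright N)\to X\otimes\underline{\mathrm{Hom}}(M,N)$ has inverse $\mathfrak a^{-1}_{X,M,N}=\underline{\mathrm{Hom}}(\mathrm{id}_M,\mathrm{id}_X\triangleright\underline{\mathrm{ev}}_{M,N})\,\underline{\mathrm{coev}}_{X\otimes\underline{\mathrm{Hom}}(M,N),M}$, and $\mathfrak b_{X,M,N}:\underline{\mathrm{Hom}}(X\triangleright M,N)\otimes X\to\underline{\mathrm{Hom}}(M,N)$ is $\mathfrak b_{X,M,N}=\underline{\mathrm{Hom}}(\mathrm{id}_M,\underline{\mathrm{ev}}_{X\triangleright M,N})\,\underline{\mathrm{coev}}_{\underline{\mathrm{Hom}}(X\triangleright M,N)\otimes X,M}$. Relative end: for a functor $S:\mathcal M^{\mathrm{op}}\times\mathcal M\to\mathcal A$ with a $\mathcal V$-prebalancing (natural isomorphism) $\beta^V_{M,N}:S(M,V\blacktriangleright N)\to S(V^*\blacktriangleright M,N)$, $\oint_{M\in\mathcal M}(S,\beta)$ is the universal object $E$ with dinatural $\pi_M:E\to S(M,M)$ satisfying $S(\mathrm{ev}_V\blacktriangleright\mathrm{id}_M,\mathrm{id}_M)\pi_M=\beta^V_{V\blacktriangleright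 M,M}\pi_{V\blacktriangleright M}$. The functor $\bar\rho$: for $(F,d)$ and $f:X\triangleright M\to F(V\blacktriangleright N)$ put $\gamma^X_{V,M,N}(f)=(\mathrm{ev}_{G(V)}\triangleright\mathrm{id}_{F(N)})(\mathrm{id}_{G(V^* )}\triangleright d_{V,N}f)(\sigma_{G(V^* ),X}^{-1}\triangleright\mathrm{id}_M)$. With $E=\underline{\mathrm{Hom}}(M,F(V\blacktriangleright N))$, let $\beta^V_{M,N}:E\to\underline{\mathrm{Hom}}(V^*\blacktriangleright M,F(N))$ be the unique morphism with $\phi^E_{V^*\blacktriangleright M,F(N)}(\beta^V_{M,N})=\gamma^E_{V,M,N}(\phi^E_{M,F(V\blacktriangleright N)}(\mathrm{id}_E))$. Then $\bar\rho(F,d)=\oint_{M}(\underline{\mathrm{Hom}}(M,F(M)),\beta)$; it is right adjoint to $\rho$, with unit $h$ and counit $e$, hence lax monoidal, and it is a $\mathcal C$-bimodule functor with $r_{F,X}:\bar\rho(F\triangleleft X)\to\bar\rho(F)\otimes X$, $l_{X,F}:\bar\rho(X\triangleright F)\to X\otimes\bar\rho(F)$, $r_{F,X}^{-1}=\bar\rho(e_F\triangleleft\mathrm{id}_X)h_{\bar\rho(F)\otimes X}$, $l_{X,F}^{-1}=\bar\rho(\mathrm{id}_X\triangleright e_F)h_{X\otimes\bar\rho(F)}$. The functor $\mathcal Z_{\mathcal C}(\bar\rho):\mathcal C(\mathcal V,\mathcal M)\to\mathcal Z^{\mathcal V}(\mathcal C)$ sends $(F,c,d)$ to $\bar\rho(F,d)$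 with half-braiding $l_{X,F}\bar\rho(c_X)r_{F,X}^{-1}$; it is lax monoidal. With $\mu_{F,F'}:\bar\rho(F)\otimes\bar\rho(F')\to\bar\rho(FF')$ and $\varepsilon:\mathbf 1\to\bar\rho(\mathrm{Id}_{\mathcal M})$ the lax monoidal structure, the multiplication and unit of $A_{\mathcal V,\mathcal M}$ are $\mu_{\mathrm{Id},\mathrm{Id}}$ and $\varepsilon$. *)

theory Defs
  imports "HOL-Computational_Algebra.Polynomial"
begin

section \<open>Linear and finite abelian categories\<close>

text \<open>
  A category has a carrier of objects inside a type \<open>'o\<close> and hom-sets inside a type \<open>'a\<close>.
  Hom-sets may overlap, so that the centre can reuse the arrows of the underlying category.
  Composition is in applicative order: \<open>g \<cdot> f\<close> is \<open>f\<close> followed by \<open>g\<close>.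
\<close>

record ('k, 'o, 'a) lincat =
  obj :: "'o set"
  hom :: "'o \<Rightarrow> 'o \<Rightarrow> 'a set"
  idn :: "'o \<Rightarrow> 'a"
  cmp :: "'a \<Rightarrow> 'a \<Rightarrow> 'a" (infixr "\<cdot>\<index>" 60)
  zer :: "'o \<Rightarrow> 'o \<Rightarrow> 'a"
  pls :: "'a \<Rightarrow> 'a \<Rightarrow> 'a" (infixl "\<oplus>\<index>" 55)
  scl :: "'k \<Rightarrow> 'a \<Rightarrow> 'a"

locale linear_category =
  fixes C :: "('k::field, 'o, 'a, 'z) lincat_scheme" (structure)
  assumes idn_in: "X \<in> obj C \<Longrightarrow> idn C X \<in> hom C X X"
    and cmp_in: "\<lbrakk>X \<in> obj C; Y \<in> obj C; Z \<in> obj C; f \<in> hom C X Y; g \<in> hom C Y Z\<rbrakk>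
      \<Longrightarrow> g \<cdot> f \<in> hom C X Z"
    and cmp_assoc: "\<lbrakk>W \<in> obj C; X \<in> obj C; Y \<in> obj C; Z \<in> obj C;
        f \<in> hom C W X; g \<in> hom C X Y; h \<in> hom C Y Z\<rbrakk> \<Longrightarrow> (h \<cdot> g) \<cdot> f = h \<cdot> (g \<cdot> f)"
    and idn_left: "\<lbrakk>X \<in> obj C; Y \<in> obj C; f \<in> hom C X Y\<rbrakk> \<Longrightarrow> idn C Y \<cdot> f = f"
    and idn_right: "\<lbrakk>X \<in> obj C; Y \<in> obj C; f \<in> hom C X Y\<rbrakk> \<Longrightarrow> f \<cdot> idn C X = f"
    and zer_in: "\<lbrakk>X \<in> obj C; Y \<in> obj C\<rbrakk> \<Longrightarrow> zer C X Y \<in> hom C X Y"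
    and pls_in: "\<lbrakk>X \<in> obj C; Y \<in> obj C; f \<in> hom C X Y; g \<in> hom C X Y\<rbrakk> \<Longrightarrow> f \<oplus> g \<in> hom C X Y"
    and scl_in: "\<lbrakk>X \<in> obj C; Y \<in> obj C; f \<in> hom C X Y\<rbrakk> \<Longrightarrow> scl C a f \<in> hom C X Y"
    and pls_assoc: "\<lbrakk>X \<in> obj C; Y \<in> obj C; f \<in> hom C X Y; g \<in> hom C X Y; h \<in> hom C X Y\<rbrakk>
      \<Longrightarrow> (f \<oplus> g) \<oplus> h = f \<oplus> (g \<oplus> h)"
    and pls_comm: "\<lbrakk>X \<in> obj C; Y \<in> obj C; f \<in> hom C X Y; g \<in> hom C X Y\<rbrakk> \<Longrightarrow> f \<oplus> g = g \<oplus> f"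
    and zer_pls: "\<lbrakk>X \<in> obj C; Y \<in> obj C; f \<in> hom C X Y\<rbrakk> \<Longrightarrow> zer C X Y \<oplus> f = f"
    and scl_zero: "\<lbrakk>X \<in> obj C; Y \<in> obj C; f \<in> hom C X Y\<rbrakk> \<Longrightarrow> scl C 0 f = zer C X Y"
    and scl_one: "\<lbrakk>X \<in> obj C; Y \<in> obj C; f \<in> hom C X Y\<rbrakk> \<Longrightarrow> scl C 1 f = f"
    and scl_mult: "\<lbrakk>X \<in> obj C; Y \<in> obj C; f \<in> hom C X Y\<rbrakk> \<Longrightarrow> scl C (a * b) f = scl C a (scl C b f)"
    and scl_add: "\<lbrakk>X \<in> obj C; Y \<in> obj C; f \<in> hom C X Y\<rbrakk>
      \<Longrightarrow> scl C (a + b) f = scl C a f \<oplus> scl C b f"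
    and scl_pls: "\<lbrakk>X \<in> obj C; Y \<in> obj C; f \<in> hom C X Y; g \<in> hom C X Y\<rbrakk>
      \<Longrightarrow> scl C a (f \<oplus> g) = scl C a f \<oplus> scl C a g"
    and cmp_pls_left: "\<lbrakk>X \<in> obj C; Y \<in> obj C; Z \<in> obj C;
        f \<in> hom C X Y; g \<in> hom C Y Z; h \<in> hom C Y Z\<rbrakk> \<Longrightarrow> (g \<oplus> h) \<cdot> f = g \<cdot> f \<oplus> h \<cdot> f"
    and cmp_pls_right: "\<lbrakk>X \<in> obj C; Y \<in> obj C; Z \<in> obj C;
        f \<in> hom C X Y; g \<in> hom C X Y; h \<in> hom C Y Z\<rbrakk> \<Longrightarrow> h \<cdot> (f \<oplus> g) = h \<cdot> f \<oplus> h \<cdot> g"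
    and cmp_scl_left: "\<lbrakk>X \<in> obj C; Y \<in> obj C; Z \<in> obj C; f \<in> hom C X Y; g \<in> hom C Y Z\<rbrakk>
      \<Longrightarrow> scl C a g \<cdot> f = scl C a (g \<cdot> f)"
    and cmp_scl_right: "\<lbrakk>X \<in> obj C; Y \<in> obj C; Z \<in> obj C; f \<in> hom C X Y; g \<in> hom C Y Z\<rbrakk>
      \<Longrightarrow> g \<cdot> scl C a f = scl C a (g \<cdot> f)"

text \<open>
  A category whose objects and arrows are all the elements of two types, every arrow having a unique
  source and target.  A map defined on all of \<open>'o\<close> or \<open>'a\<close> then has no values off the category.
\<close>

definition on_types :: "('k, 'o, 'a, 'z) lincat_scheme \<Rightarrow> bool" where
  "on_types C \<longleftrightarrow> obj C = UNIV \<and> (\<forall>f. \<exists>!p. f \<in> hom C (fst p) (snd p))"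

primrec lincomb :: "('k, 'o, 'a, 'z) lincat_scheme \<Rightarrow> 'o \<Rightarrow> 'o \<Rightarrow> nat \<Rightarrow> (nat \<Rightarrow> 'k) \<Rightarrow> (nat \<Rightarrow> 'a) \<Rightarrow> 'a"
  where
    "lincomb C X Y 0 a b = zer C X Y"
  | "lincomb C X Y (Suc n) a b = lincomb C X Y n a b \<oplus>\<^bsub>C\<^esub> scl C (a n) (b n)"

text \<open>\<open>has_hom_dim C X Y n\<close>: the vector space \<open>hom C X Y\<close> has a basis with \<open>n\<close> elements.\<close>

definition has_hom_dim :: "('k::field, 'o, 'a, 'z) lincat_scheme \<Rightarrow> 'o \<Rightarrow> 'o \<Rightarrow> nat \<Rightarrow> bool" where
  "has_hom_dim C X Y n \<longleftrightarrow> (\<exists>b. (\<forall>i<n. b i \<in> hom C X Y) \<and>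
     (\<forall>f\<in>hom C X Y. \<exists>!a. (\<forall>i\<ge>n. a i = 0) \<and> lincomb C X Y n a b = f))"

definition inverses :: "('k, 'o, 'a, 'z) lincat_scheme \<Rightarrow> 'o \<Rightarrow> 'o \<Rightarrow> 'a \<Rightarrow> 'a \<Rightarrow> bool" where
  "inverses C X Y f g \<longleftrightarrow> f \<in> hom C X Y \<and> g \<in> hom C Y X \<and>
     g \<cdot>\<^bsub>C\<^esub> f = idn C X \<and> f \<cdot>\<^bsub>C\<^esub> g = idn C Y"

definition is_iso :: "('k, 'o, 'a, 'z) lincat_scheme \<Rightarrow> 'o \<Rightarrow> 'o \<Rightarrow> 'a \<Rightarrow> bool" where
  "is_iso C X Y f \<longleftrightarrow> (\<exists>g. inverses C X Y f g)"

definition arr_inv :: "('k, 'o, 'a, 'z) lincat_scheme \<Rightarrow> 'o \<Rightarrow> 'o \<Rightarrow> 'a \<Rightarrow> 'a" where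
  "arr_inv C X Y f = (THE g. inverses C X Y f g)"

definition zero_object :: "('k, 'o, 'a, 'z) lincat_scheme \<Rightarrow> 'o \<Rightarrow> bool" where
  "zero_object C X \<longleftrightarrow> X \<in> obj C \<and> idn C X = zer C X X"

definition is_mono :: "('k, 'o, 'a, 'z) lincat_scheme \<Rightarrow> 'o \<Rightarrow> 'o \<Rightarrow> 'a \<Rightarrow> bool" where
  "is_mono C X Y f \<longleftrightarrow> f \<in> hom C X Y \<and>
     (\<forall>W\<in>obj C. \<forall>g\<in>hom C W X. \<forall>h\<in>hom C W X. f \<cdot>\<^bsub>C\<^esub> g = f \<cdot>\<^bsub>C\<^esub> h \<longrightarrow> g = h)"

definition is_epi :: "('k, 'o, 'a, 'z) lincat_scheme \<Rightarrow> 'o \<Rightarrow> 'o \<Rightarrow> 'a \<Rightarrow> bool" where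
  "is_epi C X Y f \<longleftrightarrow> f \<in> hom C X Y \<and>
     (\<forall>Z\<in>obj C. \<forall>g\<in>hom C Y Z. \<forall>h\<in>hom C Y Z. g \<cdot>\<^bsub>C\<^esub> f = h \<cdot>\<^bsub>C\<^esub> f \<longrightarrow> g = h)"

definition is_kernel :: "('k, 'o, 'a, 'z) lincat_scheme \<Rightarrow> 'o \<Rightarrow> 'o \<Rightarrow> 'o \<Rightarrow> 'a \<Rightarrow> 'a \<Rightarrow> bool" where
  "is_kernel C K X Y k f \<longleftrightarrow> K \<in> obj C \<and> k \<in> hom C K X \<and> f \<cdot>\<^bsub>C\<^esub> k = zer C K Y \<and>
     (\<forall>W\<in>obj C. \<forall>g\<in>hom C W X. f \<cdot>\<^bsub>C\<^esub> g = zer C W Y \<longrightarrow> (\<exists>!u. u \<in> hom C W K \<and> k \<cdot>\<^bsub>C\<^esub> u = g))"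

definition is_cokernel :: "('k, 'o, 'a, 'z) lincat_scheme \<Rightarrow> 'o \<Rightarrow> 'o \<Rightarrow> 'o \<Rightarrow> 'a \<Rightarrow> 'a \<Rightarrow> bool" where
  "is_cokernel C X Y Q f q \<longleftrightarrow> Q \<in> obj C \<and> q \<in> hom C Y Q \<and> q \<cdot>\<^bsub>C\<^esub> f = zer C X Q \<and>
     (\<forall>Z\<in>obj C. \<forall>g\<in>hom C Y Z. g \<cdot>\<^bsub>C\<^esub> f = zer C X Z \<longrightarrow> (\<exists>!u. u \<in> hom C Q Z \<and> u \<cdot>\<^bsub>C\<^esub> q = g))"

locale abelian_category = linear_category +
  assumes has_zero: "\<exists>Z. zero_object C Z"
    and has_biproducts: "\<lbrakk>X \<in> obj C; Y \<in> obj C\<rbrakk> \<Longrightarrow>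
      \<exists>S\<in>obj C. \<exists>i\<in>hom C X S. \<exists>j\<in>hom C Y S. \<exists>p\<in>hom C S X. \<exists>q\<in>hom C S Y.
        p \<cdot> i = idn C X \<and> q \<cdot> j = idn C Y \<and> p \<cdot> j = zer C Y X \<and> q \<cdot> i = zer C X Y \<and>
        i \<cdot> p \<oplus> j \<cdot> q = idn C S"
    and has_kernels: "\<lbrakk>X \<in> obj C; Y \<in> obj C; f \<in> hom C X Y\<rbrakk> \<Longrightarrow> \<exists>K k. is_kernel C K X Y k f"
    and has_cokernels: "\<lbrakk>X \<in> obj C; Y \<in> obj C; f \<in> hom C X Y\<rbrakk> \<Longrightarrow> \<exists>Q q. is_cokernel C X Y Q f q"
    and mono_normal: "\<lbrakk>X \<in> obj C; Y \<in> obj C; is_mono C X Y f\<rbrakk>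
      \<Longrightarrow> \<exists>Z\<in>obj C. \<exists>g\<in>hom C Y Z. is_kernel C X Y Z f g"
    and epi_normal: "\<lbrakk>X \<in> obj C; Y \<in> obj C; is_epi C X Y f\<rbrakk>
      \<Longrightarrow> \<exists>W\<in>obj C. \<exists>g\<in>hom C W X. is_cokernel C W X Y g f"

definition simple_object :: "('k, 'o, 'a, 'z) lincat_scheme \<Rightarrow> 'o \<Rightarrow> bool" where
  "simple_object C S \<longleftrightarrow> S \<in> obj C \<and> \<not> zero_object C S \<and>
     (\<forall>W\<in>obj C. \<forall>f. is_mono C W S f \<longrightarrow> zero_object C W \<or> is_iso C W S f)"

text \<open>Existence of a composition series: a zero object, or an extension of a simple object by an
  object having a composition series.\<close>

inductive finite_length :: "('k, 'o, 'a, 'z) lincat_scheme \<Rightarrow> 'o \<Rightarrow> bool" for C where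
  zero: "zero_object C X \<Longrightarrow> finite_length C X"
| step: "\<lbrakk>finite_length C K; X \<in> obj C; simple_object C S; is_epi C X S p; is_kernel C K X S k p\<rbrakk>
    \<Longrightarrow> finite_length C X"

definition projective :: "('k, 'o, 'a, 'z) lincat_scheme \<Rightarrow> 'o \<Rightarrow> bool" where
  "projective C P \<longleftrightarrow> P \<in> obj C \<and> (\<forall>X\<in>obj C. \<forall>Y\<in>obj C. \<forall>e f. is_epi C X Y e \<and> f \<in> hom C P Y \<longrightarrow>
     (\<exists>g\<in>hom C P X. e \<cdot>\<^bsub>C\<^esub> g = f))"

locale finite_category = abelian_category +
  assumes finite_homs: "\<lbrakk>X \<in> obj C; Y \<in> obj C\<rbrakk> \<Longrightarrow> \<exists>n. has_hom_dim C X Y n"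
    and finite_lengths: "X \<in> obj C \<Longrightarrow> finite_length C X"
    and enough_projectives: "X \<in> obj C \<Longrightarrow> \<exists>P p. projective C P \<and> is_epi C P X p"
    and finitely_many_simples: "\<exists>T. finite T \<and> T \<subseteq> obj C \<and>
      (\<forall>S. simple_object C S \<longrightarrow> (\<exists>S'\<in>T. \<exists>f. is_iso C S S' f))"

section \<open>Tensor categories, braidings and the centre\<close>

record ('k, 'o, 'a) moncat = "('k, 'o, 'a) lincat" +
  tob :: "'o \<Rightarrow> 'o \<Rightarrow> 'o" (infixr "\<otimes>\<index>" 70)
  tar :: "'a \<Rightarrow> 'a \<Rightarrow> 'a" (infixr "\<boxtimes>\<index>" 70)
  unt :: "'o"

locale strict_monoidal_category = linear_category C
  for C :: "('k::field, 'o, 'a, 'z) moncat_scheme" (structure) +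
  assumes unt_obj: "unt C \<in> obj C"
    and tob_obj: "\<lbrakk>X \<in> obj C; Y \<in> obj C\<rbrakk> \<Longrightarrow> X \<otimes> Y \<in> obj C"
    and tar_in: "\<lbrakk>X \<in> obj C; X' \<in> obj C; Y \<in> obj C; Y' \<in> obj C; f \<in> hom C X X'; g \<in> hom C Y Y'\<rbrakk>
      \<Longrightarrow> f \<boxtimes> g \<in> hom C (X \<otimes> Y) (X' \<otimes> Y')"
    and tar_idn: "\<lbrakk>X \<in> obj C; Y \<in> obj C\<rbrakk> \<Longrightarrow> idn C X \<boxtimes> idn C Y = idn C (X \<otimes> Y)"
    and tar_cmp: "\<lbrakk>X \<in> obj C; X' \<in> obj C; X'' \<in> obj C; Y \<in> obj C; Y' \<in> obj C; Y'' \<in> obj C;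
        f \<in> hom C X X'; f' \<in> hom C X' X''; g \<in> hom C Y Y'; g' \<in> hom C Y' Y''\<rbrakk>
      \<Longrightarrow> (f' \<cdot> f) \<boxtimes> (g' \<cdot> g) = (f' \<boxtimes> g') \<cdot> (f \<boxtimes> g)"
    and tar_pls_left: "\<lbrakk>X \<in> obj C; X' \<in> obj C; Y \<in> obj C; Y' \<in> obj C;
        f \<in> hom C X X'; f' \<in> hom C X X'; g \<in> hom C Y Y'\<rbrakk> \<Longrightarrow> (f \<oplus> f') \<boxtimes> g = f \<boxtimes> g \<oplus> f' \<boxtimes> g"
    and tar_pls_right: "\<lbrakk>X \<in> obj C; X' \<in> obj C; Y \<in> obj C; Y' \<in> obj C;
        f \<in> hom C X X'; g \<in> hom C Y Y'; g' \<in> hom C Y Y'\<rbrakk> \<Longrightarrow> f \<boxtimes> (g \<oplus> g') = f \<boxtimes> g \<oplus> f \<boxtimes> g'"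
    and tar_scl_left: "\<lbrakk>X \<in> obj C; X' \<in> obj C; Y \<in> obj C; Y' \<in> obj C;
        f \<in> hom C X X'; g \<in> hom C Y Y'\<rbrakk> \<Longrightarrow> scl C a f \<boxtimes> g = scl C a (f \<boxtimes> g)"
    and tar_scl_right: "\<lbrakk>X \<in> obj C; X' \<in> obj C; Y \<in> obj C; Y' \<in> obj C;
        f \<in> hom C X X'; g \<in> hom C Y Y'\<rbrakk> \<Longrightarrow> f \<boxtimes> scl C a g = scl C a (f \<boxtimes> g)"
    and tob_assoc: "\<lbrakk>X \<in> obj C; Y \<in> obj C; Z \<in> obj C\<rbrakk> \<Longrightarrow> (X \<otimes> Y) \<otimes> Z = X \<otimes> (Y \<otimes> Z)"
    and tob_unit: "X \<in> obj C \<Longrightarrow> unt C \<otimes> X = X" "X \<in> obj C \<Longrightarrow> X \<otimes> unt C = X"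
    and tar_assoc: "\<lbrakk>X \<in> obj C; X' \<in> obj C; Y \<in> obj C; Y' \<in> obj C; Z \<in> obj C; Z' \<in> obj C;
        f \<in> hom C X X'; g \<in> hom C Y Y'; h \<in> hom C Z Z'\<rbrakk> \<Longrightarrow> (f \<boxtimes> g) \<boxtimes> h = f \<boxtimes> (g \<boxtimes> h)"
    and tar_unit: "\<lbrakk>X \<in> obj C; Y \<in> obj C; f \<in> hom C X Y\<rbrakk> \<Longrightarrow> idn C (unt C) \<boxtimes> f = f"
      "\<lbrakk>X \<in> obj C; Y \<in> obj C; f \<in> hom C X Y\<rbrakk> \<Longrightarrow> f \<boxtimes> idn C (unt C) = f"

text \<open>\<open>D\<close> is a left dual of \<open>X\<close>, equivalently \<open>X\<close> is a right dual of \<open>D\<close>.\<close>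

definition left_dual :: "('k, 'o, 'a, 'z) moncat_scheme \<Rightarrow> 'o \<Rightarrow> 'o \<Rightarrow> 'a \<Rightarrow> 'a \<Rightarrow> bool" where
  "left_dual C X D ev coev \<longleftrightarrow> D \<in> obj C \<and>
     ev \<in> hom C (D \<otimes>\<^bsub>C\<^esub> X) (unt C) \<and> coev \<in> hom C (unt C) (X \<otimes>\<^bsub>C\<^esub> D) \<and>
     (idn C X \<boxtimes>\<^bsub>C\<^esub> ev) \<cdot>\<^bsub>C\<^esub> (coev \<boxtimes>\<^bsub>C\<^esub> idn C X) = idn C X \<and>
     (ev \<boxtimes>\<^bsub>C\<^esub> idn C D) \<cdot>\<^bsub>C\<^esub> (idn C D \<boxtimes>\<^bsub>C\<^esub> coev) = idn C D"

locale tensor_category = finite_category C + strict_monoidal_category C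
  for C :: "('k::field, 'o, 'a, 'z) moncat_scheme" (structure) +
  assumes left_rigid: "X \<in> obj C \<Longrightarrow> \<exists>D ev coev. left_dual C X D ev coev"
    and right_rigid: "X \<in> obj C \<Longrightarrow> \<exists>D\<in>obj C. \<exists>ev coev. left_dual C D X ev coev"
    and unt_simple: "simple_object C (unt C)"

record ('k, 'o, 'a) brcat = "('k, 'o, 'a) moncat" +
  brd :: "'o \<Rightarrow> 'o \<Rightarrow> 'a"

locale braided_category = strict_monoidal_category C
  for C :: "('k::field, 'o, 'a, 'z) brcat_scheme" (structure) +
  assumes brd_iso: "\<lbrakk>X \<in> obj C; Y \<in> obj C\<rbrakk> \<Longrightarrow> is_iso C (X \<otimes> Y) (Y \<otimes> X) (brd C X Y)"
    and brd_natural: "\<lbrakk>X \<in> obj C; X' \<in> obj C; Y \<in> obj C; Y' \<in> obj C;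
        f \<in> hom C X X'; g \<in> hom C Y Y'\<rbrakk> \<Longrightarrow> brd C X' Y' \<cdot> (f \<boxtimes> g) = (g \<boxtimes> f) \<cdot> brd C X Y"
    and brd_tob_left: "\<lbrakk>X \<in> obj C; Y \<in> obj C; Z \<in> obj C\<rbrakk> \<Longrightarrow>
      brd C (X \<otimes> Y) Z = (brd C X Z \<boxtimes> idn C Y) \<cdot> (idn C X \<boxtimes> brd C Y Z)"
    and brd_tob_right: "\<lbrakk>X \<in> obj C; Y \<in> obj C; Z \<in> obj C\<rbrakk> \<Longrightarrow>
      brd C X (Y \<otimes> Z) = (idn C Y \<boxtimes> brd C X Z) \<cdot> (brd C X Y \<boxtimes> idn C Z)"

locale braided_tensor_category = tensor_category C + braided_category C
  for C :: "('k::field, 'o, 'a, 'z) brcat_scheme" (structure)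

definition half_braiding :: "('k, 'o, 'a, 'z) moncat_scheme \<Rightarrow> 'o \<Rightarrow> ('o \<Rightarrow> 'a) \<Rightarrow> bool" where
  "half_braiding C A \<sigma> \<longleftrightarrow>
     (\<forall>X\<in>obj C. is_iso C (A \<otimes>\<^bsub>C\<^esub> X) (X \<otimes>\<^bsub>C\<^esub> A) (\<sigma> X)) \<and>
     (\<forall>X\<in>obj C. \<forall>Y\<in>obj C. \<forall>f\<in>hom C X Y.
        \<sigma> Y \<cdot>\<^bsub>C\<^esub> (idn C A \<boxtimes>\<^bsub>C\<^esub> f) = (f \<boxtimes>\<^bsub>C\<^esub> idn C A) \<cdot>\<^bsub>C\<^esub> \<sigma> X) \<and>
     (\<forall>X\<in>obj C. \<forall>Y\<in>obj C.
        \<sigma> (X \<otimes>\<^bsub>C\<^esub> Y) = (idn C X \<boxtimes>\<^bsub>C\<^esub> \<sigma> Y) \<cdot>\<^bsub>C\<^esub> (\<sigma> X \<boxtimes>\<^bsub>C\<^esub> idn C Y))"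

definition center :: "('k, 'o, 'a, 'z) moncat_scheme \<Rightarrow> ('k, 'o \<times> ('o \<Rightarrow> 'a), 'a) brcat" where
  "center C = \<lparr>
     obj = {(A, \<sigma>). A \<in> obj C \<and> half_braiding C A \<sigma>},
     hom = (\<lambda>(A, \<sigma>) (B, \<tau>). {f \<in> hom C A B. \<forall>X\<in>obj C.
       (idn C X \<boxtimes>\<^bsub>C\<^esub> f) \<cdot>\<^bsub>C\<^esub> \<sigma> X = \<tau> X \<cdot>\<^bsub>C\<^esub> (f \<boxtimes>\<^bsub>C\<^esub> idn C X)}),
     idn = (\<lambda>(A, \<sigma>). idn C A),
     cmp = cmp C,
     zer = (\<lambda>(A, \<sigma>) (B, \<tau>). zer C A B),
     pls = pls C,
     scl = scl C,
     tob = (\<lambda>(A, \<sigma>) (B, \<tau>). (A \<otimes>\<^bsub>C\<^esub> B,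
       \<lambda>X. (\<sigma> X \<boxtimes>\<^bsub>C\<^esub> idn C B) \<cdot>\<^bsub>C\<^esub> (idn C A \<boxtimes>\<^bsub>C\<^esub> \<tau> X))),
     tar = tar C,
     unt = (unt C, \<lambda>X. idn C X),
     brd = (\<lambda>(A, \<sigma>) (B, \<tau>). \<sigma> B)\<rparr>"

definition is_algebra :: "('k, 'o, 'a, 'z) moncat_scheme \<Rightarrow> 'o \<Rightarrow> 'a \<Rightarrow> 'a \<Rightarrow> bool" where
  "is_algebra C A \<mu> \<epsilon> \<longleftrightarrow> A \<in> obj C \<and>
     \<mu> \<in> hom C (A \<otimes>\<^bsub>C\<^esub> A) A \<and> \<epsilon> \<in> hom C (unt C) A \<and>
     \<mu> \<cdot>\<^bsub>C\<^esub> (\<mu> \<boxtimes>\<^bsub>C\<^esub> idn C A) = \<mu> \<cdot>\<^bsub>C\<^esub> (idn C A \<boxtimes>\<^bsub>C\<^esub> \<mu>) \<and>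
     \<mu> \<cdot>\<^bsub>C\<^esub> (\<epsilon> \<boxtimes>\<^bsub>C\<^esub> idn C A) = idn C A \<and> \<mu> \<cdot>\<^bsub>C\<^esub> (idn C A \<boxtimes>\<^bsub>C\<^esub> \<epsilon>) = idn C A"

definition is_commutative_algebra :: "('k, 'o, 'a, 'z) brcat_scheme \<Rightarrow> 'o \<Rightarrow> 'a \<Rightarrow> 'a \<Rightarrow> bool" where
  "is_commutative_algebra C A \<mu> \<epsilon> \<longleftrightarrow> is_algebra C A \<mu> \<epsilon> \<and> \<mu> \<cdot>\<^bsub>C\<^esub> brd C A A = \<mu>"

section \<open>Functors\<close>

record ('o, 'a, 'p, 'b) fctr =
  fob :: "'o \<Rightarrow> 'p"
  far :: "'a \<Rightarrow> 'b"

locale linear_functor =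
  fixes C :: "('k::field, 'o, 'a, 'z) lincat_scheme"
    and D :: "('k, 'p, 'b, 'y) lincat_scheme"
    and F :: "('o, 'a, 'p, 'b, 'x) fctr_scheme"
  assumes fob_obj: "X \<in> obj C \<Longrightarrow> fob F X \<in> obj D"
    and far_in: "\<lbrakk>X \<in> obj C; Y \<in> obj C; f \<in> hom C X Y\<rbrakk> \<Longrightarrow> far F f \<in> hom D (fob F X) (fob F Y)"
    and far_idn: "X \<in> obj C \<Longrightarrow> far F (idn C X) = idn D (fob F X)"
    and far_cmp: "\<lbrakk>X \<in> obj C; Y \<in> obj C; Z \<in> obj C; f \<in> hom C X Y; g \<in> hom C Y Z\<rbrakk>
      \<Longrightarrow> far F (g \<cdot>\<^bsub>C\<^esub> f) = far F g \<cdot>\<^bsub>D\<^esub> far F f"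
    and far_pls: "\<lbrakk>X \<in> obj C; Y \<in> obj C; f \<in> hom C X Y; g \<in> hom C X Y\<rbrakk>
      \<Longrightarrow> far F (f \<oplus>\<^bsub>C\<^esub> g) = far F f \<oplus>\<^bsub>D\<^esub> far F g"
    and far_scl: "\<lbrakk>X \<in> obj C; Y \<in> obj C; f \<in> hom C X Y\<rbrakk> \<Longrightarrow> far F (scl C a f) = scl D a (far F f)"

definition faithful :: "('k, 'o, 'a, 'z) lincat_scheme \<Rightarrow> ('o, 'a, 'p, 'b, 'x) fctr_scheme \<Rightarrow> bool" where
  "faithful C F \<longleftrightarrow> (\<forall>X\<in>obj C. \<forall>Y\<in>obj C. inj_on (far F) (hom C X Y))"

text \<open>A sequence \<open>X \<rightarrow> Y \<rightarrow> Q \<rightarrow> 0\<close> is exact iff its second arrow is a cokernel of the first.\<close>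

definition right_exact :: "('k, 'o, 'a, 'z) lincat_scheme \<Rightarrow> ('k, 'p, 'b, 'y) lincat_scheme \<Rightarrow>
    ('o, 'a, 'p, 'b, 'x) fctr_scheme \<Rightarrow> bool" where
  "right_exact C D F \<longleftrightarrow> (\<forall>X\<in>obj C. \<forall>Y\<in>obj C. \<forall>Q\<in>obj C. \<forall>f\<in>hom C X Y. \<forall>q.
     is_cokernel C X Y Q f q \<longrightarrow> is_cokernel D (fob F X) (fob F Y) (fob F Q) (far F f) (far F q))"

record ('o, 'a, 'p, 'b) monfctr = "('o, 'a, 'p, 'b) fctr" +
  fmul :: "'o \<Rightarrow> 'o \<Rightarrow> 'b"
  funt :: "'b"

locale braided_functor = linear_functor V Z G
  for V :: "('k::field, 'v, 'w, 'z) brcat_scheme"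
    and Z :: "('k, 'o, 'a, 'y) brcat_scheme"
    and G :: "('v, 'w, 'o, 'a, 'x) monfctr_scheme" +
  assumes fmul_iso: "\<lbrakk>X \<in> obj V; Y \<in> obj V\<rbrakk> \<Longrightarrow>
      is_iso Z (fob G X \<otimes>\<^bsub>Z\<^esub> fob G Y) (fob G (X \<otimes>\<^bsub>V\<^esub> Y)) (fmul G X Y)"
    and funt_iso: "is_iso Z (unt Z) (fob G (unt V)) (funt G)"
    and fmul_natural: "\<lbrakk>X \<in> obj V; X' \<in> obj V; Y \<in> obj V; Y' \<in> obj V; f \<in> hom V X X'; g \<in> hom V Y Y'\<rbrakk>
      \<Longrightarrow> fmul G X' Y' \<cdot>\<^bsub>Z\<^esub> (far G f \<boxtimes>\<^bsub>Z\<^esub> far G g) = far G (f \<boxtimes>\<^bsub>V\<^esub> g) \<cdot>\<^bsub>Z\<^esub> fmul G X Y"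
    and fmul_assoc: "\<lbrakk>X \<in> obj V; Y \<in> obj V; W \<in> obj V\<rbrakk> \<Longrightarrow>
      fmul G (X \<otimes>\<^bsub>V\<^esub> Y) W \<cdot>\<^bsub>Z\<^esub> (fmul G X Y \<boxtimes>\<^bsub>Z\<^esub> idn Z (fob G W)) =
      fmul G X (Y \<otimes>\<^bsub>V\<^esub> W) \<cdot>\<^bsub>Z\<^esub> (idn Z (fob G X) \<boxtimes>\<^bsub>Z\<^esub> fmul G Y W)"
    and fmul_unit: "X \<in> obj V \<Longrightarrow>
      fmul G (unt V) X \<cdot>\<^bsub>Z\<^esub> (funt G \<boxtimes>\<^bsub>Z\<^esub> idn Z (fob G X)) = idn Z (fob G X)"
      "X \<in> obj V \<Longrightarrow> fmul G X (unt V) \<cdot>\<^bsub>Z\<^esub> (idn Z (fob G X) \<boxtimes>\<^bsub>Z\<^esub> funt G) = idn Z (fob G X)"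
    and fmul_braided: "\<lbrakk>X \<in> obj V; Y \<in> obj V\<rbrakk> \<Longrightarrow>
      far G (brd V X Y) \<cdot>\<^bsub>Z\<^esub> fmul G X Y = fmul G Y X \<cdot>\<^bsub>Z\<^esub> brd Z (fob G X) (fob G Y)"

definition relative_center :: "('k, 'v, 'w, 'z) brcat_scheme \<Rightarrow> ('k, 'o, 'a, 'y) moncat_scheme \<Rightarrow>
    ('v, 'w, 'o \<times> ('o \<Rightarrow> 'a), 'a, 'x) monfctr_scheme \<Rightarrow> ('k, 'o \<times> ('o \<Rightarrow> 'a), 'a) brcat" where
  "relative_center V C G = (center C)\<lparr>obj := {A \<in> obj (center C). \<forall>X\<in>obj V.
     brd (center C) (fob G X) A \<cdot>\<^bsub>C\<^esub> brd (center C) A (fob G X) =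
     idn (center C) (A \<otimes>\<^bsub>center C\<^esub> fob G X)}\<rparr>"

section \<open>Module categories\<close>

text \<open>
  The associativity isomorphisms \<open>asc M X Y N : (X \<otimes> Y) \<rhd> N \<rightarrow> X \<rhd> (Y \<rhd> N)\<close> and the unit isomorphisms
  \<open>lun M N : 1 \<rhd> N \<rightarrow> N\<close> are part of the data and occur explicitly in all formulas.
\<close>

record ('k, 'c, 'e, 'o, 'a) modcat = "('k, 'o, 'a) lincat" +
  aob :: "'c \<Rightarrow> 'o \<Rightarrow> 'o" (infixr "\<rhd>\<index>" 65)
  aar :: "'e \<Rightarrow> 'a \<Rightarrow> 'a" (infixr "\<unrhd>\<index>" 65)
  asc :: "'c \<Rightarrow> 'c \<Rightarrow> 'o \<Rightarrow> 'a"
  lun :: "'o \<Rightarrow> 'a"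

locale module_category = strict_monoidal_category C + M: finite_category M
  for C :: "('k::field, 'c, 'e, 'z) moncat_scheme"
    and M :: "('k, 'c, 'e, 'o, 'a) modcat" +
  assumes aob_obj: "\<lbrakk>X \<in> obj C; N \<in> obj M\<rbrakk> \<Longrightarrow> X \<rhd>\<^bsub>M\<^esub> N \<in> obj M"
    and aar_in: "\<lbrakk>X \<in> obj C; X' \<in> obj C; N \<in> obj M; N' \<in> obj M; f \<in> hom C X X'; g \<in> hom M N N'\<rbrakk>
      \<Longrightarrow> f \<unrhd>\<^bsub>M\<^esub> g \<in> hom M (X \<rhd>\<^bsub>M\<^esub> N) (X' \<rhd>\<^bsub>M\<^esub> N')"
    and aar_idn: "\<lbrakk>X \<in> obj C; N \<in> obj M\<rbrakk> \<Longrightarrow> idn C X \<unrhd>\<^bsub>M\<^esub> idn M N = idn M (X \<rhd>\<^bsub>M\<^esub> N)"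
    and aar_cmp: "\<lbrakk>X \<in> obj C; X' \<in> obj C; X'' \<in> obj C; N \<in> obj M; N' \<in> obj M; N'' \<in> obj M;
        f \<in> hom C X X'; f' \<in> hom C X' X''; g \<in> hom M N N'; g' \<in> hom M N' N''\<rbrakk>
      \<Longrightarrow> (f' \<cdot>\<^bsub>C\<^esub> f) \<unrhd>\<^bsub>M\<^esub> (g' \<cdot>\<^bsub>M\<^esub> g) = (f' \<unrhd>\<^bsub>M\<^esub> g') \<cdot>\<^bsub>M\<^esub> (f \<unrhd>\<^bsub>M\<^esub> g)"
    and aar_pls_left: "\<lbrakk>X \<in> obj C; X' \<in> obj C; N \<in> obj M; N' \<in> obj M;
        f \<in> hom C X X'; f' \<in> hom C X X'; g \<in> hom M N N'\<rbrakk>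
      \<Longrightarrow> (f \<oplus>\<^bsub>C\<^esub> f') \<unrhd>\<^bsub>M\<^esub> g = (f \<unrhd>\<^bsub>M\<^esub> g) \<oplus>\<^bsub>M\<^esub> (f' \<unrhd>\<^bsub>M\<^esub> g)"
    and aar_pls_right: "\<lbrakk>X \<in> obj C; X' \<in> obj C; N \<in> obj M; N' \<in> obj M;
        f \<in> hom C X X'; g \<in> hom M N N'; g' \<in> hom M N N'\<rbrakk>
      \<Longrightarrow> f \<unrhd>\<^bsub>M\<^esub> (g \<oplus>\<^bsub>M\<^esub> g') = (f \<unrhd>\<^bsub>M\<^esub> g) \<oplus>\<^bsub>M\<^esub> (f \<unrhd>\<^bsub>M\<^esub> g')"
    and aar_scl_left: "\<lbrakk>X \<in> obj C; X' \<in> obj C; N \<in> obj M; N' \<in> obj M; f \<in> hom C X X'; g \<in> hom M N N'\<rbrakk>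
      \<Longrightarrow> scl C a f \<unrhd>\<^bsub>M\<^esub> g = scl M a (f \<unrhd>\<^bsub>M\<^esub> g)"
    and aar_scl_right: "\<lbrakk>X \<in> obj C; X' \<in> obj C; N \<in> obj M; N' \<in> obj M; f \<in> hom C X X'; g \<in> hom M N N'\<rbrakk>
      \<Longrightarrow> f \<unrhd>\<^bsub>M\<^esub> scl M a g = scl M a (f \<unrhd>\<^bsub>M\<^esub> g)"
    and asc_iso: "\<lbrakk>X \<in> obj C; Y \<in> obj C; N \<in> obj M\<rbrakk> \<Longrightarrow>
      is_iso M ((X \<otimes>\<^bsub>C\<^esub> Y) \<rhd>\<^bsub>M\<^esub> N) (X \<rhd>\<^bsub>M\<^esub> Y \<rhd>\<^bsub>M\<^esub> N) (asc M X Y N)"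
    and asc_natural: "\<lbrakk>X \<in> obj C; X' \<in> obj C; Y \<in> obj C; Y' \<in> obj C; N \<in> obj M; N' \<in> obj M;
        f \<in> hom C X X'; f' \<in> hom C Y Y'; g \<in> hom M N N'\<rbrakk> \<Longrightarrow>
      asc M X' Y' N' \<cdot>\<^bsub>M\<^esub> ((f \<boxtimes>\<^bsub>C\<^esub> f') \<unrhd>\<^bsub>M\<^esub> g) = (f \<unrhd>\<^bsub>M\<^esub> f' \<unrhd>\<^bsub>M\<^esub> g) \<cdot>\<^bsub>M\<^esub> asc M X Y N"
    and lun_iso: "N \<in> obj M \<Longrightarrow> is_iso M (unt C \<rhd>\<^bsub>M\<^esub> N) N (lun M N)"
    and lun_natural: "\<lbrakk>N \<in> obj M; N' \<in> obj M; g \<in> hom M N N'\<rbrakk> \<Longrightarrow>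
      lun M N' \<cdot>\<^bsub>M\<^esub> (idn C (unt C) \<unrhd>\<^bsub>M\<^esub> g) = g \<cdot>\<^bsub>M\<^esub> lun M N"
    and pentagon: "\<lbrakk>X \<in> obj C; Y \<in> obj C; Z \<in> obj C; N \<in> obj M\<rbrakk> \<Longrightarrow>
      asc M X Y (Z \<rhd>\<^bsub>M\<^esub> N) \<cdot>\<^bsub>M\<^esub> asc M (X \<otimes>\<^bsub>C\<^esub> Y) Z N =
      (idn C X \<unrhd>\<^bsub>M\<^esub> asc M Y Z N) \<cdot>\<^bsub>M\<^esub> asc M X (Y \<otimes>\<^bsub>C\<^esub> Z) N"
    and unit_triangle: "\<lbrakk>X \<in> obj C; N \<in> obj M\<rbrakk> \<Longrightarrow>
      (idn C X \<unrhd>\<^bsub>M\<^esub> lun M N) \<cdot>\<^bsub>M\<^esub> asc M X (unt C) N = idn M (X \<rhd>\<^bsub>M\<^esub> N)"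

locale module_functor = linear_functor M N F
  for C :: "('k::field, 'c, 'e, 'z) moncat_scheme"
    and M :: "('k, 'c, 'e, 'o, 'a) modcat"
    and N :: "('k, 'c, 'e, 'p, 'b) modcat"
    and F :: "('o, 'a, 'p, 'b) fctr"
    and s :: "'c \<Rightarrow> 'o \<Rightarrow> 'b" +
  assumes str_iso: "\<lbrakk>X \<in> obj C; K \<in> obj M\<rbrakk> \<Longrightarrow>
      is_iso N (fob F (X \<rhd>\<^bsub>M\<^esub> K)) (X \<rhd>\<^bsub>N\<^esub> fob F K) (s X K)"
    and str_natural: "\<lbrakk>X \<in> obj C; X' \<in> obj C; K \<in> obj M; K' \<in> obj M; f \<in> hom C X X'; g \<in> hom M K K'\<rbrakk>
      \<Longrightarrow> s X' K' \<cdot>\<^bsub>N\<^esub> far F (f \<unrhd>\<^bsub>M\<^esub> g) = (f \<unrhd>\<^bsub>N\<^esub> far F g) \<cdot>\<^bsub>N\<^esub> s X K"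
    and str_tob: "\<lbrakk>X \<in> obj C; Y \<in> obj C; K \<in> obj M\<rbrakk> \<Longrightarrow>
      (idn C X \<unrhd>\<^bsub>N\<^esub> s Y K) \<cdot>\<^bsub>N\<^esub> s X (Y \<rhd>\<^bsub>M\<^esub> K) \<cdot>\<^bsub>N\<^esub> far F (asc M X Y K) =
      asc N X Y (fob F K) \<cdot>\<^bsub>N\<^esub> s (X \<otimes>\<^bsub>C\<^esub> Y) K"
    and str_unt: "K \<in> obj M \<Longrightarrow> lun N (fob F K) \<cdot>\<^bsub>N\<^esub> s (unt C) K = far F (lun M K)"

definition module_equivalent :: "('k::field, 'c, 'e, 'z) moncat_scheme \<Rightarrow>
    ('k, 'c, 'e, 'o, 'a) modcat \<Rightarrow> ('k, 'c, 'e, 'p, 'b) modcat \<Rightarrow> bool" where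
  "module_equivalent C M N \<longleftrightarrow> (\<exists>F s. module_functor C M N F s \<and>
     (\<forall>K\<in>obj M. \<forall>L\<in>obj M. bij_betw (far F) (hom M K L) (hom N (fob F K) (fob F L))) \<and>
     (\<forall>L\<in>obj N. \<exists>K\<in>obj M. \<exists>f. is_iso N (fob F K) L f))"

definition module_sum :: "('k, 'c, 'e, 'o, 'a) modcat \<Rightarrow> ('k, 'c, 'e, 'p, 'b) modcat \<Rightarrow>
    ('k, 'c, 'e, 'o \<times> 'p, 'a \<times> 'b) modcat" where
  "module_sum M N = \<lparr>
     obj = obj M \<times> obj N,
     hom = (\<lambda>K L. hom M (fst K) (fst L) \<times> hom N (snd K) (snd L)),
     idn = (\<lambda>K. (idn M (fst K), idn N (snd K))),
     cmp = (\<lambda>g f. (fst g \<cdot>\<^bsub>M\<^esub> fst f, snd g \<cdot>\<^bsub>N\<^esub> snd f)),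
     zer = (\<lambda>K L. (zer M (fst K) (fst L), zer N (snd K) (snd L))),
     pls = (\<lambda>f g. (fst f \<oplus>\<^bsub>M\<^esub> fst g, snd f \<oplus>\<^bsub>N\<^esub> snd g)),
     scl = (\<lambda>a f. (scl M a (fst f), scl N a (snd f))),
     aob = (\<lambda>X K. (X \<rhd>\<^bsub>M\<^esub> fst K, X \<rhd>\<^bsub>N\<^esub> snd K)),
     aar = (\<lambda>f g. (f \<unrhd>\<^bsub>M\<^esub> fst g, f \<unrhd>\<^bsub>N\<^esub> snd g)),
     asc = (\<lambda>X Y K. (asc M X Y (fst K), asc N X Y (snd K))),
     lun = (\<lambda>K. (lun M (fst K), lun N (snd K)))\<rparr>"

definition nontrivial :: "('k, 'o, 'a, 'z) lincat_scheme \<Rightarrow> bool" where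
  "nontrivial M \<longleftrightarrow> (\<exists>N\<in>obj M. \<not> zero_object M N)"

text \<open>
  The summands range over module categories carried by the types of \<open>M\<close>.  This is no restriction:
  a summand of \<open>M\<close> is equivalent to a full subcategory of \<open>M\<close>.
  As usual, the zero module category does not count as indecomposable.
\<close>

definition indecomposable :: "('k::field, 'c, 'e, 'z) moncat_scheme \<Rightarrow>
    ('k, 'c, 'e, 'o, 'a) modcat \<Rightarrow> bool" where
  "indecomposable C M \<longleftrightarrow> nontrivial M \<and>
     \<not> (\<exists>(M1 :: ('k, 'c, 'e, 'o, 'a) modcat) (M2 :: ('k, 'c, 'e, 'o, 'a) modcat).
         module_category C M1 \<and> module_category C M2 \<and> nontrivial M1 \<and> nontrivial M2 \<and>
         module_equivalent C M (module_sum M1 M2))"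

definition exact_module :: "('k, 'c, 'e, 'z) moncat_scheme \<Rightarrow> ('k, 'c, 'e, 'o, 'a) modcat \<Rightarrow> bool" where
  "exact_module C M \<longleftrightarrow> (\<forall>P N. projective C P \<and> N \<in> obj M \<longrightarrow> projective M (P \<rhd>\<^bsub>M\<^esub> N))"

text \<open>The \<open>V\<close>-module category obtained from a \<open>C\<close>-module category along \<open>G : V \<rightarrow> Z(C)\<close>.\<close>

definition restrict_module :: "('k, 'v, 'w, 'z) brcat_scheme \<Rightarrow> ('k, 'c, 'e, 'y) moncat_scheme \<Rightarrow>
    ('v, 'w, 'c \<times> ('c \<Rightarrow> 'e), 'e, 'x) monfctr_scheme \<Rightarrow> ('k, 'c, 'e, 'o, 'a) modcat \<Rightarrow>
    ('k, 'v, 'w, 'o, 'a) modcat" where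
  "restrict_module V C G M = \<lparr>
     obj = obj M, hom = hom M, idn = idn M, cmp = cmp M, zer = zer M, pls = pls M, scl = scl M,
     aob = (\<lambda>X N. fst (fob G X) \<rhd>\<^bsub>M\<^esub> N),
     aar = (\<lambda>f g. far G f \<unrhd>\<^bsub>M\<^esub> g),
     asc = (\<lambda>X Y N. asc M (fst (fob G X)) (fst (fob G Y)) N \<cdot>\<^bsub>M\<^esub>
       (arr_inv C (fst (fob G X) \<otimes>\<^bsub>C\<^esub> fst (fob G Y)) (fst (fob G (X \<otimes>\<^bsub>V\<^esub> Y))) (fmul G X Y)
         \<unrhd>\<^bsub>M\<^esub> idn M N)),
     lun = (\<lambda>N. lun M N \<cdot>\<^bsub>M\<^esub>
       (arr_inv C (unt C) (fst (fob G (unt V))) (funt G) \<unrhd>\<^bsub>M\<^esub> idn M N))\<rparr>"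

section \<open>Internal Homs\<close>

text \<open>
  \<open>ih N K\<close> represents \<open>Hom(- \<rhd> N, K)\<close> through the bijections
  \<open>phi X N K : Hom(X, ih N K) \<rightarrow> Hom(X \<rhd> N, K)\<close>.
\<close>

record ('c, 'e, 'o, 'a) ihom =
  ih :: "'o \<Rightarrow> 'o \<Rightarrow> 'c"
  phi :: "'c \<Rightarrow> 'o \<Rightarrow> 'o \<Rightarrow> 'e \<Rightarrow> 'a"

definition internal_hom :: "('k, 'c, 'e, 'z) moncat_scheme \<Rightarrow> ('k, 'c, 'e, 'o, 'a) modcat \<Rightarrow>
    ('c, 'e, 'o, 'a) ihom \<Rightarrow> bool" where
  "internal_hom C M I \<longleftrightarrow> (\<forall>N\<in>obj M. \<forall>K\<in>obj M. ih I N K \<in> obj C \<and>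
     (\<forall>X\<in>obj C. bij_betw (phi I X N K) (hom C X (ih I N K)) (hom M (X \<rhd>\<^bsub>M\<^esub> N) K)) \<and>
     (\<forall>X\<in>obj C. \<forall>Y\<in>obj C. \<forall>f\<in>hom C X Y. \<forall>g\<in>hom C Y (ih I N K).
        phi I X N K (g \<cdot>\<^bsub>C\<^esub> f) = phi I Y N K g \<cdot>\<^bsub>M\<^esub> (f \<unrhd>\<^bsub>M\<^esub> idn M N)))"

section \<open>Relative ends\<close>

text \<open>
  A functor \<open>S : M\<^sup>o\<^sup>p \<times> M \<rightarrow> A\<close>: for \<open>f : N' \<rightarrow> N\<close> and \<open>g : K \<rightarrow> K'\<close>,
  \<open>spre S N' N K f\<close> is \<open>S(f, id) : S(N, K) \<rightarrow> S(N', K)\<close> and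
  \<open>spost S N K K' g\<close> is \<open>S(id, g) : S(N, K) \<rightarrow> S(N, K')\<close>.
\<close>

record ('o, 'a, 'p, 'b) bifctr =
  sob :: "'o \<Rightarrow> 'o \<Rightarrow> 'p"
  spre :: "'o \<Rightarrow> 'o \<Rightarrow> 'o \<Rightarrow> 'a \<Rightarrow> 'b"
  spost :: "'o \<Rightarrow> 'o \<Rightarrow> 'o \<Rightarrow> 'a \<Rightarrow> 'b"

text \<open>The morphism \<open>ev\<^sub>X \<rhd> id : D \<rhd> (X \<rhd> N) \<rightarrow> N\<close>, where \<open>ev : D \<otimes> X \<rightarrow> 1\<close>.\<close>

definition ev_act :: "('k, 'v, 'w, 'z) moncat_scheme \<Rightarrow> ('k, 'v, 'w, 'o, 'a) modcat \<Rightarrow>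
    'v \<Rightarrow> 'v \<Rightarrow> 'w \<Rightarrow> 'o \<Rightarrow> 'a" where
  "ev_act V M D X ev N = lun M N \<cdot>\<^bsub>M\<^esub> (ev \<unrhd>\<^bsub>M\<^esub> idn M N) \<cdot>\<^bsub>M\<^esub>
     arr_inv M ((D \<otimes>\<^bsub>V\<^esub> X) \<rhd>\<^bsub>M\<^esub> N) (D \<rhd>\<^bsub>M\<^esub> X \<rhd>\<^bsub>M\<^esub> N) (asc M D X N)"

text \<open>
  In the following \<open>dl X\<close> is the left dual of \<open>X\<close> with evaluation \<open>ev X\<close>, and
  \<open>\<beta> X N K : S(N, X \<rhd> K) \<rightarrow> S(dl X \<rhd> N, K)\<close> is the prebalancing.
\<close>

definition relative_wedge :: "('k, 'v, 'w, 'z) moncat_scheme \<Rightarrow> ('v \<Rightarrow> 'v) \<Rightarrow> ('v \<Rightarrow> 'w) \<Rightarrow>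
    ('k, 'v, 'w, 'o, 'a) modcat \<Rightarrow> ('k, 'p, 'b, 'y) lincat_scheme \<Rightarrow> ('o, 'a, 'p, 'b) bifctr \<Rightarrow>
    ('v \<Rightarrow> 'o \<Rightarrow> 'o \<Rightarrow> 'b) \<Rightarrow> 'p \<times> ('o \<Rightarrow> 'b) \<Rightarrow> bool" where
  "relative_wedge V dl ev M A S \<beta> = (\<lambda>(E, \<pi>). E \<in> obj A \<and>
     (\<forall>N\<in>obj M. \<pi> N \<in> hom A E (sob S N N)) \<and>
     (\<forall>N\<in>obj M. \<forall>K\<in>obj M. \<forall>f\<in>hom M N K. spost S N N K f \<cdot>\<^bsub>A\<^esub> \<pi> N = spre S N K K f \<cdot>\<^bsub>A\<^esub> \<pi> K) \<and>
     (\<forall>X\<in>obj V. \<forall>N\<in>obj M.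
        spre S (dl X \<rhd>\<^bsub>M\<^esub> X \<rhd>\<^bsub>M\<^esub> N) N N (ev_act V M (dl X) X (ev X) N) \<cdot>\<^bsub>A\<^esub> \<pi> N =
        \<beta> X (X \<rhd>\<^bsub>M\<^esub> N) N \<cdot>\<^bsub>A\<^esub> \<pi> (X \<rhd>\<^bsub>M\<^esub> N)))"

definition relative_end :: "('k, 'v, 'w, 'z) moncat_scheme \<Rightarrow> ('v \<Rightarrow> 'v) \<Rightarrow> ('v \<Rightarrow> 'w) \<Rightarrow>
    ('k, 'v, 'w, 'o, 'a) modcat \<Rightarrow> ('k, 'p, 'b, 'y) lincat_scheme \<Rightarrow> ('o, 'a, 'p, 'b) bifctr \<Rightarrow>
    ('v \<Rightarrow> 'o \<Rightarrow> 'o \<Rightarrow> 'b) \<Rightarrow> 'p \<times> ('o \<Rightarrow> 'b) \<Rightarrow> bool" where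
  "relative_end V dl ev M A S \<beta> = (\<lambda>(E, \<pi>). relative_wedge V dl ev M A S \<beta> (E, \<pi>) \<and>
     (\<forall>E' \<pi>'. relative_wedge V dl ev M A S \<beta> (E', \<pi>') \<longrightarrow>
        (\<exists>!f. f \<in> hom A E' E \<and> (\<forall>N\<in>obj M. \<pi> N \<cdot>\<^bsub>A\<^esub> f = \<pi>' N))))"

section \<open>The right adjoint of the action functor and the algebra\<close>

text \<open>
  Data: chosen left duals \<open>dl\<close>, \<open>ev\<close> in \<open>V\<close>, chosen internal Homs \<open>I\<close>, and, for every object
  \<open>(F, d)\<close> of the category of right exact \<open>V\<close>-module endofunctors of \<open>M\<close>, the object and the
  dinatural family \<open>R (F, d)\<close> of a relative end.  Nothing is assumed here; the constants below only
  make sense under the hypotheses of the main theorem.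
\<close>

locale central_module_data =
  fixes V :: "('k::field, 'v, 'w) brcat"
    and dl :: "'v \<Rightarrow> 'v"
    and ev :: "'v \<Rightarrow> 'w"
    and C :: "('k, 'c, 'e) moncat"
    and G :: "('v, 'w, 'c \<times> ('c \<Rightarrow> 'e), 'e) monfctr"
    and M :: "('k, 'c, 'e, 'o, 'a) modcat"
    and I :: "('c, 'e, 'o, 'a) ihom"
    and R :: "('o, 'a, 'o, 'a) fctr \<times> ('v \<Rightarrow> 'o \<Rightarrow> 'a) \<Rightarrow> 'c \<times> ('o \<Rightarrow> 'e)"
begin

abbreviation MV :: "('k, 'v, 'w, 'o, 'a) modcat" where
  "MV \<equiv> restrict_module V C G M"

abbreviation Gob :: "'v \<Rightarrow> 'c" where
  "Gob X \<equiv> fst (fob G X)"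

abbreviation Gbr :: "'v \<Rightarrow> 'c \<Rightarrow> 'e" where
  "Gbr X \<equiv> snd (fob G X)"

abbreviation asc_inv :: "'c \<Rightarrow> 'c \<Rightarrow> 'o \<Rightarrow> 'a" where
  "asc_inv X Y N \<equiv> arr_inv M ((X \<otimes>\<^bsub>C\<^esub> Y) \<rhd>\<^bsub>M\<^esub> N) (X \<rhd>\<^bsub>M\<^esub> Y \<rhd>\<^bsub>M\<^esub> N) (asc M X Y N)"

text \<open>The evaluation \<open>G(X\<^sup>*) \<otimes> G(X) \<rightarrow> 1\<close> which identifies \<open>G(X\<^sup>*)\<close> with \<open>G(X)\<^sup>*\<close>.\<close>

definition evG :: "'v \<Rightarrow> 'e" where
  "evG X = arr_inv C (unt C) (Gob (unt V)) (funt G) \<cdot>\<^bsub>C\<^esub> far G (ev X) \<cdot>\<^bsub>C\<^esub> fmul G (dl X) X"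

text \<open>\<open>\<sigma>\<^sup>-\<^sup>1 \<rhd> id : Y \<rhd> (G(X) \<rhd> N) \<rightarrow> G(X) \<rhd> (Y \<rhd> N)\<close>.\<close>

definition swap :: "'v \<Rightarrow> 'c \<Rightarrow> 'o \<Rightarrow> 'a" where
  "swap X Y N = asc M (Gob X) Y N \<cdot>\<^bsub>M\<^esub>
     (arr_inv C (Gob X \<otimes>\<^bsub>C\<^esub> Y) (Y \<otimes>\<^bsub>C\<^esub> Gob X) (Gbr X Y) \<unrhd>\<^bsub>M\<^esub> idn M N) \<cdot>\<^bsub>M\<^esub> asc_inv Y (Gob X) N"

subsection \<open>Module endofunctors\<close>

definition EndV :: "(('o, 'a, 'o, 'a) fctr \<times> ('v \<Rightarrow> 'o \<Rightarrow> 'a)) set" where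
  "EndV = {(F, d). module_functor V MV MV F d \<and> right_exact M M F}"

definition IdV :: "('o, 'a, 'o, 'a) fctr \<times> ('v \<Rightarrow> 'o \<Rightarrow> 'a)" where
  "IdV = (\<lparr>fob = (\<lambda>N. N), far = (\<lambda>f. f)\<rparr>, \<lambda>X N. idn M (Gob X \<rhd>\<^bsub>M\<^esub> N))"

definition compV :: "('o, 'a, 'o, 'a) fctr \<times> ('v \<Rightarrow> 'o \<Rightarrow> 'a) \<Rightarrow>
    ('o, 'a, 'o, 'a) fctr \<times> ('v \<Rightarrow> 'o \<Rightarrow> 'a) \<Rightarrow> ('o, 'a, 'o, 'a) fctr \<times> ('v \<Rightarrow> 'o \<Rightarrow> 'a)" where
  "compV = (\<lambda>(F, d) (F', d').
     (\<lparr>fob = (\<lambda>N. fob F (fob F' N)), far = (\<lambda>f. far F (far F' f))\<rparr>,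
      \<lambda>X N. d X (fob F' N) \<cdot>\<^bsub>M\<^esub> far F (d' X N)))"

definition lactV :: "'c \<Rightarrow> ('o, 'a, 'o, 'a) fctr \<times> ('v \<Rightarrow> 'o \<Rightarrow> 'a) \<Rightarrow>
    ('o, 'a, 'o, 'a) fctr \<times> ('v \<Rightarrow> 'o \<Rightarrow> 'a)" where
  "lactV Y = (\<lambda>(F, d).
     (\<lparr>fob = (\<lambda>N. Y \<rhd>\<^bsub>M\<^esub> fob F N), far = (\<lambda>f. idn C Y \<unrhd>\<^bsub>M\<^esub> far F f)\<rparr>,
      \<lambda>X N. swap X Y (fob F N) \<cdot>\<^bsub>M\<^esub> (idn C Y \<unrhd>\<^bsub>M\<^esub> d X N)))"

definition ractV :: "('o, 'a, 'o, 'a) fctr \<times> ('v \<Rightarrow> 'o \<Rightarrow> 'a) \<Rightarrow> 'c \<Rightarrow>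
    ('o, 'a, 'o, 'a) fctr \<times> ('v \<Rightarrow> 'o \<Rightarrow> 'a)" where
  "ractV = (\<lambda>(F, d) Y.
     (\<lparr>fob = (\<lambda>N. fob F (Y \<rhd>\<^bsub>M\<^esub> N)), far = (\<lambda>f. far F (idn C Y \<unrhd>\<^bsub>M\<^esub> f))\<rparr>,
      \<lambda>X N. d X (Y \<rhd>\<^bsub>M\<^esub> N) \<cdot>\<^bsub>M\<^esub> far F (swap X Y N)))"

definition rho :: "'c \<Rightarrow> ('o, 'a, 'o, 'a) fctr \<times> ('v \<Rightarrow> 'o \<Rightarrow> 'a)" where
  "rho Y = (\<lparr>fob = (\<lambda>N. Y \<rhd>\<^bsub>M\<^esub> N), far = (\<lambda>f. idn C Y \<unrhd>\<^bsub>M\<^esub> f)\<rparr>, \<lambda>X N. swap X Y N)"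

subsection \<open>Structure morphisms of the internal Hom\<close>

definition psi :: "'c \<Rightarrow> 'o \<Rightarrow> 'o \<Rightarrow> 'a \<Rightarrow> 'e" where
  "psi X N K = inv_into (hom C X (ih I N K)) (phi I X N K)"

definition icoev :: "'c \<Rightarrow> 'o \<Rightarrow> 'e" where
  "icoev X N = psi X N (X \<rhd>\<^bsub>M\<^esub> N) (idn M (X \<rhd>\<^bsub>M\<^esub> N))"

definition iev :: "'o \<Rightarrow> 'o \<Rightarrow> 'a" where
  "iev N K = phi I (ih I N K) N K (idn C (ih I N K))"

text \<open>The two partial actions of the bifunctor internal Hom on \<open>f : N' \<rightarrow> N\<close> and \<open>g : K \<rightarrow> K'\<close>;
  they are the ones for which \<open>phi\<close> is natural in \<open>N\<close> and \<open>K\<close>.\<close>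

definition ipre :: "'o \<Rightarrow> 'o \<Rightarrow> 'o \<Rightarrow> 'a \<Rightarrow> 'e" where
  "ipre N' N K f = psi (ih I N K) N' K (iev N K \<cdot>\<^bsub>M\<^esub> (idn C (ih I N K) \<unrhd>\<^bsub>M\<^esub> f))"

definition ipost :: "'o \<Rightarrow> 'o \<Rightarrow> 'o \<Rightarrow> 'a \<Rightarrow> 'e" where
  "ipost N K K' g = psi (ih I N K) N K' (g \<cdot>\<^bsub>M\<^esub> iev N K)"

text \<open>\<open>\<aa>\<^sup>-\<^sup>1 : X \<otimes> ih N K \<rightarrow> ih N (X \<rhd> K)\<close> and \<open>\<bb> : ih (X \<rhd> N) K \<otimes> X \<rightarrow> ih N K\<close>.\<close>

definition ia_inv :: "'c \<Rightarrow> 'o \<Rightarrow> 'o \<Rightarrow> 'e" where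
  "ia_inv X N K =
     ipost N ((X \<otimes>\<^bsub>C\<^esub> ih I N K) \<rhd>\<^bsub>M\<^esub> N) (X \<rhd>\<^bsub>M\<^esub> K)
       ((idn C X \<unrhd>\<^bsub>M\<^esub> iev N K) \<cdot>\<^bsub>M\<^esub> asc M X (ih I N K) N) \<cdot>\<^bsub>C\<^esub>
     icoev (X \<otimes>\<^bsub>C\<^esub> ih I N K) N"

definition ib :: "'c \<Rightarrow> 'o \<Rightarrow> 'o \<Rightarrow> 'e" where
  "ib X N K =
     ipost N ((ih I (X \<rhd>\<^bsub>M\<^esub> N) K \<otimes>\<^bsub>C\<^esub> X) \<rhd>\<^bsub>M\<^esub> N) K
       (iev (X \<rhd>\<^bsub>M\<^esub> N) K \<cdot>\<^bsub>M\<^esub> asc M (ih I (X \<rhd>\<^bsub>M\<^esub> N) K) X N) \<cdot>\<^bsub>C\<^esub>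
     icoev (ih I (X \<rhd>\<^bsub>M\<^esub> N) K \<otimes>\<^bsub>C\<^esub> X) N"

subsection \<open>The functor \<open>rho_bar\<close>\<close>

text \<open>\<open>gam (F, d) X Y N K\<close> sends \<open>f : Y \<rhd> N \<rightarrow> F(G(X) \<rhd> K)\<close> to a morphism \<open>Y \<rhd> (G(X\<^sup>*) \<rhd> N) \<rightarrow> F(K)\<close>.\<close>

definition gam :: "('o, 'a, 'o, 'a) fctr \<times> ('v \<Rightarrow> 'o \<Rightarrow> 'a) \<Rightarrow> 'v \<Rightarrow> 'c \<Rightarrow> 'o \<Rightarrow> 'o \<Rightarrow> 'a \<Rightarrow> 'a" where
  "gam = (\<lambda>(F, d) X Y N K f.
     lun M (fob F K) \<cdot>\<^bsub>M\<^esub> (evG X \<unrhd>\<^bsub>M\<^esub> idn M (fob F K)) \<cdot>\<^bsub>M\<^esub>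
     asc_inv (Gob (dl X)) (Gob X) (fob F K) \<cdot>\<^bsub>M\<^esub>
     (idn C (Gob (dl X)) \<unrhd>\<^bsub>M\<^esub> (d X K \<cdot>\<^bsub>M\<^esub> f)) \<cdot>\<^bsub>M\<^esub> swap (dl X) Y N)"

definition bet :: "('o, 'a, 'o, 'a) fctr \<times> ('v \<Rightarrow> 'o \<Rightarrow> 'a) \<Rightarrow> 'v \<Rightarrow> 'o \<Rightarrow> 'o \<Rightarrow> 'e" where
  "bet Fd X N K = (let L = fob (fst Fd) (Gob X \<rhd>\<^bsub>M\<^esub> K) in
     psi (ih I N L) (Gob (dl X) \<rhd>\<^bsub>M\<^esub> N) (fob (fst Fd) K) (gam Fd X (ih I N L) N K (iev N L)))"

text \<open>The bifunctor \<open>(N, K) \<mapsto> ih N (F K)\<close>.\<close>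

definition hom_bifctr :: "('o, 'a, 'o, 'a) fctr \<Rightarrow> ('o, 'a, 'c, 'e) bifctr" where
  "hom_bifctr F = \<lparr>
     sob = (\<lambda>N K. ih I N (fob F K)),
     spre = (\<lambda>N' N K f. ipre N' N (fob F K) f),
     spost = (\<lambda>N K K' g. ipost N (fob F K) (fob F K') (far F g))\<rparr>"

definition relative_ends :: bool where
  "relative_ends \<longleftrightarrow> (\<forall>Fd\<in>EndV. relative_end V dl ev MV C (hom_bifctr (fst Fd)) (bet Fd) (R Fd))"

definition rho_bar :: "('o, 'a, 'o, 'a) fctr \<times> ('v \<Rightarrow> 'o \<Rightarrow> 'a) \<Rightarrow> 'c" where
  "rho_bar Fd = fst (R Fd)"

definition end_pi :: "('o, 'a, 'o, 'a) fctr \<times> ('v \<Rightarrow> 'o \<Rightarrow> 'a) \<Rightarrow> 'o \<Rightarrow> 'e" where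
  "end_pi Fd = snd (R Fd)"

definition rho_bar_map :: "('o, 'a, 'o, 'a) fctr \<times> ('v \<Rightarrow> 'o \<Rightarrow> 'a) \<Rightarrow>
    ('o, 'a, 'o, 'a) fctr \<times> ('v \<Rightarrow> 'o \<Rightarrow> 'a) \<Rightarrow> ('o \<Rightarrow> 'a) \<Rightarrow> 'e" where
  "rho_bar_map Fd Fd' \<alpha> = (THE f. f \<in> hom C (rho_bar Fd) (rho_bar Fd') \<and> (\<forall>N\<in>obj M.
     end_pi Fd' N \<cdot>\<^bsub>C\<^esub> f = ipost N (fob (fst Fd) N) (fob (fst Fd') N) (\<alpha> N) \<cdot>\<^bsub>C\<^esub> end_pi Fd N))"

text \<open>
  Unit and counit of the canonical adjunction between \<open>rho\<close> and \<open>rho_bar\<close>, in which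
  \<open>\<alpha> : rho Y \<rightarrow> F\<close> corresponds to the \<open>f : Y \<rightarrow> rho_bar F\<close> with \<open>end_pi N \<cdot> f = psi (\<alpha> N)\<close> for all \<open>N\<close>.
\<close>

definition adj_unit :: "'c \<Rightarrow> 'e" where
  "adj_unit Y = (THE f. f \<in> hom C Y (rho_bar (rho Y)) \<and> (\<forall>N\<in>obj M.
     end_pi (rho Y) N \<cdot>\<^bsub>C\<^esub> f = icoev Y N))"

definition adj_counit :: "('o, 'a, 'o, 'a) fctr \<times> ('v \<Rightarrow> 'o \<Rightarrow> 'a) \<Rightarrow> 'o \<Rightarrow> 'a" where
  "adj_counit Fd N = phi I (rho_bar Fd) N (fob (fst Fd) N) (end_pi Fd N)"

definition r_inv :: "('o, 'a, 'o, 'a) fctr \<times> ('v \<Rightarrow> 'o \<Rightarrow> 'a) \<Rightarrow> 'c \<Rightarrow> 'e" where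
  "r_inv Fd Y =
     rho_bar_map (rho (rho_bar Fd \<otimes>\<^bsub>C\<^esub> Y)) (ractV Fd Y)
       (\<lambda>N. adj_counit Fd (Y \<rhd>\<^bsub>M\<^esub> N) \<cdot>\<^bsub>M\<^esub> asc M (rho_bar Fd) Y N) \<cdot>\<^bsub>C\<^esub>
     adj_unit (rho_bar Fd \<otimes>\<^bsub>C\<^esub> Y)"

definition l_inv :: "'c \<Rightarrow> ('o, 'a, 'o, 'a) fctr \<times> ('v \<Rightarrow> 'o \<Rightarrow> 'a) \<Rightarrow> 'e" where
  "l_inv Y Fd =
     rho_bar_map (rho (Y \<otimes>\<^bsub>C\<^esub> rho_bar Fd)) (lactV Y Fd)
       (\<lambda>N. (idn C Y \<unrhd>\<^bsub>M\<^esub> adj_counit Fd N) \<cdot>\<^bsub>M\<^esub> asc M Y (rho_bar Fd) N) \<cdot>\<^bsub>C\<^esub>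
     adj_unit (Y \<otimes>\<^bsub>C\<^esub> rho_bar Fd)"

definition l_mor :: "'c \<Rightarrow> ('o, 'a, 'o, 'a) fctr \<times> ('v \<Rightarrow> 'o \<Rightarrow> 'a) \<Rightarrow> 'e" where
  "l_mor Y Fd = arr_inv C (Y \<otimes>\<^bsub>C\<^esub> rho_bar Fd) (rho_bar (lactV Y Fd)) (l_inv Y Fd)"

text \<open>The lax monoidal structure induced by the strong monoidal structure
  \<open>rho (Y \<otimes> Y') \<cong> rho Y rho Y'\<close> (given by \<open>asc\<close>) and \<open>rho 1 \<cong> Id\<close> (given by \<open>lun\<close>) of \<open>rho\<close>.\<close>

definition lax_mult :: "('o, 'a, 'o, 'a) fctr \<times> ('v \<Rightarrow> 'o \<Rightarrow> 'a) \<Rightarrow>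
    ('o, 'a, 'o, 'a) fctr \<times> ('v \<Rightarrow> 'o \<Rightarrow> 'a) \<Rightarrow> 'e" where
  "lax_mult Fd Fd' =
     rho_bar_map (rho (rho_bar Fd \<otimes>\<^bsub>C\<^esub> rho_bar Fd')) (compV Fd Fd')
       (\<lambda>N. adj_counit Fd (fob (fst Fd') N) \<cdot>\<^bsub>M\<^esub> (idn C (rho_bar Fd) \<unrhd>\<^bsub>M\<^esub> adj_counit Fd' N) \<cdot>\<^bsub>M\<^esub>
          asc M (rho_bar Fd) (rho_bar Fd') N) \<cdot>\<^bsub>C\<^esub>
     adj_unit (rho_bar Fd \<otimes>\<^bsub>C\<^esub> rho_bar Fd')"

definition lax_unit :: "'e" where
  "lax_unit = rho_bar_map (rho (unt C)) IdV (\<lambda>N. lun M N) \<cdot>\<^bsub>C\<^esub> adj_unit (unt C)"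

subsection \<open>The category \<open>C(V, M)\<close> and the algebra\<close>

definition CVM :: "(('o, 'a, 'o, 'a) fctr \<times> ('c \<Rightarrow> 'o \<Rightarrow> 'a) \<times> ('v \<Rightarrow> 'o \<Rightarrow> 'a)) set" where
  "CVM = {(F, c, d). (F, d) \<in> EndV \<and> module_functor C M M F c \<and>
     (\<forall>Y\<in>obj C. \<forall>X\<in>obj V. \<forall>N\<in>obj M.
        (idn C (Gob X) \<unrhd>\<^bsub>M\<^esub> c Y N) \<cdot>\<^bsub>M\<^esub> snd (ractV (F, d) Y) X N =
        snd (lactV Y (F, d)) X N \<cdot>\<^bsub>M\<^esub> c Y (Gob X \<rhd>\<^bsub>M\<^esub> N)) \<and>
     (\<forall>X\<in>obj V. \<forall>N\<in>obj M. c (Gob X) N = d X N)}"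

definition IdCVM :: "('o, 'a, 'o, 'a) fctr \<times> ('c \<Rightarrow> 'o \<Rightarrow> 'a) \<times> ('v \<Rightarrow> 'o \<Rightarrow> 'a)" where
  "IdCVM = (fst IdV, (\<lambda>Y N. idn M (Y \<rhd>\<^bsub>M\<^esub> N)), snd IdV)"

definition Z_rho_bar :: "('o, 'a, 'o, 'a) fctr \<times> ('c \<Rightarrow> 'o \<Rightarrow> 'a) \<times> ('v \<Rightarrow> 'o \<Rightarrow> 'a) \<Rightarrow>
    'c \<times> ('c \<Rightarrow> 'e)" where
  "Z_rho_bar = (\<lambda>(F, c, d). (rho_bar (F, d),
     \<lambda>Y. l_mor Y (F, d) \<cdot>\<^bsub>C\<^esub> rho_bar_map (ractV (F, d) Y) (lactV Y (F, d)) (c Y) \<cdot>\<^bsub>C\<^esub> r_inv (F, d) Y))"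

end

end

theory Submission
  imports Defs
begin

text \<open>
  The relative end defining \<open>rho_bar (F, d)\<close> represents the \<open>V\<close>-module transformations from the functors
  \<open>Y \<rhd> -\<close> to \<open>F\<close>.  Hence \<open>A\<close> carries a universal transformation \<open>e : A \<rhd> - \<rightarrow> Id\<close>, and morphisms into
  \<open>A\<close>, \<open>X \<otimes> A\<close> and \<open>A \<otimes> X\<close> are determined by their composites with \<open>e\<close>.  The natural transformations
  \<open>Y \<rhd> - \<rightarrow> Z \<rhd> -\<close> are the arrows \<open>Y \<rightarrow> Z\<close> of a strict monoidal category; there the half-braiding is
  characterised by \<open>(X \<otimes> e) \<sigma>\<^sub>X = e \<otimes> X\<close> and the multiplication by \<open>e \<mu> = e \<otimes> e\<close>, so that all identities
  reduce to the interchange law.  For instance \<open>e \<mu> \<sigma>\<^sub>A = e (A \<otimes> e) \<sigma>\<^sub>A = e (e \<otimes> A) = e \<mu>\<close>, and the compatibility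
  of \<open>e\<close> with the \<open>V\<close>-module structures says that \<open>\<sigma>\<close> at \<open>G(V)\<close> is inverse to the half-braiding of \<open>G(V)\<close>.

  Morphisms \<open>1 \<rightarrow> A\<close> of the centre are the module endomorphisms \<open>\<phi>\<close> of the identity functor of \<open>M\<close>.  Since \<open>M\<close> is
  exact, \<open>\<phi>\<close> is determined by its values at the simple objects, where it is scalar.  If two of these scalars
  were different, a Lagrange interpolation polynomial in \<open>\<phi>\<close> would be a nontrivial idempotent and \<open>M\<close> would
  decompose.
\<close>

section \<open>Categories carried by types\<close>

text \<open>Objects and arrows exhaust their types, so typing conditions become equations between
  \<open>src\<close> and \<open>trg\<close> values that rewriting discharges. The associators of
  \<open>M\<close> are genuine data and would clutter every computation with \<open>e\<close>; this
  obstacle is removed by showing once, in \<open>tensor_extension_natfam\<close>, that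
  transformations between action functors satisfy strict laws when horizontal composition is
  conjugated by associators. Compatibility with the \<open>V\<close>-action becomes commutation with
  the half-braidings of the objects \<open>Gob X\<close>. That condition is closed under composition
  and tensor product, so it cuts out a smaller extension and is inherited by all composites. The
  relative end gives universality of \<open>e\<close> only for arrows into the unit object; rigidity
  of \<open>C\<close> spreads it to \<open>X \<otimes> A\<close> and \<open>A \<otimes> X\<close>.
  For connectedness the summands must be carried by the types of \<open>M\<close>, which is why
  idempotents are split inside \<open>M\<close> and the summands are full subcategories.\<close>

definition src :: "('k, 'o, 'a, 'z) lincat_scheme \<Rightarrow> 'a \<Rightarrow> 'o" where
  "src C f = fst (THE p. f \<in> hom C (fst p) (snd p))"

definition trg :: "('k, 'o, 'a, 'z) lincat_scheme \<Rightarrow> 'a \<Rightarrow> 'o" where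
  "trg C f = snd (THE p. f \<in> hom C (fst p) (snd p))"

text \<open>The description operators in \<open>src\<close> and \<open>trg\<close> are meaningful
  because \<open>on_types\<close> gives exactly one pair of end points per arrow. Membership in a
  hom-set thereby splits into two equations.\<close>

lemma on_types_hom_iff:
  assumes "on_types C"
  shows "f \<in> hom C X Y \<longleftrightarrow> src C f = X \<and> trg C f = Y"
proof -
  have ex1: "\<exists>!p. f \<in> hom C (fst p) (snd p)"
    using assms by (simp add: on_types_def)
  have "f \<in> hom C (src C f) (trg C f)"
    unfolding src_def trg_def using theI'[OF ex1] by simp
  moreover have "(X, Y) = (src C f, trg C f)" if "f \<in> hom C X Y"
    using ex1 that calculation by (metis fst_conv snd_conv)
  ultimately show ?thesis by auto
qed

locale typed_category = linear_category C
  for C :: "('k::field, 'o, 'a, 'z) lincat_scheme" (structure) +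
  assumes typed: "on_types C"
begin

lemma obj_UNIV [simp]: "X \<in> obj C"
  using typed by (simp add: on_types_def)

lemma hom_iff: "f \<in> hom C X Y \<longleftrightarrow> src C f = X \<and> trg C f = Y"
  by (rule on_types_hom_iff[OF typed])

lemma src_idn [simp]: "src C (idn C X) = X" and trg_idn [simp]: "trg C (idn C X) = X"
  using idn_in[of X] by (simp_all add: hom_iff)

lemma src_cmp [simp]: "trg C f = src C g \<Longrightarrow> src C (g \<cdot> f) = src C f"
  and trg_cmp [simp]: "trg C f = src C g \<Longrightarrow> trg C (g \<cdot> f) = trg C g"
  using cmp_in[of "src C f" "src C g" "trg C g" f g] by (auto simp: hom_iff)

lemma cmp_assoc_typed [simp]:
  "\<lbrakk>trg C f = src C g; trg C g = src C h\<rbrakk> \<Longrightarrow> (h \<cdot> g) \<cdot> f = h \<cdot> (g \<cdot> f)"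
  using cmp_assoc[of "src C f" "src C g" "src C h" "trg C h" f g h] by (auto simp: hom_iff)

lemma idn_cmp [simp]: "trg C f = Y \<Longrightarrow> idn C Y \<cdot> f = f"
  and cmp_idn [simp]: "src C f = X \<Longrightarrow> f \<cdot> idn C X = f"
  using idn_left[of X Y f] idn_left[of "src C f" "trg C f" f] idn_right[of "src C f" "trg C f" f]
  by (auto simp: hom_iff)

lemma inverses_iff: "inverses C X Y f g \<longleftrightarrow> src C f = X \<and> trg C f = Y \<and> src C g = Y \<and> trg C g = X \<and>
    g \<cdot> f = idn C X \<and> f \<cdot> g = idn C Y"
  by (auto simp: inverses_def hom_iff)

lemma inverses_unique:
  assumes "inverses C X Y f g" "inverses C X Y f h"
  shows "g = h"
proof -
  have "(h \<cdot> f) \<cdot> g = h \<cdot> (f \<cdot> g)" using assms by (intro cmp_assoc_typed) (simp_all add: inverses_iff)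
  moreover have "(h \<cdot> f) \<cdot> g = g" "h \<cdot> (f \<cdot> g) = h"
    using assms by (simp_all add: inverses_iff del: cmp_assoc_typed)
  ultimately show ?thesis by simp
qed

lemma arr_inv_eq: "inverses C X Y f g \<Longrightarrow> arr_inv C X Y f = g"
  unfolding arr_inv_def using inverses_unique by blast

lemma inverses_arr_inv: "is_iso C X Y f \<Longrightarrow> inverses C X Y f (arr_inv C X Y f)"
  unfolding is_iso_def using arr_inv_eq by metis

lemma
  assumes "is_iso C X Y f"
  shows src_arr_inv [simp]: "src C (arr_inv C X Y f) = Y"
    and trg_arr_inv [simp]: "trg C (arr_inv C X Y f) = X"
    and arr_inv_cmp [simp]: "arr_inv C X Y f \<cdot> f = idn C X"
    and cmp_arr_inv [simp]: "f \<cdot> arr_inv C X Y f = idn C Y"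
    and src_iso: "src C f = X"
    and trg_iso: "trg C f = Y"
  using inverses_arr_inv[OF assms] by (simp_all add: inverses_iff)

lemma arr_inv_cmp_assoc [simp]:
  assumes "is_iso C X Y f" "trg C h = X" shows "arr_inv C X Y f \<cdot> (f \<cdot> h) = h"
  using assms by (simp add: src_iso trg_iso flip: cmp_assoc_typed)

lemma cmp_arr_inv_assoc [simp]:
  assumes "is_iso C X Y f" "trg C h = Y" shows "f \<cdot> (arr_inv C X Y f \<cdot> h) = h"
  using assms by (simp add: src_iso trg_iso flip: cmp_assoc_typed)

lemma is_isoI:
  assumes "src C f = X" "trg C f = Y" "src C g = Y" "trg C g = X" "g \<cdot> f = idn C X" "f \<cdot> g = idn C Y"
  shows "is_iso C X Y f"
  using assms by (auto simp: is_iso_def inverses_iff)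

lemma is_iso_idn [simp]: "is_iso C X X (idn C X)"
  by (rule is_isoI[of _ _ _ "idn C X"]) simp_all

lemma cmp_left_cancel_iso:
  assumes "is_iso C X Y f" "trg C g = X" "trg C h = X" "f \<cdot> g = f \<cdot> h"
  shows "g = h"
  using assms arr_inv_cmp_assoc[OF assms(1)] by metis

lemma cmp_right_cancel_iso:
  assumes iso: "is_iso C X Y f" and "src C g = Y" "src C h = Y" "g \<cdot> f = h \<cdot> f"
  shows "g = h"
proof -
  have "(g \<cdot> f) \<cdot> arr_inv C X Y f = (h \<cdot> f) \<cdot> arr_inv C X Y f" using assms by simp
  then show ?thesis using assms(2,3) iso by (simp add: src_iso[OF iso] trg_iso[OF iso])
qed

lemma is_iso_cmp:
  assumes f: "is_iso C X Y f" and g: "is_iso C Y Z g"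
  shows "is_iso C X Z (g \<cdot> f)"
  using assms
  by (intro is_isoI[of _ _ _ "arr_inv C X Y f \<cdot> arr_inv C Y Z g"])
    (simp_all add: src_iso[OF f] trg_iso[OF f] src_iso[OF g] trg_iso[OF g])

end

locale typed_monoidal_category = typed_category C + strict_monoidal_category C
  for C :: "('k::field, 'o, 'a, 'z) moncat_scheme" (structure)
begin

lemma src_tar [simp]: "src C (f \<boxtimes> g) = src C f \<otimes> src C g"
  and trg_tar [simp]: "trg C (f \<boxtimes> g) = trg C f \<otimes> trg C g"
  using tar_in[of "src C f" "trg C f" "src C g" "trg C g" f g] by (auto simp: hom_iff)

lemma tob_assoc_typed [simp]: "(X \<otimes> Y) \<otimes> Z = X \<otimes> (Y \<otimes> Z)"
  by (simp add: tob_assoc)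

lemma tob_unit_typed [simp]: "unt C \<otimes> X = X" "X \<otimes> unt C = X"
  by (simp_all add: tob_unit)

lemma tar_assoc_typed: "(f \<boxtimes> g) \<boxtimes> h = f \<boxtimes> (g \<boxtimes> h)"
  by (rule tar_assoc[of "src C f" "trg C f" "src C g" "trg C g" "src C h" "trg C h"])
    (simp_all add: hom_iff)

lemma tar_unit_typed [simp]: "idn C (unt C) \<boxtimes> f = f" "f \<boxtimes> idn C (unt C) = f"
  using tar_unit[of "src C f" "trg C f" f] by (simp_all add: hom_iff)

lemma tar_idn_typed [simp]: "idn C X \<boxtimes> idn C Y = idn C (X \<otimes> Y)"
  by (simp add: tar_idn)

lemma tar_cmp_typed: "\<lbrakk>trg C f = src C f'; trg C g = src C g'\<rbrakk> \<Longrightarrow>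
    (f' \<boxtimes> g') \<cdot> (f \<boxtimes> g) = (f' \<cdot> f) \<boxtimes> (g' \<cdot> g)"
  by (rule tar_cmp[symmetric, of "src C f" "src C f'" "trg C f'" "src C g" "src C g'" "trg C g'"])
    (auto simp: hom_iff)

lemma tar_cmp_typed_assoc: "\<lbrakk>trg C f = src C f'; trg C g = src C g'; trg C h = src C f \<otimes> src C g\<rbrakk> \<Longrightarrow>
    (f' \<boxtimes> g') \<cdot> ((f \<boxtimes> g) \<cdot> h) = ((f' \<cdot> f) \<boxtimes> (g' \<cdot> g)) \<cdot> h"
  by (simp add: tar_cmp_typed flip: cmp_assoc_typed)

lemma is_iso_tar:
  assumes f: "is_iso C X Y f" and g: "is_iso C X' Y' g"
  shows "is_iso C (X \<otimes> X') (Y \<otimes> Y') (f \<boxtimes> g)"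
  using f g
  by (intro is_isoI[of _ _ _ "arr_inv C X Y f \<boxtimes> arr_inv C X' Y' g"])
    (simp_all add: src_iso[OF f] trg_iso[OF f] src_iso[OF g] trg_iso[OF g] tar_cmp_typed)

end

section \<open>Module categories carried by types\<close>

locale typed_module_category = module_category C M + typed_monoidal_category C + M: typed_category M
  for C :: "('k::field, 'c, 'e, 'z) moncat_scheme" (structure)
    and M :: "('k, 'c, 'e, 'o, 'a) modcat"
begin

abbreviation cmp_M :: "'a \<Rightarrow> 'a \<Rightarrow> 'a" (infixr "\<bullet>" 60) where
  "cmp_M \<equiv> cmp M"

abbreviation aob_M :: "'c \<Rightarrow> 'o \<Rightarrow> 'o" (infixr "\<ast>" 65) where
  "aob_M \<equiv> aob M"

abbreviation aar_M :: "'e \<Rightarrow> 'a \<Rightarrow> 'a" (infixr "\<odot>" 65) where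
  "aar_M \<equiv> aar M"

definition asci :: "'c \<Rightarrow> 'c \<Rightarrow> 'o \<Rightarrow> 'a" where
  "asci X Y N = arr_inv M ((X \<otimes> Y) \<ast> N) (X \<ast> Y \<ast> N) (asc M X Y N)"

lemma src_aar [simp]: "src M (f \<odot> g) = src C f \<ast> src M g"
  and trg_aar [simp]: "trg M (f \<odot> g) = trg C f \<ast> trg M g"
  using aar_in[of "src C f" "trg C f" "src M g" "trg M g" f g] by (auto simp: hom_iff M.hom_iff)

lemma aar_idn_typed [simp]: "idn C X \<odot> idn M N = idn M (X \<ast> N)"
  by (simp add: aar_idn)

lemma aar_cmp_typed: "\<lbrakk>trg C f = src C f'; trg M g = src M g'\<rbrakk> \<Longrightarrow>
    (f' \<odot> g') \<bullet> (f \<odot> g) = (f' \<cdot> f) \<odot> (g' \<bullet> g)"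
  by (rule aar_cmp[symmetric, of "src C f" "src C f'" "trg C f'" "src M g" "src M g'" "trg M g'"])
    (auto simp: hom_iff M.hom_iff)

lemma aar_cmp_typed_assoc: "\<lbrakk>trg C f = src C f'; trg M g = src M g'; trg M h = src C f \<ast> src M g\<rbrakk> \<Longrightarrow>
    (f' \<odot> g') \<bullet> ((f \<odot> g) \<bullet> h) = ((f' \<cdot> f) \<odot> (g' \<bullet> g)) \<bullet> h"
  by (simp add: aar_cmp_typed flip: M.cmp_assoc_typed)

lemma asc_iso_typed: "is_iso M ((X \<otimes> Y) \<ast> N) (X \<ast> Y \<ast> N) (asc M X Y N)"
  by (simp add: asc_iso)

lemma lun_iso_typed: "is_iso M (unt C \<ast> N) N (lun M N)"
  by (simp add: lun_iso)

lemma src_asc [simp]: "src M (asc M X Y N) = (X \<otimes> Y) \<ast> N"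
  and trg_asc [simp]: "trg M (asc M X Y N) = X \<ast> Y \<ast> N"
  and src_asci [simp]: "src M (asci X Y N) = X \<ast> Y \<ast> N"
  and trg_asci [simp]: "trg M (asci X Y N) = (X \<otimes> Y) \<ast> N"
  and asci_asc [simp]: "asci X Y N \<bullet> asc M X Y N = idn M ((X \<otimes> Y) \<ast> N)"
  and asc_asci [simp]: "asc M X Y N \<bullet> asci X Y N = idn M (X \<ast> Y \<ast> N)"
  using asc_iso_typed[of X Y N]
  by (simp_all add: asci_def M.src_iso[OF asc_iso_typed] M.trg_iso[OF asc_iso_typed])

lemma asci_asc_assoc [simp]:
    "trg M h = (X \<otimes> Y) \<ast> N \<Longrightarrow> asci X Y N \<bullet> (asc M X Y N \<bullet> h) = h"
  and asc_asci_assoc [simp]: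
    "trg M h = X \<ast> Y \<ast> N \<Longrightarrow> asc M X Y N \<bullet> (asci X Y N \<bullet> h) = h"
  by (simp_all flip: M.cmp_assoc_typed)

lemma src_lun [simp]: "src M (lun M N) = unt C \<ast> N"
  and trg_lun [simp]: "trg M (lun M N) = N"
  by (simp_all add: M.src_iso[OF lun_iso_typed] M.trg_iso[OF lun_iso_typed])

lemma asc_nat: "\<lbrakk>src C f = X; trg C f = X'; src C f' = Y; trg C f' = Y'; src M g = N; trg M g = N'\<rbrakk> \<Longrightarrow>
    asc M X' Y' N' \<bullet> ((f \<boxtimes> f') \<odot> g) = (f \<odot> f' \<odot> g) \<bullet> asc M X Y N"
  by (rule asc_natural) (simp_all add: hom_iff M.hom_iff)

lemma asc_nat_assoc: "\<lbrakk>src C f = X; trg C f = X'; src C f' = Y; trg C f' = Y'; src M g = N; trg M g = N';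
    trg M h = (X \<otimes> Y) \<ast> N\<rbrakk> \<Longrightarrow>
    asc M X' Y' N' \<bullet> (((f \<boxtimes> f') \<odot> g) \<bullet> h) =
    (f \<odot> f' \<odot> g) \<bullet> (asc M X Y N \<bullet> h)"
  using asc_nat[of f X X' f' Y Y' g N N'] by (simp flip: M.cmp_assoc_typed)

lemma asci_nat:
  assumes "src C f = X" "trg C f = X'" "src C f' = Y" "trg C f' = Y'" "src M g = N" "trg M g = N'"
  shows "((f \<boxtimes> f') \<odot> g) \<bullet> asci X Y N = asci X' Y' N' \<bullet> (f \<odot> f' \<odot> g)"
proof -
  have "((f \<boxtimes> f') \<odot> g) \<bullet> asci X Y N =
      asci X' Y' N' \<bullet> (asc M X' Y' N' \<bullet> ((f \<boxtimes> f') \<odot> g)) \<bullet> asci X Y N"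
    using assms by simp
  then show ?thesis using assms by (simp add: asc_nat)
qed

lemma tar_aar_conj:
  "\<lbrakk>src C f = X; trg C f = X'; src C f' = Y; trg C f' = Y'; src M g = N; trg M g = N'\<rbrakk> \<Longrightarrow>
    asci X' Y' N' \<bullet> (f \<odot> f' \<odot> g) \<bullet> asc M X Y N = (f \<boxtimes> f') \<odot> g"
  by (simp flip: asc_nat)

lemma pentagon_typed: "asc M X Y (Z \<ast> N) \<bullet> asc M (X \<otimes> Y) Z N =
    (idn C X \<odot> asc M Y Z N) \<bullet> asc M X (Y \<otimes> Z) N"
  by (simp add: pentagon)

lemma pentagon_inv: "asci (X \<otimes> Y) Z N \<bullet> asci X Y (Z \<ast> N) =
    asci X (Y \<otimes> Z) N \<bullet> (idn C X \<odot> asci Y Z N)"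
proof (rule M.cmp_right_cancel_iso[OF M.is_iso_cmp[OF asc_iso_typed asc_iso_typed]])
  have "(asci X (Y \<otimes> Z) N \<bullet> (idn C X \<odot> asci Y Z N)) \<bullet> asc M X Y (Z \<ast> N) \<bullet> asc M (X \<otimes> Y) Z N =
      idn M ((X \<otimes> Y \<otimes> Z) \<ast> N)"
    by (simp add: pentagon_typed) (simp add: aar_cmp_typed_assoc)
  moreover have "(asci (X \<otimes> Y) Z N \<bullet> asci X Y (Z \<ast> N)) \<bullet> asc M X Y (Z \<ast> N) \<bullet>
      asc M (X \<otimes> Y) Z N = idn M ((X \<otimes> Y \<otimes> Z) \<ast> N)"
    by simp
  ultimately show "(asci (X \<otimes> Y) Z N \<bullet> asci X Y (Z \<ast> N)) \<bullet> asc M X Y (Z \<ast> N) \<bullet> asc M (X \<otimes> Y) Z N =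
     (asci X (Y \<otimes> Z) N \<bullet> (idn C X \<odot> asci Y Z N)) \<bullet> asc M X Y (Z \<ast> N) \<bullet> asc M (X \<otimes> Y) Z N"
    by simp
qed simp_all

lemma unit_triangle_typed: "(idn C X \<odot> lun M N) \<bullet> asc M X (unt C) N = idn M (X \<ast> N)"
  by (simp add: unit_triangle)

text \<open>As \<open>C\<close> is strict, \<open>X \<otimes> 1\<close> is \<open>X\<close>, and the
  triangle axiom exhibits the acted unitor as a left inverse of the associator. Reading unitors as
  inverse associators lets \<open>strictify\<close> absorb them.\<close>

lemma asci_unit_right: "asci X (unt C) N = idn C X \<odot> lun M N"
  by (rule M.cmp_right_cancel_iso[OF asc_iso_typed[of X "unt C" N]]) (simp_all add: unit_triangle_typed)

lemma lun_nat: "lun M (trg M g) \<bullet> (idn C (unt C) \<odot> g) = g \<bullet> lun M (src M g)"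
  by (rule lun_natural) (simp_all add: M.hom_iff)

text \<open>Naturality of the unitor makes \<open>1 \<rhd> -\<close> isomorphic to the identity
  functor.\<close>

lemma unt_act_faithful:
  assumes "src M f = src M g" "trg M f = trg M g" "idn C (unt C) \<odot> f = idn C (unt C) \<odot> g"
  shows "f = g"
proof (rule M.cmp_right_cancel_iso[OF lun_iso_typed])
  have "f \<bullet> lun M (src M f) = lun M (trg M f) \<bullet> (idn C (unt C) \<odot> f)"
    by (rule lun_nat[symmetric])
  also have "\<dots> = lun M (trg M g) \<bullet> (idn C (unt C) \<odot> g)"
    by (simp only: assms)
  also have "\<dots> = g \<bullet> lun M (src M f)"
    using assms by (simp only: lun_nat)
  finally show "f \<bullet> lun M (src M f) = g \<bullet> lun M (src M f)" .
qed (simp_all add: assms)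

text \<open>Kelly's lemma: the left unit triangle follows from the pentagon and the middle triangle.\<close>

lemma unit_triangle_left: "lun M (X \<ast> N) \<bullet> asc M (unt C) X N = idn M (X \<ast> N)"
proof (rule unt_act_faithful)
  \<comment> \<open>In the pentagon at \<open>1, 1, X\<close> strictness identifies
    \<open>asc M (1 \<otimes> 1) X N\<close> with \<open>asc M 1 (1 \<otimes> X) N\<close>, so this
    common isomorphism can be cancelled.\<close>
  have "idn C (unt C) \<odot> asc M (unt C) X N = asc M (unt C) (unt C) (X \<ast> N)"
    by (rule M.cmp_right_cancel_iso[OF asc_iso_typed[of "unt C" X N]])
      (use pentagon_typed[of "unt C" "unt C" X N] in simp_all)
  then have "(idn C (unt C) \<odot> lun M (X \<ast> N)) \<bullet> (idn C (unt C) \<odot> asc M (unt C) X N) =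
      idn M (unt C \<ast> X \<ast> N)"
    using unit_triangle_typed[of "unt C" "X \<ast> N"] by simp
  then show "idn C (unt C) \<odot> (lun M (X \<ast> N) \<bullet> asc M (unt C) X N) =
      idn C (unt C) \<odot> idn M (X \<ast> N)"
    by (simp add: aar_cmp_typed)
qed simp_all

lemma asci_unit_left: "asci (unt C) X N = lun M (X \<ast> N)"
  by (rule M.cmp_right_cancel_iso[OF asc_iso_typed[of "unt C" X N]]) (simp_all add: unit_triangle_left)

end

section \<open>Internal Homs\<close>

locale typed_internal_hom = central_module_data V dl ev C G M I R + typed_module_category C M
  for V :: "('k::field, 'v, 'w) brcat"
    and dl :: "'v \<Rightarrow> 'v"
    and ev :: "'v \<Rightarrow> 'w"
    and C :: "('k, 'c, 'e) moncat" (structure)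
    and G :: "('v, 'w, 'c \<times> ('c \<Rightarrow> 'e), 'e) monfctr"
    and M :: "('k, 'c, 'e, 'o, 'a) modcat"
    and I :: "('c, 'e, 'o, 'a) ihom"
    and R :: "('o, 'a, 'o, 'a) fctr \<times> ('v \<Rightarrow> 'o \<Rightarrow> 'a) \<Rightarrow> 'c \<times> ('o \<Rightarrow> 'e)" +
  assumes internal_hom: "internal_hom C M I"
begin

lemma phi_bij: "bij_betw (phi I X N K) (hom C X (ih I N K)) (hom M (X \<ast> N) K)"
  using internal_hom by (simp add: internal_hom_def)

lemma
  assumes "trg C g = ih I N K" "src C g = X"
  shows src_phi [simp]: "src M (phi I X N K g) = X \<ast> N"
    and trg_phi [simp]: "trg M (phi I X N K g) = K"
  using bij_betwE[OF phi_bij[of X N K]] assms by (auto simp: hom_iff M.hom_iff)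

lemma phi_cmp [simp]:
  assumes "trg C g = ih I N K" "trg C f = src C g" "src C f = X"
  shows "phi I X N K (g \<cdot> f) = phi I (src C g) N K g \<bullet> (f \<odot> idn M N)"
  using internal_hom assms by (simp add: internal_hom_def hom_iff)

lemma
  assumes "src M f = X \<ast> N" "trg M f = K"
  shows src_psi [simp]: "src C (psi X N K f) = X"
    and trg_psi [simp]: "trg C (psi X N K f) = ih I N K"
    and phi_psi [simp]: "phi I X N K (psi X N K f) = f"
proof -
  have f: "f \<in> hom M (X \<ast> N) K" using assms by (simp add: M.hom_iff)
  then have "psi X N K f \<in> hom C X (ih I N K)"
    using bij_betw_inv_into[OF phi_bij[of X N K]] unfolding psi_def by (blast dest: bij_betwE)
  then show "src C (psi X N K f) = X" "trg C (psi X N K f) = ih I N K"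
    by (simp_all add: hom_iff)
  show "phi I X N K (psi X N K f) = f"
    using bij_betw_inv_into_right[OF phi_bij f] by (simp add: psi_def)
qed

lemma phi_inject:
  assumes "trg C f = ih I N K" "trg C g = ih I N K" "src C f = X" "src C g = X"
    "phi I X N K f = phi I X N K g"
  shows "f = g"
  using bij_betw_imp_inj_on[OF phi_bij[of X N K]] assms by (auto simp: inj_on_def hom_iff)

lemma src_iev [simp]: "src M (iev N K) = ih I N K \<ast> N" and trg_iev [simp]: "trg M (iev N K) = K"
  by (simp_all add: iev_def)

text \<open>This is the Yoneda lemma: naturality of \<open>phi\<close> in its first argument reduces
  it to the image \<open>iev\<close> of the identity.\<close>

lemma phi_eq_iev: "trg C f = ih I N K \<Longrightarrow> src C f = X \<Longrightarrow> phi I X N K f = iev N K \<bullet> (f \<odot> idn M N)"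
  using phi_cmp[of "idn C (ih I N K)" N K f X] by (simp add: iev_def)

lemma src_icoev [simp]: "src C (icoev X N) = X"
  and trg_icoev [simp]: "trg C (icoev X N) = ih I N (X \<ast> N)"
  and phi_icoev [simp]: "phi I X N (X \<ast> N) (icoev X N) = idn M (X \<ast> N)"
  by (simp_all add: icoev_def)

lemma
  assumes "src M f = N'" "trg M f = N"
  shows src_ipre [simp]: "src C (ipre N' N K f) = ih I N K"
    and trg_ipre [simp]: "trg C (ipre N' N K f) = ih I N' K"
    and phi_ipre: "trg C g = ih I N K \<Longrightarrow> src C g = X \<Longrightarrow>
      phi I X N' K (ipre N' N K f \<cdot> g) = phi I X N K g \<bullet> (idn C X \<odot> f)"
  using assms by (simp_all add: ipre_def phi_eq_iev[of g N K X] aar_cmp_typed)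

lemma
  assumes "src M g = K" "trg M g = K'"
  shows src_ipost [simp]: "src C (ipost N K K' g) = ih I N K"
    and trg_ipost [simp]: "trg C (ipost N K K' g) = ih I N K'"
    and phi_ipost: "trg C f = ih I N K \<Longrightarrow> src C f = X \<Longrightarrow>
      phi I X N K' (ipost N K K' g \<cdot> f) = g \<bullet> phi I X N K f"
  using assms by (simp_all add: ipost_def phi_eq_iev[of f N K X])

text \<open>The composite of \<open>ipost\<close> with \<open>icoev\<close> collapses under
  \<open>phi\<close>, since \<open>phi\<close> turns \<open>icoev\<close> into an identity. Only an
  evaluation and an associator remain.\<close>

lemma
  shows src_ia_inv [simp]: "src C (ia_inv X N K) = X \<otimes> ih I N K"
    and trg_ia_inv [simp]: "trg C (ia_inv X N K) = ih I N (X \<ast> K)"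
    and phi_ia_inv: "phi I (X \<otimes> ih I N K) N (X \<ast> K) (ia_inv X N K) =
      (idn C X \<odot> iev N K) \<bullet> asc M X (ih I N K) N"
  by (simp_all add: ia_inv_def phi_ipost del: phi_cmp)

lemma
  shows src_ib [simp]: "src C (ib X N K) = ih I (X \<ast> N) K \<otimes> X"
    and trg_ib [simp]: "trg C (ib X N K) = ih I N K"
    and phi_ib: "phi I (ih I (X \<ast> N) K \<otimes> X) N K (ib X N K) =
      iev (X \<ast> N) K \<bullet> asc M (ih I (X \<ast> N) K) X N"
  by (simp_all add: ib_def phi_ipost del: phi_cmp)

end

lemma (in typed_monoidal_category) half_braiding_iff: "half_braiding C A \<sigma> \<longleftrightarrow>
    (\<forall>X. is_iso C (A \<otimes> X) (X \<otimes> A) (\<sigma> X)) \<and>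
    (\<forall>f. \<sigma> (trg C f) \<cdot> (idn C A \<boxtimes> f) = (f \<boxtimes> idn C A) \<cdot> \<sigma> (src C f)) \<and>
    (\<forall>X Y. \<sigma> (X \<otimes> Y) = (idn C X \<boxtimes> \<sigma> Y) \<cdot> (\<sigma> X \<boxtimes> idn C Y))"
  unfolding half_braiding_def by (auto simp: hom_iff)

text \<open>For \<open>1 \<otimes> 1 = 1\<close> the hexagon makes the component at the unit
  idempotent, and an invertible idempotent is an identity.\<close>

lemma (in typed_monoidal_category) half_braiding_unit:
  assumes "half_braiding C A \<sigma>" shows "\<sigma> (unt C) = idn C A"
proof -
  have iso: "is_iso C A A (\<sigma> (unt C))"
    using assms by (metis half_braiding_iff tob_unit_typed)
  have "\<sigma> (unt C) = \<sigma> (unt C) \<cdot> \<sigma> (unt C)"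
    using assms unfolding half_braiding_iff by (metis tob_unit_typed tar_unit_typed)
  then show ?thesis
    using iso by (metis cmp_left_cancel_iso cmp_idn src_iso trg_iso trg_idn)
qed

section \<open>Strict monoidal extensions on the same objects\<close>

text \<open>A strict monoidal category with the objects of \<open>C\<close> and arrows in
  \<open>'x\<close>, receiving \<open>C\<close> through the identity-on-objects functor
  \<open>J\<close>. Arrows are singled out by a predicate, so that shrinking \<open>arr\<close>
  gives a smaller extension with the same operations.\<close>

locale tensor_extension = typed_monoidal_category C
  for C :: "('k::field, 'c, 'e, 'z) moncat_scheme" (structure) +
  fixes arr :: "'x \<Rightarrow> bool"
    and dm :: "'x \<Rightarrow> 'c"
    and cd :: "'x \<Rightarrow> 'c"
    and comp :: "'x \<Rightarrow> 'x \<Rightarrow> 'x" (infixr "\<diamond>" 60)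
    and ten :: "'x \<Rightarrow> 'x \<Rightarrow> 'x" (infixr "\<star>" 70)
    and J :: "'e \<Rightarrow> 'x"
  assumes comp_arr [simp]: "\<lbrakk>arr f; arr g; cd f = dm g\<rbrakk> \<Longrightarrow> arr (g \<diamond> f)"
    and dm_comp [simp]: "\<lbrakk>arr f; arr g; cd f = dm g\<rbrakk> \<Longrightarrow> dm (g \<diamond> f) = dm f"
    and cd_comp [simp]: "\<lbrakk>arr f; arr g; cd f = dm g\<rbrakk> \<Longrightarrow> cd (g \<diamond> f) = cd g"
    and comp_assoc [simp]: "\<lbrakk>arr f; arr g; arr h; cd f = dm g; cd g = dm h\<rbrakk> \<Longrightarrow>
      (h \<diamond> g) \<diamond> f = h \<diamond> (g \<diamond> f)"
    and ten_arr [simp]: "\<lbrakk>arr f; arr g\<rbrakk> \<Longrightarrow> arr (f \<star> g)"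
    and dm_ten [simp]: "\<lbrakk>arr f; arr g\<rbrakk> \<Longrightarrow> dm (f \<star> g) = dm f \<otimes> dm g"
    and cd_ten [simp]: "\<lbrakk>arr f; arr g\<rbrakk> \<Longrightarrow> cd (f \<star> g) = cd f \<otimes> cd g"
    and ten_assoc: "\<lbrakk>arr f; arr g; arr h\<rbrakk> \<Longrightarrow> (f \<star> g) \<star> h = f \<star> (g \<star> h)"
    and ten_comp: "\<lbrakk>arr f; arr g; arr f'; arr g'; cd f = dm f'; cd g = dm g'\<rbrakk> \<Longrightarrow>
      (f' \<star> g') \<diamond> (f \<star> g) = (f' \<diamond> f) \<star> (g' \<diamond> g)"
    and J_arr [simp]: "arr (J u)"
    and dm_J [simp]: "dm (J u) = src C u"
    and cd_J [simp]: "cd (J u) = trg C u"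
    and J_idn_comp [simp]: "\<lbrakk>arr f; cd f = X\<rbrakk> \<Longrightarrow> J (idn C X) \<diamond> f = f"
    and comp_J_idn [simp]: "\<lbrakk>arr f; dm f = X\<rbrakk> \<Longrightarrow> f \<diamond> J (idn C X) = f"
    and J_cmp: "trg C u = src C v \<Longrightarrow> J (v \<cdot> u) = J v \<diamond> J u"
    and J_tar: "J (u \<boxtimes> v) = J u \<star> J v"
    and J_unit_ten [simp]: "arr f \<Longrightarrow> J (idn C (unt C)) \<star> f = f"
    and ten_J_unit [simp]: "arr f \<Longrightarrow> f \<star> J (idn C (unt C)) = f"
begin

abbreviation one :: "'c \<Rightarrow> 'x" ("\<iota>") where "\<iota> X \<equiv> J (idn C X)"

lemma ten_comp_assoc:
  assumes "arr f" "arr g" "arr f'" "arr g'" "arr h" "cd f = dm f'" "cd g = dm g'" "cd h = dm f \<otimes> dm g"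
  shows "(f' \<star> g') \<diamond> (f \<star> g) \<diamond> h = ((f' \<diamond> f) \<star> (g' \<diamond> g)) \<diamond> h"
  using assms by (simp add: ten_comp flip: comp_assoc)

lemma one_ten_one: "\<iota> X \<star> \<iota> Y = \<iota> (X \<otimes> Y)"
  by (simp flip: J_tar)

text \<open>The half-braidings \<open>s i\<close> are natural for arrows of \<open>C\<close>; this
  singles out the arrows of the extension for which naturality persists. For transformations of
  action functors and \<open>s = Gbr\<close> it is compatibility with the \<open>V\<close>-module
  structures.\<close>

definition central_arr :: "('i \<Rightarrow> 'c) \<Rightarrow> ('i \<Rightarrow> 'c \<Rightarrow> 'e) \<Rightarrow> 'x \<Rightarrow> bool" where
  "central_arr g s f \<longleftrightarrow> arr f \<and>
     (\<forall>i. J (s i (cd f)) \<diamond> (\<iota> (g i) \<star> f) = (f \<star> \<iota> (g i)) \<diamond> J (s i (dm f)))"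

text \<open>Each closure property mirrors a law of half-braidings: the hexagon gives tensor products
  and naturality gives the arrows \<open>J u\<close>, while composites paste two squares.\<close>

lemma tensor_extension_central_arr:
  assumes s: "\<And>i. half_braiding C (g i) (s i)"
  shows "tensor_extension C (central_arr g s) dm cd (\<diamond>) (\<star>) J"
proof -
  have src_s: "src C (s i X) = g i \<otimes> X" and trg_s: "trg C (s i X) = X \<otimes> g i" for i X
    using s[of i] by (auto simp: half_braiding_iff dest: src_iso trg_iso)
  have s_tob: "s i (X \<otimes> Y) = (idn C X \<boxtimes> s i Y) \<cdot> (s i X \<boxtimes> idn C Y)" for i X Y
    using s[of i] by (simp add: half_braiding_iff)
  note sD = src_s trg_s
  have arrD: "arr f" if "central_arr g s f" for f using that by (simp add: central_arr_def)
  have comp: "central_arr g s (h \<diamond> f)"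
    if f: "central_arr g s f" and h: "central_arr g s h" and eq: "cd f = dm h" for f h
  proof -
    have [simp]: "arr f" "arr h" "cd f = dm h" using f h eq by (auto dest: arrD)
    have "J (s i (cd h)) \<diamond> (\<iota> (g i) \<star> (h \<diamond> f)) = ((h \<diamond> f) \<star> \<iota> (g i)) \<diamond> J (s i (dm f))" for i
    proof -
      have "J (s i (cd h)) \<diamond> (\<iota> (g i) \<star> (h \<diamond> f)) = (J (s i (cd h)) \<diamond> (\<iota> (g i) \<star> h)) \<diamond> (\<iota> (g i) \<star> f)"
        by (simp add: ten_comp sD)
      also have "\<dots> = (h \<star> \<iota> (g i)) \<diamond> J (s i (cd f)) \<diamond> (\<iota> (g i) \<star> f)"
        using h by (simp add: central_arr_def sD)
      also have "\<dots> = (h \<star> \<iota> (g i)) \<diamond> (f \<star> \<iota> (g i)) \<diamond> J (s i (dm f))"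
        using f by (simp add: central_arr_def)
      also have "\<dots> = ((h \<diamond> f) \<star> \<iota> (g i)) \<diamond> J (s i (dm f))"
        by (simp add: ten_comp_assoc sD)
      finally show ?thesis .
    qed
    then show ?thesis by (simp add: central_arr_def)
  qed
  have ten: "central_arr g s (f \<star> h)" if f: "central_arr g s f" and h: "central_arr g s h" for f h
  proof -
    have [simp]: "arr f" "arr h" using f h by (auto dest: arrD)
    have "J (s i (cd f \<otimes> cd h)) \<diamond> (\<iota> (g i) \<star> (f \<star> h)) =
        ((f \<star> h) \<star> \<iota> (g i)) \<diamond> J (s i (dm f \<otimes> dm h))" for i
    proof -
      \<comment> \<open>The hexagon breaks the half-braiding at a tensor product into two factors;
        one carries \<open>f\<close> past \<open>g i\<close>, the other carries
        \<open>h\<close>.\<close>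
      have "J (s i (cd f \<otimes> cd h)) \<diamond> (\<iota> (g i) \<star> (f \<star> h)) =
          (\<iota> (cd f) \<star> J (s i (cd h))) \<diamond> (J (s i (cd f)) \<star> \<iota> (cd h)) \<diamond> ((\<iota> (g i) \<star> f) \<star> h)"
        by (simp add: s_tob J_cmp J_tar sD ten_assoc)
      also have "\<dots> = (\<iota> (cd f) \<star> J (s i (cd h))) \<diamond> ((J (s i (cd f)) \<diamond> (\<iota> (g i) \<star> f)) \<star> h)"
        by (simp add: ten_comp sD)
      also have "\<dots> = (\<iota> (cd f) \<star> J (s i (cd h))) \<diamond> (((f \<star> \<iota> (g i)) \<diamond> J (s i (dm f))) \<star> (h \<diamond> \<iota> (dm h)))"
        using f by (simp add: central_arr_def)
      also have "\<dots> = (\<iota> (cd f) \<star> J (s i (cd h))) \<diamond> (f \<star> (\<iota> (g i) \<star> h)) \<diamond> (J (s i (dm f)) \<star> \<iota> (dm h))"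
        by (subst ten_comp[symmetric]) (simp_all add: sD ten_assoc)
      also have "\<dots> = (f \<star> (J (s i (cd h)) \<diamond> (\<iota> (g i) \<star> h))) \<diamond> (J (s i (dm f)) \<star> \<iota> (dm h))"
        by (subst ten_comp_assoc) (simp_all add: sD)
      also have "\<dots> = ((f \<diamond> \<iota> (dm f)) \<star> ((h \<star> \<iota> (g i)) \<diamond> J (s i (dm h)))) \<diamond> (J (s i (dm f)) \<star> \<iota> (dm h))"
        using h by (simp add: central_arr_def)
      also have "\<dots> = ((f \<star> h) \<star> \<iota> (g i)) \<diamond> (\<iota> (dm f) \<star> J (s i (dm h))) \<diamond> (J (s i (dm f)) \<star> \<iota> (dm h))"
        by (subst ten_comp[symmetric]) (simp_all add: sD ten_assoc)
      also have "\<dots> = ((f \<star> h) \<star> \<iota> (g i)) \<diamond> J (s i (dm f \<otimes> dm h))"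
        by (simp add: s_tob J_cmp J_tar sD)
      finally show ?thesis .
    qed
    then show ?thesis by (simp add: central_arr_def)
  qed
  have J: "central_arr g s (J u)" for u
    using s by (simp add: central_arr_def half_braiding_iff sD flip: J_cmp J_tar)
  show ?thesis
    by unfold_locales (auto simp: arrD intro: comp ten J simp: ten_assoc ten_comp J_cmp J_tar)
qed

end

section \<open>Coreflections and commutative algebras\<close>

text \<open>\<open>A\<close> represents the functor sending \<open>Y\<close> to the arrows from
  \<open>Y\<close> to the unit object in the extension, with universal element
  \<open>e\<close>.\<close>

locale unit_coreflection = tensor_extension C arr dm cd comp ten J + tensor_category C
  for C :: "('k::field, 'c, 'e, 'z) moncat_scheme" (structure)
    and arr :: "'x \<Rightarrow> bool"
    and dm :: "'x \<Rightarrow> 'c"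
    and cd :: "'x \<Rightarrow> 'c"
    and comp :: "'x \<Rightarrow> 'x \<Rightarrow> 'x" (infixr "\<diamond>" 60)
    and ten :: "'x \<Rightarrow> 'x \<Rightarrow> 'x" (infixr "\<star>" 70)
    and J :: "'e \<Rightarrow> 'x" +
  fixes A :: 'c and e :: 'x
  assumes e_arr [simp]: "arr e" and dm_e [simp]: "dm e = A" and cd_e [simp]: "cd e = unt C"
    and universal: "\<lbrakk>arr a; cd a = unt C\<rbrakk> \<Longrightarrow> \<exists>!f. src C f = dm a \<and> trg C f = A \<and> e \<diamond> J f = a"
begin

lemma e_cancel: "\<lbrakk>src C f = src C g; trg C f = A; trg C g = A; e \<diamond> J f = e \<diamond> J g\<rbrakk> \<Longrightarrow> f = g"
  using universal[of "e \<diamond> J g"] by auto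

text \<open>A left dual \<open>D\<close> of \<open>X\<close> trades an arrow
  \<open>Y \<rightarrow> X\<close> of the extension for an arrow
  \<open>D \<otimes> Y \<rightarrow> 1\<close>, to which universality applies. Evaluation and
  coevaluation come from \<open>C\<close>, so the factor carried back lies in \<open>C\<close>
  too.\<close>

lemma universal_left: "\<lbrakk>arr a; cd a = X\<rbrakk> \<Longrightarrow>
    \<exists>f. src C f = dm a \<and> trg C f = X \<otimes> A \<and> (\<iota> X \<star> e) \<diamond> J f = a"
  and e_cancel_left: "\<lbrakk>src C f = src C g; trg C f = X \<otimes> A; trg C g = X \<otimes> A;
      (\<iota> X \<star> e) \<diamond> J f = (\<iota> X \<star> e) \<diamond> J g\<rbrakk> \<Longrightarrow> f = g"
proof -
  obtain D ev co where "left_dual C X D ev co" using left_rigid[of X] by auto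
  then have dual: "src C ev = D \<otimes> X" "trg C ev = unt C" "src C co = unt C" "trg C co = X \<otimes> D"
      "(idn C X \<boxtimes> ev) \<cdot> (co \<boxtimes> idn C X) = idn C X"
    by (simp_all add: left_dual_def hom_iff)
  have zigzag: "(\<iota> X \<star> J ev) \<diamond> (J co \<star> \<iota> X) = \<iota> X"
    using arg_cong[OF dual(5), of J] by (simp add: J_cmp J_tar dual(1-4))
  {
    assume a [simp]: "arr a" "cd a = X"
    obtain f where f: "src C f = D \<otimes> dm a" "trg C f = A" "e \<diamond> J f = J ev \<diamond> (\<iota> D \<star> a)"
      using universal[of "J ev \<diamond> (\<iota> D \<star> a)"] by (auto simp: dual)
    have "(\<iota> X \<star> e) \<diamond> J ((idn C X \<boxtimes> f) \<cdot> (co \<boxtimes> idn C (dm a))) =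
        (\<iota> X \<star> (e \<diamond> J f)) \<diamond> (J co \<star> \<iota> (dm a))"
      by (simp add: J_cmp J_tar dual f ten_comp_assoc del: f(3))
    also have "\<dots> = (\<iota> X \<star> J ev) \<diamond> ((\<iota> X \<star> \<iota> D) \<star> a) \<diamond> (J co \<star> \<iota> (dm a))"
      by (simp add: f ten_assoc ten_comp_assoc dual)
    also have "\<dots> = (\<iota> X \<star> J ev) \<diamond> (J co \<star> (\<iota> X \<diamond> a))"
      by (simp add: one_ten_one ten_comp dual)
    also have "J co \<star> (\<iota> X \<diamond> a) = (J co \<star> \<iota> X) \<diamond> (\<iota> (unt C) \<star> a)"
      by (subst ten_comp) (simp_all add: dual)
    also have "(\<iota> X \<star> J ev) \<diamond> (J co \<star> \<iota> X) \<diamond> (\<iota> (unt C) \<star> a) =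
        ((\<iota> X \<star> J ev) \<diamond> (J co \<star> \<iota> X)) \<diamond> a"
      by (simp add: dual)
    also have "\<dots> = a"
      by (simp only: zigzag) simp
    finally show "\<exists>f. src C f = dm a \<and> trg C f = X \<otimes> A \<and> (\<iota> X \<star> e) \<diamond> J f = a"
      by (intro exI[of _ "(idn C X \<boxtimes> f) \<cdot> (co \<boxtimes> idn C (dm a))"]) (simp add: dual f)
  next
    assume *: "src C f = src C g" "trg C f = X \<otimes> A" "trg C g = X \<otimes> A"
      "(\<iota> X \<star> e) \<diamond> J f = (\<iota> X \<star> e) \<diamond> J g"
    \<comment> \<open>By interchange of \<open>e\<close> with the evaluation, the transpose of
      \<open>h\<close> composed with \<open>e\<close> depends on \<open>h\<close> only through
      \<open>(\<iota> X \<star> e) \<diamond> J h\<close>.\<close>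
    have tr: "e \<diamond> J ((ev \<boxtimes> idn C A) \<cdot> (idn C D \<boxtimes> h)) = J ev \<diamond> (\<iota> D \<star> ((\<iota> X \<star> e) \<diamond> J h))"
      if "trg C h = X \<otimes> A" for h
    proof -
      have "e \<diamond> J ((ev \<boxtimes> idn C A) \<cdot> (idn C D \<boxtimes> h)) = (\<iota> (unt C) \<star> e) \<diamond> (J ev \<star> \<iota> A) \<diamond> (\<iota> D \<star> J h)"
        using that by (simp add: J_cmp J_tar dual)
      also have "\<dots> = (J ev \<star> \<iota> (unt C)) \<diamond> ((\<iota> D \<star> \<iota> X) \<star> e) \<diamond> (\<iota> D \<star> J h)"
        using that by (simp add: ten_comp_assoc dual one_ten_one del: J_unit_ten ten_J_unit)
      also have "\<dots> = J ev \<diamond> (\<iota> D \<star> ((\<iota> X \<star> e) \<diamond> J h))"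
        using that by (simp add: ten_assoc ten_comp)
      finally show ?thesis .
    qed
    have "(ev \<boxtimes> idn C A) \<cdot> (idn C D \<boxtimes> f) = (ev \<boxtimes> idn C A) \<cdot> (idn C D \<boxtimes> g)"
      by (rule e_cancel) (use * in \<open>simp_all add: dual tr\<close>)
    \<comment> \<open>The zigzag identity recovers \<open>h\<close> from its transpose, so equal
      transposes force equal arrows.\<close>
    moreover have "(idn C X \<boxtimes> ((ev \<boxtimes> idn C A) \<cdot> (idn C D \<boxtimes> h))) \<cdot> (co \<boxtimes> idn C (src C h)) = h"
      if h: "trg C h = X \<otimes> A" for h
    proof -
      have "(idn C X \<boxtimes> ((ev \<boxtimes> idn C A) \<cdot> (idn C D \<boxtimes> h))) \<cdot> (co \<boxtimes> idn C (src C h)) =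
          (idn C X \<boxtimes> (ev \<boxtimes> idn C A)) \<cdot> ((idn C X \<boxtimes> idn C D) \<boxtimes> h) \<cdot> (co \<boxtimes> idn C (src C h))"
        using h by (simp add: tar_assoc_typed tar_cmp_typed_assoc dual del: tar_idn_typed)
      also have "\<dots> = ((idn C X \<boxtimes> ev) \<boxtimes> idn C A) \<cdot> (co \<boxtimes> (idn C X \<boxtimes> idn C A)) \<cdot> h"
      proof -
        have "((idn C X \<boxtimes> idn C D) \<boxtimes> h) \<cdot> (co \<boxtimes> idn C (src C h)) =
            (co \<boxtimes> idn C (X \<otimes> A)) \<cdot> (idn C (unt C) \<boxtimes> h)"
          using h by (simp only: tar_cmp_typed tar_idn_typed src_idn trg_idn dual) (simp add: dual)
        then show ?thesis by (simp add: tar_assoc_typed)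
      qed
      also have "\<dots> = (((idn C X \<boxtimes> ev) \<cdot> (co \<boxtimes> idn C X)) \<boxtimes> idn C A) \<cdot> h"
        using h by (subst tar_assoc_typed[symmetric]) (simp add: tar_cmp_typed_assoc dual)
      also have "\<dots> = h" using h by (simp only: dual(5)) simp
      finally show ?thesis .
    qed
    ultimately show "f = g" using * by metis
  }
qed

text \<open>Mirror image: tensoring with \<open>X\<close> on the right calls for an object
  \<open>D\<close> having \<open>X\<close> as left dual, which right rigidity provides.\<close>

lemma universal_right: "\<lbrakk>arr a; cd a = X\<rbrakk> \<Longrightarrow>
    \<exists>f. src C f = dm a \<and> trg C f = A \<otimes> X \<and> (e \<star> \<iota> X) \<diamond> J f = a"
  and e_cancel_right: "\<lbrakk>src C f = src C g; trg C f = A \<otimes> X; trg C g = A \<otimes> X;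
      (e \<star> \<iota> X) \<diamond> J f = (e \<star> \<iota> X) \<diamond> J g\<rbrakk> \<Longrightarrow> f = g"
proof -
  obtain D ev co where "left_dual C D X ev co" using right_rigid[of X] by auto
  then have dual: "src C ev = X \<otimes> D" "trg C ev = unt C" "src C co = unt C" "trg C co = D \<otimes> X"
      "(ev \<boxtimes> idn C X) \<cdot> (idn C X \<boxtimes> co) = idn C X"
    by (simp_all add: left_dual_def hom_iff)
  have zigzag: "(J ev \<star> \<iota> X) \<diamond> (\<iota> X \<star> J co) = \<iota> X"
    using arg_cong[OF dual(5), of J] by (simp add: J_cmp J_tar dual(1-4))
  {
    assume a [simp]: "arr a" "cd a = X"
    obtain f where f: "src C f = dm a \<otimes> D" "trg C f = A" "e \<diamond> J f = J ev \<diamond> (a \<star> \<iota> D)"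
      using universal[of "J ev \<diamond> (a \<star> \<iota> D)"] by (auto simp: dual)
    have "(e \<star> \<iota> X) \<diamond> J ((f \<boxtimes> idn C X) \<cdot> (idn C (dm a) \<boxtimes> co)) =
        ((e \<diamond> J f) \<star> \<iota> X) \<diamond> (\<iota> (dm a) \<star> J co)"
      by (simp add: J_cmp J_tar dual f ten_comp_assoc del: f(3))
    also have "\<dots> = (J ev \<star> \<iota> X) \<diamond> (a \<star> (\<iota> D \<star> \<iota> X)) \<diamond> (\<iota> (dm a) \<star> J co)"
      by (simp add: f ten_comp_assoc dual flip: ten_assoc)
    also have "\<dots> = (J ev \<star> \<iota> X) \<diamond> ((\<iota> X \<diamond> a) \<star> J co)"
      by (simp add: one_ten_one ten_comp dual)
    also have "(\<iota> X \<diamond> a) \<star> J co = (\<iota> X \<star> J co) \<diamond> (a \<star> \<iota> (unt C))"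
      by (subst ten_comp) (simp_all add: dual)
    also have "(J ev \<star> \<iota> X) \<diamond> (\<iota> X \<star> J co) \<diamond> (a \<star> \<iota> (unt C)) =
        ((J ev \<star> \<iota> X) \<diamond> (\<iota> X \<star> J co)) \<diamond> a"
      by (simp add: dual)
    also have "\<dots> = a"
      by (simp only: zigzag) simp
    finally show "\<exists>f. src C f = dm a \<and> trg C f = A \<otimes> X \<and> (e \<star> \<iota> X) \<diamond> J f = a"
      by (intro exI[of _ "(f \<boxtimes> idn C X) \<cdot> (idn C (dm a) \<boxtimes> co)"]) (simp add: dual f)
  next
    assume *: "src C f = src C g" "trg C f = A \<otimes> X" "trg C g = A \<otimes> X"
      "(e \<star> \<iota> X) \<diamond> J f = (e \<star> \<iota> X) \<diamond> J g"
    have tr: "e \<diamond> J ((idn C A \<boxtimes> ev) \<cdot> (h \<boxtimes> idn C D)) = J ev \<diamond> (((e \<star> \<iota> X) \<diamond> J h) \<star> \<iota> D)"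
      if "trg C h = A \<otimes> X" for h
    proof -
      have "e \<diamond> J ((idn C A \<boxtimes> ev) \<cdot> (h \<boxtimes> idn C D)) = (e \<star> \<iota> (unt C)) \<diamond> (\<iota> A \<star> J ev) \<diamond> (J h \<star> \<iota> D)"
        using that by (simp add: J_cmp J_tar dual)
      also have "\<dots> = (\<iota> (unt C) \<star> J ev) \<diamond> (e \<star> (\<iota> X \<star> \<iota> D)) \<diamond> (J h \<star> \<iota> D)"
        using that by (simp add: ten_comp_assoc dual one_ten_one del: J_unit_ten ten_J_unit)
      also have "\<dots> = J ev \<diamond> (((e \<star> \<iota> X) \<diamond> J h) \<star> \<iota> D)"
        using that by (simp add: ten_comp flip: ten_assoc)
      finally show ?thesis .
    qed
    have "(idn C A \<boxtimes> ev) \<cdot> (f \<boxtimes> idn C D) = (idn C A \<boxtimes> ev) \<cdot> (g \<boxtimes> idn C D)"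
      by (rule e_cancel) (use * in \<open>simp_all add: dual tr\<close>)
    moreover have "(((idn C A \<boxtimes> ev) \<cdot> (h \<boxtimes> idn C D)) \<boxtimes> idn C X) \<cdot> (idn C (src C h) \<boxtimes> co) = h"
      if h: "trg C h = A \<otimes> X" for h
    proof -
      have "(((idn C A \<boxtimes> ev) \<cdot> (h \<boxtimes> idn C D)) \<boxtimes> idn C X) \<cdot> (idn C (src C h) \<boxtimes> co) =
          ((idn C A \<boxtimes> ev) \<boxtimes> idn C X) \<cdot> (h \<boxtimes> (idn C D \<boxtimes> idn C X)) \<cdot> (idn C (src C h) \<boxtimes> co)"
        using h by (simp add: tar_cmp_typed_assoc dual del: tar_idn_typed flip: tar_assoc_typed)
      also have "\<dots> = (idn C A \<boxtimes> (ev \<boxtimes> idn C X)) \<cdot> ((idn C A \<boxtimes> idn C X) \<boxtimes> co) \<cdot> h"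
      proof -
        have "(h \<boxtimes> (idn C D \<boxtimes> idn C X)) \<cdot> (idn C (src C h) \<boxtimes> co) =
            (idn C (A \<otimes> X) \<boxtimes> co) \<cdot> (h \<boxtimes> idn C (unt C))"
          using h by (simp only: tar_cmp_typed tar_idn_typed src_idn trg_idn dual) (simp add: dual)
        then show ?thesis by (simp add: tar_assoc_typed)
      qed
      also have "\<dots> = (idn C A \<boxtimes> ((ev \<boxtimes> idn C X) \<cdot> (idn C X \<boxtimes> co))) \<cdot> h"
        using h by (subst tar_assoc_typed) (simp add: tar_cmp_typed_assoc dual)
      also have "\<dots> = h" using h by (simp only: dual(5)) simp
      finally show ?thesis .
    qed
    ultimately show "f = g" using * by metis
  }
qed

end

text \<open>The structure morphisms enter only through their composites with \<open>e\<close>, which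
  determine them; that \<open>\<sigma>\<close> is invertible and satisfies the hexagon is derived,
  not assumed.\<close>

locale coreflection_algebra = unit_coreflection C arr dm cd comp ten J A e
  for C :: "('k::field, 'c, 'e, 'z) moncat_scheme" (structure)
    and arr :: "'x \<Rightarrow> bool"
    and dm :: "'x \<Rightarrow> 'c"
    and cd :: "'x \<Rightarrow> 'c"
    and comp :: "'x \<Rightarrow> 'x \<Rightarrow> 'x" (infixr "\<diamond>" 60)
    and ten :: "'x \<Rightarrow> 'x \<Rightarrow> 'x" (infixr "\<star>" 70)
    and J :: "'e \<Rightarrow> 'x"
    and A :: 'c and e :: 'x +
  fixes \<sigma> :: "'c \<Rightarrow> 'e" and \<mu> \<epsilon> :: 'e
  assumes src_\<sigma> [simp]: "src C (\<sigma> X) = A \<otimes> X" and trg_\<sigma> [simp]: "trg C (\<sigma> X) = X \<otimes> A"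
    and e_\<sigma>: "(\<iota> X \<star> e) \<diamond> J (\<sigma> X) = e \<star> \<iota> X"
    and src_\<mu> [simp]: "src C \<mu> = A \<otimes> A" and trg_\<mu> [simp]: "trg C \<mu> = A"
    and e_\<mu>: "e \<diamond> J \<mu> = e \<star> e"
    and src_\<epsilon> [simp]: "src C \<epsilon> = unt C" and trg_\<epsilon> [simp]: "trg C \<epsilon> = A"
    and e_\<epsilon>: "e \<diamond> J \<epsilon> = \<iota> (unt C)"
begin

lemma e_\<sigma>_assoc: "\<lbrakk>arr a; cd a = A \<otimes> X\<rbrakk> \<Longrightarrow> (\<iota> X \<star> e) \<diamond> J (\<sigma> X) \<diamond> a = (e \<star> \<iota> X) \<diamond> a"
  using e_\<sigma>[of X] by (simp flip: comp_assoc)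

lemma e_\<mu>_assoc: "\<lbrakk>arr a; cd a = A \<otimes> A\<rbrakk> \<Longrightarrow> e \<diamond> J \<mu> \<diamond> a = (e \<star> e) \<diamond> a"
  using e_\<mu> by (simp flip: comp_assoc)

text \<open>The inverse is the factorisation of \<open>\<iota> X \<star> e\<close> through
  \<open>e \<star> \<iota> X\<close> given by \<open>universal_right\<close>; the equation defining
  \<open>\<sigma>\<close> is symmetric in the two sides.\<close>

lemma half_braiding_\<sigma>: "half_braiding C A \<sigma>"
  unfolding half_braiding_iff
proof (intro conjI allI)
  fix X
  obtain g where g: "src C g = X \<otimes> A" "trg C g = A \<otimes> X" "(e \<star> \<iota> X) \<diamond> J g = \<iota> X \<star> e"
    using universal_right[of "\<iota> X \<star> e" X] by auto
  show "is_iso C (A \<otimes> X) (X \<otimes> A) (\<sigma> X)"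
  proof (rule is_isoI)
    show "g \<cdot> \<sigma> X = idn C (A \<otimes> X)"
    proof (rule e_cancel_right)
      have "(e \<star> \<iota> X) \<diamond> J (g \<cdot> \<sigma> X) = ((e \<star> \<iota> X) \<diamond> J g) \<diamond> J (\<sigma> X)"
        by (simp add: J_cmp g del: g(3))
      then show "(e \<star> \<iota> X) \<diamond> J (g \<cdot> \<sigma> X) = (e \<star> \<iota> X) \<diamond> J (idn C (A \<otimes> X))"
        by (simp add: g e_\<sigma>)
    qed (simp_all add: g)
    show "\<sigma> X \<cdot> g = idn C (X \<otimes> A)"
      by (rule e_cancel_left[of _ _ X]) (simp_all add: g J_cmp e_\<sigma>_assoc)
  qed (simp_all add: g)
next
  fix f
  \<comment> \<open>Both sides of naturality become \<open>J f\<close> after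
    \<open>e \<star> \<iota> (src C f)\<close>; interchange lets \<open>J f\<close> pass
    \<open>e\<close> because \<open>e\<close> ends at the unit object.\<close>
  have "(\<iota> (trg C f) \<star> e) \<diamond> J (\<sigma> (trg C f)) \<diamond> (\<iota> A \<star> J f) = (\<iota> (unt C) \<star> J f) \<diamond> (e \<star> \<iota> (src C f))"
    by (simp add: e_\<sigma>_assoc ten_comp del: J_unit_ten)
  also have "\<dots> = (\<iota> (trg C f) \<star> e) \<diamond> (J f \<star> \<iota> A) \<diamond> J (\<sigma> (src C f))"
  proof -
    have "(\<iota> (trg C f) \<star> e) \<diamond> (J f \<star> \<iota> A) = (J f \<star> \<iota> (unt C)) \<diamond> (\<iota> (src C f) \<star> e)"
      by (simp add: ten_comp del: ten_J_unit)
    then have "(\<iota> (trg C f) \<star> e) \<diamond> (J f \<star> \<iota> A) \<diamond> J (\<sigma> (src C f)) =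
        J f \<diamond> (\<iota> (src C f) \<star> e) \<diamond> J (\<sigma> (src C f))"
      by (simp flip: comp_assoc)
    then show ?thesis by (simp add: e_\<sigma>)
  qed
  finally show "\<sigma> (trg C f) \<cdot> (idn C A \<boxtimes> f) = (f \<boxtimes> idn C A) \<cdot> \<sigma> (src C f)"
    by (intro e_cancel_left[of _ _ "trg C f"]) (simp_all add: J_cmp J_tar)
next
  fix X Y
  have "(\<iota> (X \<otimes> Y) \<star> e) \<diamond> (\<iota> X \<star> J (\<sigma> Y)) \<diamond> (J (\<sigma> X) \<star> \<iota> Y) =
      (\<iota> X \<star> ((\<iota> Y \<star> e) \<diamond> J (\<sigma> Y))) \<diamond> (J (\<sigma> X) \<star> \<iota> Y)"
    by (simp add: ten_assoc ten_comp_assoc flip: one_ten_one)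
  also have "\<dots> = ((\<iota> X \<star> e) \<star> \<iota> Y) \<diamond> (J (\<sigma> X) \<star> \<iota> Y)"
    by (simp add: e_\<sigma> ten_assoc)
  also have "\<dots> = e \<star> \<iota> (X \<otimes> Y)"
    by (subst ten_comp) (simp_all add: e_\<sigma> ten_assoc one_ten_one)
  finally show "\<sigma> (X \<otimes> Y) = (idn C X \<boxtimes> \<sigma> Y) \<cdot> (\<sigma> X \<boxtimes> idn C Y)"
    by (intro e_cancel_left[of _ _ "X \<otimes> Y"]) (simp_all add: J_cmp J_tar e_\<sigma>)
qed

text \<open>\<open>\<tau>\<close> is the identity at the unit, so centrality of \<open>e\<close>
  reads \<open>(e \<star> \<iota> g) \<diamond> J (\<tau> A) = \<iota> g \<star> e\<close>. This
  undoes the equation defining \<open>\<sigma> g\<close> and is the source of membership in the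
  relative centre.\<close>

lemma braiding_inverse:
  assumes \<tau>: "half_braiding C g \<tau>" and e: "J (\<tau> (cd e)) \<diamond> (\<iota> g \<star> e) = (e \<star> \<iota> g) \<diamond> J (\<tau> (dm e))"
  shows "\<tau> A \<cdot> \<sigma> g = idn C (A \<otimes> g)"
proof (rule e_cancel_right)
  have ty: "src C (\<tau> A) = g \<otimes> A" "trg C (\<tau> A) = A \<otimes> g"
    using \<tau> by (auto simp: half_braiding_iff dest: src_iso trg_iso)
  show "src C (\<tau> A \<cdot> \<sigma> g) = src C (idn C (A \<otimes> g))" "trg C (\<tau> A \<cdot> \<sigma> g) = A \<otimes> g"
    by (simp_all add: ty)
  have "(e \<star> \<iota> g) \<diamond> J (\<tau> A \<cdot> \<sigma> g) = ((e \<star> \<iota> g) \<diamond> J (\<tau> A)) \<diamond> J (\<sigma> g)"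
    by (simp add: J_cmp ty)
  also have "(e \<star> \<iota> g) \<diamond> J (\<tau> A) = \<iota> g \<star> e"
    using e by (simp add: half_braiding_unit[OF \<tau>])
  finally show "(e \<star> \<iota> g) \<diamond> J (\<tau> A \<cdot> \<sigma> g) = (e \<star> \<iota> g) \<diamond> J (idn C (A \<otimes> g))"
    by (simp add: e_\<sigma>)
qed simp

text \<open>After composition with \<open>\<iota> X \<star> e\<close> both sides are
  \<open>e \<star> e \<star> \<iota> X\<close>. In the centre this says that \<open>\<mu>\<close> is
  a morphism from the tensor square of the algebra.\<close>

lemma \<mu>_central: "(idn C X \<boxtimes> \<mu>) \<cdot> (\<sigma> X \<boxtimes> idn C A) \<cdot> (idn C A \<boxtimes> \<sigma> X) = \<sigma> X \<cdot> (\<mu> \<boxtimes> idn C X)"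
proof (rule e_cancel_left)
  have "(\<iota> X \<star> e) \<diamond> (\<iota> X \<star> J \<mu>) \<diamond> (J (\<sigma> X) \<star> \<iota> A) \<diamond> (\<iota> A \<star> J (\<sigma> X)) =
      ((\<iota> X \<star> e) \<star> e) \<diamond> (J (\<sigma> X) \<star> \<iota> A) \<diamond> (\<iota> A \<star> J (\<sigma> X))"
    by (simp add: ten_comp_assoc e_\<mu> ten_assoc)
  also have "\<dots> = (e \<star> (\<iota> X \<star> e)) \<diamond> (\<iota> A \<star> J (\<sigma> X))"
    by (subst ten_comp_assoc) (simp_all add: e_\<sigma> ten_assoc)
  also have "\<dots> = e \<star> (e \<star> \<iota> X)"
    by (simp add: ten_comp e_\<sigma>)
  also have "\<dots> = (e \<star> \<iota> X) \<diamond> (J \<mu> \<star> \<iota> X)"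
    by (simp add: ten_comp e_\<mu> ten_assoc)
  also have "\<dots> = (\<iota> X \<star> e) \<diamond> J (\<sigma> X) \<diamond> (J \<mu> \<star> \<iota> X)"
    by (simp add: e_\<sigma>_assoc)
  finally show "(\<iota> X \<star> e) \<diamond> J ((idn C X \<boxtimes> \<mu>) \<cdot> (\<sigma> X \<boxtimes> idn C A) \<cdot> (idn C A \<boxtimes> \<sigma> X)) =
      (\<iota> X \<star> e) \<diamond> J (\<sigma> X \<cdot> (\<mu> \<boxtimes> idn C X))"
    by (simp add: J_cmp J_tar)
qed simp_all

text \<open>Transposed along \<open>e\<close>, the centre condition on a morphism
  \<open>1 \<rightarrow> A\<close> is commutation of an arrow \<open>1 \<rightarrow> 1\<close> with
  all identities. It serves both for the unit of the algebra and for connectedness.\<close>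

lemma unit_central_iff:
  assumes [simp]: "src C f = unt C" "trg C f = A"
  shows "idn C X \<boxtimes> f = \<sigma> X \<cdot> (f \<boxtimes> idn C X) \<longleftrightarrow> \<iota> X \<star> (e \<diamond> J f) = (e \<diamond> J f) \<star> \<iota> X"
proof -
  have "(\<iota> X \<star> e) \<diamond> J (idn C X \<boxtimes> f) = \<iota> X \<star> (e \<diamond> J f)"
    by (simp add: J_tar ten_comp)
  moreover have "(\<iota> X \<star> e) \<diamond> J (\<sigma> X \<cdot> (f \<boxtimes> idn C X)) = (e \<diamond> J f) \<star> \<iota> X"
    by (simp add: J_cmp J_tar e_\<sigma>_assoc ten_comp)
  ultimately show ?thesis
    using e_cancel_left[of "idn C X \<boxtimes> f" "\<sigma> X \<cdot> (f \<boxtimes> idn C X)" X] by auto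
qed

lemma \<mu>_assoc: "\<mu> \<cdot> (\<mu> \<boxtimes> idn C A) = \<mu> \<cdot> (idn C A \<boxtimes> \<mu>)"
  by (rule e_cancel) (simp_all add: J_cmp J_tar e_\<mu>_assoc ten_comp e_\<mu> ten_assoc)

lemma \<mu>_unit: "\<mu> \<cdot> (\<epsilon> \<boxtimes> idn C A) = idn C A" "\<mu> \<cdot> (idn C A \<boxtimes> \<epsilon>) = idn C A"
  by (rule e_cancel; simp add: J_cmp J_tar e_\<mu>_assoc ten_comp e_\<epsilon>)+

lemma \<mu>_commutative: "\<mu> \<cdot> \<sigma> A = \<mu>"
proof (rule e_cancel)
  have "e \<diamond> J (\<mu> \<cdot> \<sigma> A) = (e \<diamond> (\<iota> A \<star> e)) \<diamond> J (\<sigma> A)"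
    using ten_comp[of "\<iota> A" e e "\<iota> (unt C)"] by (simp add: J_cmp e_\<mu>_assoc)
  also have "\<dots> = e \<diamond> (e \<star> \<iota> A)"
    by (simp add: e_\<sigma>)
  also have "\<dots> = e \<diamond> J \<mu>"
    using ten_comp[of e "\<iota> A" "\<iota> (unt C)" e] by (simp add: e_\<mu>)
  finally show "e \<diamond> J (\<mu> \<cdot> \<sigma> A) = e \<diamond> J \<mu>" .
qed simp_all

theorem is_algebra_center: "is_algebra (center C) (A, \<sigma>) \<mu> \<epsilon>"
  using half_braiding_\<sigma> \<mu>_central unit_central_iff[of \<epsilon>] \<mu>_assoc \<mu>_unit
  by (simp add: is_algebra_def center_def hom_iff e_\<epsilon> one_ten_one)

end

section \<open>Natural transformations between action functors\<close>

context typed_module_category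
begin

lemma act_cmp: "src M a = trg M b \<Longrightarrow>
    idn C X \<odot> (a \<bullet> b) = (idn C X \<odot> a) \<bullet> (idn C X \<odot> b)"
  by (simp add: aar_cmp_typed)

lemma cmp_act: "src C a = trg C b \<Longrightarrow>
    (a \<cdot> b) \<odot> idn M N = (a \<odot> idn M N) \<bullet> (b \<odot> idn M N)"
  by (simp add: aar_cmp_typed)

lemma act_act: "idn C X \<odot> (f \<odot> g) =
    asc M X (trg C f) (trg M g) \<bullet> ((idn C X \<boxtimes> f) \<odot> g) \<bullet> asci X (src C f) (src M g)"
  by (simp add: asci_nat[of _ X X _ "src C f" "trg C f" _ "src M g" "trg M g"])

lemma act_tob: "f \<odot> idn M (Y \<ast> N) =
    asc M (trg C f) Y N \<bullet> ((f \<boxtimes> idn C Y) \<odot> idn M N) \<bullet> asci (src C f) Y N"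
  by (simp add: asci_nat[of _ "src C f" "trg C f" _ Y Y _ N N])

lemma act_asc: "idn C X \<odot> asc M Y Z N =
    asc M X Y (Z \<ast> N) \<bullet> asc M (X \<otimes> Y) Z N \<bullet> asci X (Y \<otimes> Z) N"
proof -
  have "(asc M X Y (Z \<ast> N) \<bullet> asc M (X \<otimes> Y) Z N) \<bullet> asci X (Y \<otimes> Z) N = idn C X \<odot> asc M Y Z N"
    by (simp add: pentagon_typed del: M.cmp_assoc_typed) simp
  then show ?thesis by simp
qed

lemma act_asci: "idn C X \<odot> asci Y Z N =
    asc M X (Y \<otimes> Z) N \<bullet> asci (X \<otimes> Y) Z N \<bullet> asci X Y (Z \<ast> N)"
  by (simp add: pentagon_inv)

text \<open>Rewriting with these equations moves all associativity isomorphisms to the two ends of a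
  composite, so that coherence reduces to an equation in \<open>C\<close>.\<close>

lemmas strictify = act_cmp cmp_act act_act act_tob act_asc act_asci
  asci_unit_right[symmetric] asci_unit_left[symmetric]

text \<open>A transformation from \<open>Y \<rhd> -\<close> to \<open>Z \<rhd> -\<close> is stored
  together with \<open>Y\<close> and \<open>Z\<close>, since its components need not determine these
  objects.\<close>

definition natfam :: "'c \<times> 'c \<times> ('o \<Rightarrow> 'a) \<Rightarrow> bool" where
  "natfam = (\<lambda>(Y, Z, \<alpha>). (\<forall>N. src M (\<alpha> N) = Y \<ast> N \<and> trg M (\<alpha> N) = Z \<ast> N) \<and>
     (\<forall>f. \<alpha> (trg M f) \<bullet> (idn C Y \<odot> f) = (idn C Z \<odot> f) \<bullet> \<alpha> (src M f)))"

definition natcmp :: "'c \<times> 'c \<times> ('o \<Rightarrow> 'a) \<Rightarrow> 'c \<times> 'c \<times> ('o \<Rightarrow> 'a) \<Rightarrow> 'c \<times> 'c \<times> ('o \<Rightarrow> 'a)" where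
  "natcmp = (\<lambda>(Y', Z', \<beta>) (Y, Z, \<alpha>). (Y, Z', \<lambda>N. \<beta> N \<bullet> \<alpha> N))"

text \<open>Horizontal composition, conjugated by associators so that it runs between the action
  functors of the tensor products.\<close>

definition natten :: "'c \<times> 'c \<times> ('o \<Rightarrow> 'a) \<Rightarrow> 'c \<times> 'c \<times> ('o \<Rightarrow> 'a) \<Rightarrow> 'c \<times> 'c \<times> ('o \<Rightarrow> 'a)" where
  "natten = (\<lambda>(Y, Z, \<alpha>) (Y', Z', \<beta>). (Y \<otimes> Y', Z \<otimes> Z',
     \<lambda>N. asci Z Z' N \<bullet> \<alpha> (Z' \<ast> N) \<bullet> (idn C Y \<odot> \<beta> N) \<bullet> asc M Y Y' N))"

definition natact :: "'e \<Rightarrow> 'c \<times> 'c \<times> ('o \<Rightarrow> 'a)" where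
  "natact u = (src C u, trg C u, \<lambda>N. u \<odot> idn M N)"

lemma natfamD:
  assumes "natfam (Y, Z, \<alpha>)"
  shows "src M (\<alpha> N) = Y \<ast> N" "trg M (\<alpha> N) = Z \<ast> N"
    and "\<lbrakk>trg M f = N; src M f = N'\<rbrakk> \<Longrightarrow> \<alpha> N \<bullet> (idn C Y \<odot> f) = (idn C Z \<odot> f) \<bullet> \<alpha> N'"
    and "\<lbrakk>trg M f = N; src M f = N'; trg M h = Y \<ast> N'\<rbrakk> \<Longrightarrow>
      \<alpha> N \<bullet> (idn C Y \<odot> f) \<bullet> h = (idn C Z \<odot> f) \<bullet> \<alpha> N' \<bullet> h"
proof -
  show t: "src M (\<alpha> N) = Y \<ast> N" "trg M (\<alpha> N) = Z \<ast> N" for N using assms by (auto simp: natfam_def)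
  show n: "\<alpha> N \<bullet> (idn C Y \<odot> f) = (idn C Z \<odot> f) \<bullet> \<alpha> N'" if "trg M f = N" "src M f = N'"
    using assms that by (auto simp: natfam_def)
  show "\<alpha> N \<bullet> (idn C Y \<odot> f) \<bullet> h = (idn C Z \<odot> f) \<bullet> \<alpha> N' \<bullet> h"
    if "trg M f = N" "src M f = N'" "trg M h = Y \<ast> N'"
    using n[OF that(1,2)] that by (simp add: t flip: M.cmp_assoc_typed)
qed

text \<open>Associativity of \<open>natten\<close> is the pentagon together with naturality,
  interchange is naturality of the left-hand family, and the unit laws are the two triangles.
  Abstract arguments about \<open>e\<close> then run without associators.\<close>

lemma tensor_extension_natfam:
  "tensor_extension C natfam fst (\<lambda>f. fst (snd f)) natcmp natten natact"
proof unfold_locales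
  fix f g assume "natfam f" "natfam g" "fst (snd f) = fst g"
  then obtain Y Z W \<alpha> \<beta> where eq: "f = (Y, Z, \<alpha>)" "g = (Z, W, \<beta>)" and \<alpha>: "natfam (Y, Z, \<alpha>)" and \<beta>: "natfam (Z, W, \<beta>)"
    by (cases f; cases g) auto
  show "natfam (natcmp g f)" "fst (natcmp g f) = fst f" "fst (snd (natcmp g f)) = fst (snd g)"
    using natfamD[OF \<alpha>] natfamD[OF \<beta>] by (auto simp: eq natcmp_def natfam_def)
next
  fix f g h assume "natfam f" "natfam g" "natfam h" "fst (snd f) = fst g" "fst (snd g) = fst h"
  then obtain Y Z W U \<alpha> \<beta> \<gamma> where eq: "f = (Y, Z, \<alpha>)" "g = (Z, W, \<beta>)" "h = (W, U, \<gamma>)"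
    and \<alpha>: "natfam (Y, Z, \<alpha>)" and \<beta>: "natfam (Z, W, \<beta>)" and \<gamma>: "natfam (W, U, \<gamma>)"
    by (cases f; cases g; cases h) auto
  show "natcmp (natcmp h g) f = natcmp h (natcmp g f)"
    by (simp add: eq natcmp_def natfamD(1,2)[OF \<alpha>] natfamD(1,2)[OF \<beta>] natfamD(1,2)[OF \<gamma>])
next
  fix f g assume "natfam f" "natfam g"
  then obtain Y Z Y' Z' \<alpha> \<beta> where eq: "f = (Y, Z, \<alpha>)" "g = (Y', Z', \<beta>)"
    and \<alpha>: "natfam (Y, Z, \<alpha>)" and \<beta>: "natfam (Y', Z', \<beta>)"
    by (cases f; cases g) auto
  note [simp] = natfamD(1,2)[OF \<alpha>] natfamD(1,2)[OF \<beta>]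
  have "asci Z Z' (trg M u) \<bullet> \<alpha> (Z' \<ast> trg M u) \<bullet> (idn C Y \<odot> \<beta> (trg M u)) \<bullet>
      asc M Y Y' (trg M u) \<bullet> (idn C (Y \<otimes> Y') \<odot> u) =
    (idn C (Z \<otimes> Z') \<odot> u) \<bullet> asci Z Z' (src M u) \<bullet> \<alpha> (Z' \<ast> src M u) \<bullet>
      (idn C Y \<odot> \<beta> (src M u)) \<bullet> asc M Y Y' (src M u)" for u
  proof -
    have 1: "asc M Y Y' (trg M u) \<bullet> (idn C (Y \<otimes> Y') \<odot> u) =
        (idn C Y \<odot> idn C Y' \<odot> u) \<bullet> asc M Y Y' (src M u)"
      using asc_nat[of "idn C Y" Y Y "idn C Y'" Y' Y' u] by simp
    have 2: "(idn C (Z \<otimes> Z') \<odot> u) \<bullet> asci Z Z' (src M u) =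
        asci Z Z' (trg M u) \<bullet> (idn C Z \<odot> idn C Z' \<odot> u)"
      using asci_nat[of "idn C Z" Z Z "idn C Z'" Z' Z' u] by simp
    have 3: "(idn C Y \<odot> \<beta> (trg M u)) \<bullet> (idn C Y \<odot> idn C Y' \<odot> u) =
        (idn C Y \<odot> idn C Z' \<odot> u) \<bullet> (idn C Y \<odot> \<beta> (src M u))"
      by (simp add: natfamD(3)[OF \<beta>] flip: act_cmp)
    have "asci Z Z' (trg M u) \<bullet> \<alpha> (Z' \<ast> trg M u) \<bullet> (idn C Y \<odot> \<beta> (trg M u)) \<bullet>
        asc M Y Y' (trg M u) \<bullet> (idn C (Y \<otimes> Y') \<odot> u) =
      asci Z Z' (trg M u) \<bullet> \<alpha> (Z' \<ast> trg M u) \<bullet> ((idn C Y \<odot> \<beta> (trg M u)) \<bullet>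
        (idn C Y \<odot> idn C Y' \<odot> u)) \<bullet> asc M Y Y' (src M u)"
      by (simp add: 1)
    also have "\<dots> = (asci Z Z' (trg M u) \<bullet> (idn C Z \<odot> idn C Z' \<odot> u)) \<bullet> \<alpha> (Z' \<ast> src M u) \<bullet>
        (idn C Y \<odot> \<beta> (src M u)) \<bullet> asc M Y Y' (src M u)"
      unfolding 3 by (simp add: natfamD(4)[OF \<alpha>])
    finally show ?thesis by (simp flip: 2)
  qed
  then show "natfam (natten f g)"
    by (simp add: eq natten_def natfam_def)
  show "fst (natten f g) = fst f \<otimes> fst g" "fst (snd (natten f g)) = fst (snd f) \<otimes> fst (snd g)"
    by (simp_all add: eq natten_def)
next
  fix f g h assume "natfam f" "natfam g" "natfam h"
  then obtain Y Z Y' Z' Y'' Z'' \<alpha> \<beta> \<gamma> where eq: "f = (Y, Z, \<alpha>)" "g = (Y', Z', \<beta>)" "h = (Y'', Z'', \<gamma>)"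
    and \<alpha>: "natfam (Y, Z, \<alpha>)" and \<beta>: "natfam (Y', Z', \<beta>)" and \<gamma>: "natfam (Y'', Z'', \<gamma>)"
    by (cases f; cases g; cases h) auto
  note [simp] = natfamD(1,2)[OF \<alpha>] natfamD(1,2)[OF \<beta>] natfamD(1,2)[OF \<gamma>]
  show "natten (natten f g) h = natten f (natten g h)"
  proof -
    have "asci (Z \<otimes> Z') Z'' N \<bullet> (asci Z Z' (Z'' \<ast> N) \<bullet> \<alpha> (Z' \<ast> Z'' \<ast> N) \<bullet>
          (idn C Y \<odot> \<beta> (Z'' \<ast> N)) \<bullet> asc M Y Y' (Z'' \<ast> N)) \<bullet>
          (idn C (Y \<otimes> Y') \<odot> \<gamma> N) \<bullet> asc M (Y \<otimes> Y') Y'' N =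
        asci Z (Z' \<otimes> Z'') N \<bullet> \<alpha> ((Z' \<otimes> Z'') \<ast> N) \<bullet> (idn C Y \<odot> (asci Z' Z'' N \<bullet>
          \<beta> (Z'' \<ast> N) \<bullet> (idn C Y' \<odot> \<gamma> N) \<bullet> asc M Y' Y'' N)) \<bullet> asc M Y (Y' \<otimes> Y'') N" (is "?L = ?R") for N
    proof -
      have "?R = asci Z (Z' \<otimes> Z'') N \<bullet> \<alpha> ((Z' \<otimes> Z'') \<ast> N) \<bullet> (idn C Y \<odot> asci Z' Z'' N) \<bullet>
          (idn C Y \<odot> \<beta> (Z'' \<ast> N)) \<bullet> (idn C Y \<odot> idn C Y' \<odot> \<gamma> N) \<bullet>
          (idn C Y \<odot> asc M Y' Y'' N) \<bullet> asc M Y (Y' \<otimes> Y'') N"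
        by (simp add: act_cmp)
      also have "(idn C Y \<odot> asc M Y' Y'' N) \<bullet> asc M Y (Y' \<otimes> Y'') N =
          asc M Y Y' (Y'' \<ast> N) \<bullet> asc M (Y \<otimes> Y') Y'' N"
        by (simp add: pentagon_typed)
      also have "(idn C Y \<odot> idn C Y' \<odot> \<gamma> N) \<bullet> asc M Y Y' (Y'' \<ast> N) \<bullet> asc M (Y \<otimes> Y') Y'' N =
          asc M Y Y' (Z'' \<ast> N) \<bullet> (idn C (Y \<otimes> Y') \<odot> \<gamma> N) \<bullet> asc M (Y \<otimes> Y') Y'' N"
        using asc_nat_assoc[of "idn C Y" Y Y "idn C Y'" Y' Y' "\<gamma> N"] by simp
      \<comment> \<open>Naturality of \<open>\<alpha>\<close> along an inverse associator moves the
        latter to the left end, where \<open>act_asci\<close> absorbs it.\<close>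
      also have "\<alpha> ((Z' \<otimes> Z'') \<ast> N) \<bullet> (idn C Y \<odot> asci Z' Z'' N) \<bullet>
          (idn C Y \<odot> \<beta> (Z'' \<ast> N)) \<bullet> asc M Y Y' (Z'' \<ast> N) \<bullet>
          (idn C (Y \<otimes> Y') \<odot> \<gamma> N) \<bullet> asc M (Y \<otimes> Y') Y'' N =
          (idn C Z \<odot> asci Z' Z'' N) \<bullet> \<alpha> (Z' \<ast> Z'' \<ast> N) \<bullet>
          (idn C Y \<odot> \<beta> (Z'' \<ast> N)) \<bullet> asc M Y Y' (Z'' \<ast> N) \<bullet>
          (idn C (Y \<otimes> Y') \<odot> \<gamma> N) \<bullet> asc M (Y \<otimes> Y') Y'' N"
        by (rule natfamD(4)[OF \<alpha>]) simp_all
      finally show ?thesis by (simp add: act_asci)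
    qed
    then show ?thesis by (simp add: eq natten_def)
  qed
next
  fix f g f' g' assume "natfam f" "natfam g" "natfam f'" "natfam g'" "fst (snd f) = fst f'" "fst (snd g) = fst g'"
  then obtain Y Z W Y' Z' W' \<alpha> \<beta> \<alpha>' \<beta>' where
    eq: "f = (Y, Z, \<alpha>)" "g = (Y', Z', \<beta>)" "f' = (Z, W, \<alpha>')" "g' = (Z', W', \<beta>')"
    and \<alpha>: "natfam (Y, Z, \<alpha>)" and \<beta>: "natfam (Y', Z', \<beta>)"
    and \<alpha>': "natfam (Z, W, \<alpha>')" and \<beta>': "natfam (Z', W', \<beta>')"
    by (cases f; cases g; cases f'; cases g') auto
  note [simp] = natfamD(1,2)[OF \<alpha>] natfamD(1,2)[OF \<beta>] natfamD(1,2)[OF \<alpha>'] natfamD(1,2)[OF \<beta>']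
  show "natcmp (natten f' g') (natten f g) = natten (natcmp f' f) (natcmp g' g)"
    by (simp add: eq natten_def natcmp_def act_cmp natfamD(4)[OF \<alpha>])
next
  fix u v assume "trg C u = src C v"
  then show "natact (v \<cdot> u) = natcmp (natact v) (natact u)"
    by (simp add: natact_def natcmp_def cmp_act)
next
  fix u v
  show "natact (u \<boxtimes> v) = natten (natact u) (natact v)"
    by (simp add: natact_def natten_def aar_cmp_typed_assoc tar_aar_conj)
next
  fix f assume "natfam f"
  then obtain Y Z \<alpha> where eq: "f = (Y, Z, \<alpha>)" and \<alpha>: "natfam (Y, Z, \<alpha>)" by (cases f) auto
  note [simp] = natfamD(1,2)[OF \<alpha>]
  have "lun M (Z \<ast> N) \<bullet> (idn C (unt C) \<odot> \<alpha> N) \<bullet> asc M (unt C) Y N = \<alpha> N" for N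
    using lun_nat[of "\<alpha> N"] unit_triangle_left[of Y N] by (simp flip: M.cmp_assoc_typed) simp
  then show "natten (natact (idn C (unt C))) f = f"
    by (simp add: eq natten_def natact_def asci_unit_left)
  have "(idn C Z \<odot> lun M N) \<bullet> \<alpha> (unt C \<ast> N) \<bullet> asc M Y (unt C) N = \<alpha> N" for N
    using natfamD(4)[OF \<alpha>, of "lun M N" N "unt C \<ast> N" "asc M Y (unt C) N"] by (simp add: unit_triangle_typed)
  then show "natten f (natact (idn C (unt C))) = f"
    by (simp add: eq natten_def natact_def asci_unit_right)
qed (auto simp: natfam_def natact_def natcmp_def aar_cmp_typed)

end

section \<open>Zero arrows and scalar multiples\<close>

context typed_category
begin

lemma src_zer [simp]: "src C (zer C X Y) = X" and trg_zer [simp]: "trg C (zer C X Y) = Y"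
  using zer_in[of X Y] by (simp_all add: hom_iff)

lemma src_scl [simp]: "src C (scl C a f) = src C f" and trg_scl [simp]: "trg C (scl C a f) = trg C f"
  using scl_in[of "src C f" "trg C f" f a] by (simp_all add: hom_iff)

lemma src_pls [simp]: "\<lbrakk>src C f = src C g; trg C f = trg C g\<rbrakk> \<Longrightarrow> src C (f \<oplus> g) = src C g"
  and trg_pls [simp]: "\<lbrakk>src C f = src C g; trg C f = trg C g\<rbrakk> \<Longrightarrow> trg C (f \<oplus> g) = trg C g"
  using pls_in[of "src C f" "trg C f" f g] by (simp_all add: hom_iff)

lemma scl_0: "scl C 0 f = zer C (src C f) (trg C f)"
  by (rule scl_zero) (simp_all add: hom_iff)

lemma scl_cmp: "trg C f = src C g \<Longrightarrow> scl C a g \<cdot> f = scl C a (g \<cdot> f)"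
  by (rule cmp_scl_left[of "src C f" "src C g" "trg C g"]) (simp_all add: hom_iff)

lemma cmp_scl: "trg C f = src C g \<Longrightarrow> g \<cdot> scl C a f = scl C a (g \<cdot> f)"
  by (rule cmp_scl_right[of "src C f" "src C g" "trg C g"]) (simp_all add: hom_iff)

lemma zer_cmp [simp]: "trg C f = X \<Longrightarrow> zer C X Y \<cdot> f = zer C (src C f) Y"
  using scl_cmp[of f "zer C X Y" 0] by (simp add: scl_0)

lemma cmp_zer [simp]: "src C f = Y \<Longrightarrow> f \<cdot> zer C X Y = zer C X (trg C f)"
  using cmp_scl[of "zer C X Y" f 0] by (simp add: scl_0)

end

section \<open>Unitors and the adjunctions given by dual pairs\<close>

context typed_module_category
begin

lemma aar_zer [simp]: "f \<odot> zer M X Y = zer M (src C f \<ast> X) (trg C f \<ast> Y)"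
  using aar_scl_right[of "src C f" "trg C f" X Y f "zer M X Y" 0] by (simp add: hom_iff M.hom_iff M.scl_0)

lemma asc_nat_id: "asc M X Y (trg M f) \<bullet> (idn C (X \<otimes> Y) \<odot> f) =
    (idn C X \<odot> idn C Y \<odot> f) \<bullet> asc M X Y (src M f)"
  using asc_nat[of "idn C X" X X "idn C Y" Y Y f] by simp

lemma asci_nat_id: "asci X Y (trg M f) \<bullet> (idn C X \<odot> idn C Y \<odot> f) =
    (idn C (X \<otimes> Y) \<odot> f) \<bullet> asci X Y (src M f)"
  using asci_nat[of "idn C X" X X "idn C Y" Y Y f] by simp

lemma exchange: "(u \<odot> idn M (trg M f)) \<bullet> (idn C (src C u) \<odot> f) =
    (idn C (trg C u) \<odot> f) \<bullet> (u \<odot> idn M (src M f))"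
  by (simp add: aar_cmp_typed)

definition luni :: "'o \<Rightarrow> 'a" where
  "luni N = arr_inv M (unt C \<ast> N) N (lun M N)"

lemma src_luni [simp]: "src M (luni N) = N" and trg_luni [simp]: "trg M (luni N) = unt C \<ast> N"
  and luni_lun [simp]: "luni N \<bullet> lun M N = idn M (unt C \<ast> N)"
  and lun_luni [simp]: "lun M N \<bullet> luni N = idn M N"
  using lun_iso_typed by (simp_all add: luni_def)

lemma luni_lun_assoc [simp]: "trg M h = unt C \<ast> N \<Longrightarrow> luni N \<bullet> lun M N \<bullet> h = h"
  and lun_luni_assoc [simp]: "trg M h = N \<Longrightarrow> lun M N \<bullet> luni N \<bullet> h = h"
  using lun_iso_typed by (simp_all add: luni_def)

lemma luni_nat: "luni (trg M f) \<bullet> f = (idn C (unt C) \<odot> f) \<bullet> luni (src M f)"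
proof -
  have "luni (trg M f) \<bullet> (f \<bullet> lun M (src M f)) \<bullet> luni (src M f) =
      (idn C (unt C) \<odot> f) \<bullet> luni (src M f)"
    by (simp flip: lun_nat)
  then show ?thesis by simp
qed

text \<open>The evaluation and coevaluation of a dual pair make \<open>D \<rhd> -\<close> left adjoint to \<open>Y \<rhd> -\<close>.\<close>

definition evalact :: "'c \<Rightarrow> 'c \<Rightarrow> 'e \<Rightarrow> 'o \<Rightarrow> 'a" where
  "evalact Y D ev N = lun M N \<bullet> (ev \<odot> idn M N) \<bullet> asci D Y N"

definition coevact :: "'c \<Rightarrow> 'c \<Rightarrow> 'e \<Rightarrow> 'o \<Rightarrow> 'a" where
  "coevact Y D co N = asc M Y D N \<bullet> (co \<odot> idn M N) \<bullet> luni N"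

lemma
  assumes "src C ev = D \<otimes> Y" "trg C ev = unt C"
  shows src_evalact [simp]: "src M (evalact Y D ev N) = D \<ast> Y \<ast> N"
    and trg_evalact [simp]: "trg M (evalact Y D ev N) = N"
    and evalact_natural: "evalact Y D ev (trg M f) \<bullet> (idn C D \<odot> idn C Y \<odot> f) = f \<bullet> evalact Y D ev (src M f)"
proof -
  note [simp] = assms
  show "src M (evalact Y D ev N) = D \<ast> Y \<ast> N" "trg M (evalact Y D ev N) = N"
    by (simp_all add: evalact_def)
  have "evalact Y D ev (trg M f) \<bullet> (idn C D \<odot> idn C Y \<odot> f) =
      lun M (trg M f) \<bullet> ((ev \<odot> idn M (trg M f)) \<bullet> (idn C (D \<otimes> Y) \<odot> f)) \<bullet> asci D Y (src M f)"
    by (simp add: evalact_def asci_nat_id)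
  also have "\<dots> = (lun M (trg M f) \<bullet> (idn C (unt C) \<odot> f)) \<bullet> (ev \<odot> idn M (src M f)) \<bullet> asci D Y (src M f)"
    using exchange[of ev f] by simp
  also have "\<dots> = f \<bullet> evalact Y D ev (src M f)"
    unfolding lun_nat by (simp add: evalact_def)
  finally show "evalact Y D ev (trg M f) \<bullet> (idn C D \<odot> idn C Y \<odot> f) = f \<bullet> evalact Y D ev (src M f)" .
qed

lemma
  assumes "src C co = unt C" "trg C co = Y \<otimes> D"
  shows src_coevact [simp]: "src M (coevact Y D co N) = N"
    and trg_coevact [simp]: "trg M (coevact Y D co N) = Y \<ast> D \<ast> N"
    and coevact_natural: "coevact Y D co (trg M f) \<bullet> f = (idn C Y \<odot> idn C D \<odot> f) \<bullet> coevact Y D co (src M f)"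
proof -
  note [simp] = assms
  show "src M (coevact Y D co N) = N" "trg M (coevact Y D co N) = Y \<ast> D \<ast> N"
    by (simp_all add: coevact_def)
  have "coevact Y D co (trg M f) \<bullet> f =
      asc M Y D (trg M f) \<bullet> ((co \<odot> idn M (trg M f)) \<bullet> (idn C (unt C) \<odot> f)) \<bullet> luni (src M f)"
    by (simp add: coevact_def luni_nat)
  also have "\<dots> = (asc M Y D (trg M f) \<bullet> (idn C (Y \<otimes> D) \<odot> f)) \<bullet> (co \<odot> idn M (src M f)) \<bullet> luni (src M f)"
    using exchange[of co f] by simp
  also have "\<dots> = (idn C Y \<odot> idn C D \<odot> f) \<bullet> coevact Y D co (src M f)"
    unfolding asc_nat_id by (simp add: coevact_def)
  finally show "coevact Y D co (trg M f) \<bullet> f = (idn C Y \<odot> idn C D \<odot> f) \<bullet> coevact Y D co (src M f)" .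
qed

text \<open>This is a zigzag identity of \<open>C\<close> acting on \<open>N\<close>;
  \<open>strictify\<close> pushes all associators to the ends, where they cancel against the
  unitor.\<close>

lemma act_evalact_coevact:
  assumes [simp]: "src C ev = D \<otimes> Y" "trg C ev = unt C" "src C co = unt C" "trg C co = Y \<otimes> D"
    and zigzag: "(idn C Y \<boxtimes> ev) \<cdot> (co \<boxtimes> idn C Y) = idn C Y"
  shows "(idn C Y \<odot> evalact Y D ev N) \<bullet> coevact Y D co (Y \<ast> N) = idn M (Y \<ast> N)"
proof -
  have z: "((idn C Y \<boxtimes> ev) \<odot> idn M N) \<bullet> ((co \<boxtimes> idn C Y) \<odot> idn M N) = idn M (Y \<ast> N)"
    by (simp add: zigzag flip: cmp_act)
  have "(idn C Y \<odot> evalact Y D ev N) \<bullet> coevact Y D co (Y \<ast> N) =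
      (((idn C Y \<boxtimes> ev) \<odot> idn M N) \<bullet> ((co \<boxtimes> idn C Y) \<odot> idn M N)) \<bullet> asci (unt C) Y N \<bullet> luni (Y \<ast> N)"
    by (simp add: evalact_def coevact_def strictify)
  then show ?thesis unfolding z by (simp add: asci_unit_left)
qed

lemma evalact_act_coevact:
  assumes [simp]: "src C ev = D \<otimes> Y" "trg C ev = unt C" "src C co = unt C" "trg C co = Y \<otimes> D"
    and zigzag: "(ev \<boxtimes> idn C D) \<cdot> (idn C D \<boxtimes> co) = idn C D"
  shows "evalact Y D ev (D \<ast> N) \<bullet> (idn C D \<odot> coevact Y D co N) = idn M (D \<ast> N)"
proof -
  have z: "((ev \<boxtimes> idn C D) \<odot> idn M N) \<bullet> ((idn C D \<boxtimes> co) \<odot> idn M N) = idn M (D \<ast> N)"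
    by (simp add: zigzag flip: cmp_act)
  have l: "asci D (unt C) N \<bullet> (idn C D \<odot> luni N) = idn M (D \<ast> N)"
    by (simp add: asci_unit_right flip: act_cmp)
  have "evalact Y D ev (D \<ast> N) \<bullet> (idn C D \<odot> coevact Y D co N) =
      (((ev \<boxtimes> idn C D) \<odot> idn M N) \<bullet> ((idn C D \<boxtimes> co) \<odot> idn M N)) \<bullet> asci D (unt C) N \<bullet> (idn C D \<odot> luni N)"
    by (simp add: evalact_def coevact_def strictify)
  then show ?thesis unfolding z by (simp add: l)
qed

text \<open>An arrow into \<open>Y \<rhd> N\<close> is recovered from its transpose by acting with
  \<open>Y\<close> and precomposing with the coevaluation.\<close>

lemma evalact_inject:
  assumes ty: "src C ev = D \<otimes> Y" "trg C ev = unt C" "src C co = unt C" "trg C co = Y \<otimes> D"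
    and zigzag: "(idn C Y \<boxtimes> ev) \<cdot> (co \<boxtimes> idn C Y) = idn C Y"
    and "src M f = src M g" "trg M f = Y \<ast> N" "trg M g = Y \<ast> N"
    and eq: "evalact Y D ev N \<bullet> (idn C D \<odot> f) = evalact Y D ev N \<bullet> (idn C D \<odot> g)"
  shows "f = g"
proof -
  have "(idn C Y \<odot> (evalact Y D ev N \<bullet> (idn C D \<odot> h))) \<bullet> coevact Y D co (src M h) = h"
    if h: "trg M h = Y \<ast> N" for h
  proof -
    have "(idn C Y \<odot> (evalact Y D ev N \<bullet> (idn C D \<odot> h))) \<bullet> coevact Y D co (src M h) =
        (idn C Y \<odot> evalact Y D ev N) \<bullet> coevact Y D co (trg M h) \<bullet> h"
      unfolding coevact_natural[OF ty(3,4)] using h ty by (simp add: act_cmp)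
    also have "\<dots> = ((idn C Y \<odot> evalact Y D ev N) \<bullet> coevact Y D co (Y \<ast> N)) \<bullet> h"
      using h ty by simp
    finally show ?thesis
      using h by (simp only: act_evalact_coevact[OF ty zigzag]) simp
  qed
  then show ?thesis using assms by metis
qed

text \<open>Left adjoints preserve cokernels and epimorphisms, right adjoints preserve kernels.\<close>

lemma
  assumes dual: "left_dual C Y D ev co"
  shows act_cokernel: "is_cokernel M N K Q f q \<Longrightarrow> src M f = N \<Longrightarrow> trg M f = K \<Longrightarrow>
      is_cokernel M (D \<ast> N) (D \<ast> K) (D \<ast> Q) (idn C D \<odot> f) (idn C D \<odot> q)"
    and act_epi: "is_epi M N K f \<Longrightarrow> is_epi M (D \<ast> N) (D \<ast> K) (idn C D \<odot> f)"
    and act_kernel: "is_kernel M L N K k f \<Longrightarrow> src M f = N \<Longrightarrow> trg M f = K \<Longrightarrow>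
      is_kernel M (Y \<ast> L) (Y \<ast> N) (Y \<ast> K) (idn C Y \<odot> k) (idn C Y \<odot> f)"
proof -
  have ty [simp]: "src C ev = D \<otimes> Y" "trg C ev = unt C" "src C co = unt C" "trg C co = Y \<otimes> D"
    and zz: "(idn C Y \<boxtimes> ev) \<cdot> (co \<boxtimes> idn C Y) = idn C Y" "(ev \<boxtimes> idn C D) \<cdot> (idn C D \<boxtimes> co) = idn C D"
    using dual by (auto simp: left_dual_def hom_iff)
  \<comment> \<open>\<open>flat\<close> and \<open>sharp\<close> are the two directions of the
    bijection between arrows \<open>N \<rightarrow> Y \<rhd> K\<close> and
    \<open>D \<rhd> N \<rightarrow> K\<close>; they reduce each universal property to the given
    one.\<close>
  define flat where "flat h K = evalact Y D ev K \<bullet> (idn C D \<odot> h)" for h K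
  define sharp where "sharp u N = (idn C Y \<odot> u) \<bullet> coevact Y D co N" for u N
  have fty [simp]: "src M (flat h K) = D \<ast> src M h" "trg M (flat h K) = K" if "trg M h = Y \<ast> K" for h K
    using that by (simp_all add: flat_def)
  have sty [simp]: "src M (sharp u N) = N" "trg M (sharp u N) = Y \<ast> trg M u" if "src M u = D \<ast> N" for u N
    using that by (simp_all add: sharp_def)
  have sf: "sharp (flat h K) (src M h) = h" if h: "trg M h = Y \<ast> K" for h K
  proof -
    have "sharp (flat h K) (src M h) = (idn C Y \<odot> evalact Y D ev K) \<bullet> coevact Y D co (trg M h) \<bullet> h"
      unfolding coevact_natural[OF ty(3,4)] using h by (simp add: act_cmp sharp_def flat_def)
    also have "\<dots> = ((idn C Y \<odot> evalact Y D ev K) \<bullet> coevact Y D co (Y \<ast> K)) \<bullet> h"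
      using h by simp
    finally show ?thesis
      using h by (simp only: act_evalact_coevact[OF ty zz(1)]) simp
  qed
  have fs: "flat (sharp u N) (trg M u) = u" if u: "src M u = D \<ast> N" for u N
  proof -
    have "flat (sharp u N) (trg M u) = (evalact Y D ev (trg M u) \<bullet> (idn C D \<odot> idn C Y \<odot> u)) \<bullet>
        (idn C D \<odot> coevact Y D co N)"
      using u by (simp add: act_cmp sharp_def flat_def)
    also have "\<dots> = u \<bullet> evalact Y D ev (D \<ast> N) \<bullet> (idn C D \<odot> coevact Y D co N)"
      unfolding evalact_natural[OF ty(1,2)] using u by simp
    finally show ?thesis
      using u by (simp only: evalact_act_coevact[OF ty zz(2)]) simp
  qed
  have s_cmp: "sharp (u \<bullet> (idn C D \<odot> f)) (src M f) = sharp u (trg M f) \<bullet> f" if "src M u = D \<ast> trg M f" for u f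
    using that by (simp add: sharp_def coevact_natural act_cmp)
  have f_cmp: "flat ((idn C Y \<odot> f) \<bullet> h) (trg M f) = f \<bullet> flat h (src M f)" if "trg M h = Y \<ast> src M f" for h f
  proof -
    have "flat ((idn C Y \<odot> f) \<bullet> h) (trg M f) =
        (evalact Y D ev (trg M f) \<bullet> (idn C D \<odot> idn C Y \<odot> f)) \<bullet> (idn C D \<odot> h)"
      using that by (simp add: flat_def act_cmp)
    then show ?thesis unfolding evalact_natural[OF ty(1,2)] using that by (simp add: flat_def)
  qed
  have s_post: "sharp (v \<bullet> u) N = (idn C Y \<odot> v) \<bullet> sharp u N" if "src M u = D \<ast> N" "trg M u = src M v" for u v N
    using that by (simp add: sharp_def act_cmp)
  have f_pre: "flat (h \<bullet> f) K = flat h K \<bullet> (idn C D \<odot> f)" if "trg M h = Y \<ast> K" "trg M f = src M h" for h f K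
    using that by (simp add: flat_def act_cmp)
  {
    assume ck: "is_cokernel M N K Q f q" and f [simp]: "src M f = N" "trg M f = K"
    have q [simp]: "src M q = K" "trg M q = Q" "q \<bullet> f = zer M N Q"
      and un: "\<And>Z g. src M g = K \<Longrightarrow> trg M g = Z \<Longrightarrow> g \<bullet> f = zer M N Z \<Longrightarrow>
        \<exists>!u. (src M u = Q \<and> trg M u = Z) \<and> u \<bullet> q = g"
      using ck by (auto simp: is_cokernel_def M.hom_iff)
    show "is_cokernel M (D \<ast> N) (D \<ast> K) (D \<ast> Q) (idn C D \<odot> f) (idn C D \<odot> q)"
      unfolding is_cokernel_def
    proof (intro conjI ballI impI)
      fix Z g assume "g \<in> hom M (D \<ast> K) Z" and 0: "g \<bullet> (idn C D \<odot> f) = zer M (D \<ast> N) Z"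
      then have g [simp]: "src M g = D \<ast> K" "trg M g = Z" by (simp_all add: M.hom_iff)
      \<comment> \<open>Transposition is natural, and the transpose of a zero arrow is zero.\<close>
      have "sharp g K \<bullet> f = zer M N (Y \<ast> Z)"
      proof -
        have "sharp g K \<bullet> f = sharp (zer M (D \<ast> N) Z) N"
          using s_cmp[of g f] unfolding 0[symmetric] by simp
        then show ?thesis by (simp add: sharp_def)
      qed
      then have ex: "\<exists>!u. (src M u = Q \<and> trg M u = Y \<ast> Z) \<and> u \<bullet> q = sharp g K"
        by (intro un) simp_all
      then obtain u where u [simp]: "src M u = Q" "trg M u = Y \<ast> Z" "u \<bullet> q = sharp g K"
        by blast
      have uu: "v = u" if "src M v = Q" "trg M v = Y \<ast> Z" "v \<bullet> q = sharp g K" for v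
        using ex that u by blast
      show "\<exists>!v. v \<in> hom M (D \<ast> Q) Z \<and> v \<bullet> (idn C D \<odot> q) = g"
      proof (intro ex1I[of _ "flat u Z"] conjI)
        show "flat u Z \<bullet> (idn C D \<odot> q) = g"
          using f_pre[of u Z q] fs[of g K] by simp
        fix v assume v: "v \<in> hom M (D \<ast> Q) Z \<and> v \<bullet> (idn C D \<odot> q) = g"
        then have "sharp v Q = u"
          using s_cmp[of v q] by (intro uu) (auto simp: M.hom_iff)
        then show "v = flat u Z" using fs[of v Q] v by (auto simp: M.hom_iff)
      qed (simp add: M.hom_iff)
    qed (simp_all add: M.hom_iff flip: act_cmp)
  next
    assume "is_epi M N K f"
    then have f [simp]: "src M f = N" "trg M f = K" and
      ep: "\<And>g h. src M g = K \<Longrightarrow> src M h = K \<Longrightarrow> trg M g = trg M h \<Longrightarrow> g \<bullet> f = h \<bullet> f \<Longrightarrow> g = h"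
      by (auto simp: is_epi_def M.hom_iff)
    show "is_epi M (D \<ast> N) (D \<ast> K) (idn C D \<odot> f)"
      unfolding is_epi_def
    proof (intro conjI ballI impI)
      fix Z g h assume "g \<in> hom M (D \<ast> K) Z" "h \<in> hom M (D \<ast> K) Z"
        and eq: "g \<bullet> (idn C D \<odot> f) = h \<bullet> (idn C D \<odot> f)"
      then have [simp]: "src M g = D \<ast> K" "src M h = D \<ast> K" "trg M g = Z" "trg M h = Z" by (simp_all add: M.hom_iff)
      have "sharp g K = sharp h K"
        by (rule ep) (use s_cmp[of g f] s_cmp[of h f] eq in simp_all)
      then show "g = h" using fs[of g K] fs[of h K] by simp
    qed (simp_all add: M.hom_iff)
  next
    assume ke: "is_kernel M L N K k f" and f [simp]: "src M f = N" "trg M f = K"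
    have q [simp]: "src M k = L" "trg M k = N" "f \<bullet> k = zer M L K"
      and un: "\<And>W g. src M g = W \<Longrightarrow> trg M g = N \<Longrightarrow> f \<bullet> g = zer M W K \<Longrightarrow>
        \<exists>!u. (src M u = W \<and> trg M u = L) \<and> k \<bullet> u = g"
      using ke by (auto simp: is_kernel_def M.hom_iff)
    show "is_kernel M (Y \<ast> L) (Y \<ast> N) (Y \<ast> K) (idn C Y \<odot> k) (idn C Y \<odot> f)"
      unfolding is_kernel_def
    proof (intro conjI ballI impI)
      fix W g assume "g \<in> hom M W (Y \<ast> N)" and 0: "(idn C Y \<odot> f) \<bullet> g = zer M W (Y \<ast> K)"
      then have g [simp]: "src M g = W" "trg M g = Y \<ast> N" by (simp_all add: M.hom_iff)
      have "f \<bullet> flat g N = zer M (D \<ast> W) K"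
      proof -
        have "f \<bullet> flat g N = flat (zer M W (Y \<ast> K)) K"
          using f_cmp[of g f] unfolding 0[symmetric] by simp
        then show ?thesis by (simp add: flat_def)
      qed
      then have ex: "\<exists>!u. (src M u = D \<ast> W \<and> trg M u = L) \<and> k \<bullet> u = flat g N"
        by (intro un) simp_all
      then obtain u where u [simp]: "src M u = D \<ast> W" "trg M u = L" "k \<bullet> u = flat g N"
        by blast
      have uu: "v = u" if "src M v = D \<ast> W" "trg M v = L" "k \<bullet> v = flat g N" for v
        using ex that u by blast
      show "\<exists>!v. v \<in> hom M W (Y \<ast> L) \<and> (idn C Y \<odot> k) \<bullet> v = g"
      proof (intro ex1I[of _ "sharp u W"] conjI)
        show "(idn C Y \<odot> k) \<bullet> sharp u W = g"
          using s_post[of u W k] sf[of g N] by simp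
        fix v assume v: "v \<in> hom M W (Y \<ast> L) \<and> (idn C Y \<odot> k) \<bullet> v = g"
        then have "flat v L = u"
          using f_cmp[of v k] by (intro uu) (auto simp: M.hom_iff)
        then show "v = sharp u W" using sf[of v L] v by (auto simp: M.hom_iff)
      qed (simp add: M.hom_iff)
    qed (simp_all add: M.hom_iff flip: act_cmp)
  }
qed

end

section \<open>The central structure\<close>

context typed_monoidal_category
begin

lemma center_hom_iff: "f \<in> hom (center C) P Q \<longleftrightarrow> src C f = fst P \<and> trg C f = fst Q \<and>
    (\<forall>X. (idn C X \<boxtimes> f) \<cdot> snd P X = snd Q X \<cdot> (f \<boxtimes> idn C X))"
  by (cases P; cases Q) (auto simp: center_def hom_iff)

lemma half_braiding_types:
  assumes "half_braiding C A \<sigma>"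
  shows "src C (\<sigma> X) = A \<otimes> X" "trg C (\<sigma> X) = X \<otimes> A"
  using assms by (auto simp: half_braiding_iff dest: src_iso trg_iso)

lemma center_cmp:
  assumes f: "f \<in> hom (center C) P Q" and g: "g \<in> hom (center C) Q S"
    and P: "\<And>X. trg C (snd P X) = X \<otimes> fst P" "\<And>X. src C (snd P X) = fst P \<otimes> X"
    and Q: "\<And>X. src C (snd Q X) = fst Q \<otimes> X" "\<And>X. trg C (snd Q X) = X \<otimes> fst Q"
    and S: "\<And>X. src C (snd S X) = fst S \<otimes> X"
  shows "g \<cdot> f \<in> hom (center C) P S"
proof -
  note [simp] = P Q S
  have t [simp]: "src C f = fst P" "trg C f = fst Q" "src C g = fst Q" "trg C g = fst S"
    using f g by (auto simp: center_hom_iff)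
  have "(idn C X \<boxtimes> (g \<cdot> f)) \<cdot> snd P X = snd S X \<cdot> ((g \<cdot> f) \<boxtimes> idn C X)" for X
  proof -
    have "(idn C X \<boxtimes> (g \<cdot> f)) \<cdot> snd P X = (idn C X \<boxtimes> g) \<cdot> (idn C X \<boxtimes> f) \<cdot> snd P X"
      by (simp add: tar_cmp_typed_assoc)
    also have "\<dots> = ((idn C X \<boxtimes> g) \<cdot> snd Q X) \<cdot> (f \<boxtimes> idn C X)"
      using f by (simp add: center_hom_iff)
    also have "\<dots> = snd S X \<cdot> (g \<boxtimes> idn C X) \<cdot> (f \<boxtimes> idn C X)"
      using g by (simp add: center_hom_iff)
    finally show ?thesis by (simp add: tar_cmp_typed)
  qed
  then show ?thesis by (simp add: center_hom_iff)
qed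

text \<open>Inverses in the centre are inverses in \<open>C\<close>, and these are unique. Hence
  \<open>arr_inv C\<close>, by which the definitions invert \<open>fmul G\<close> and
  \<open>funt G\<close>, returns central morphisms.\<close>

lemma center_is_iso: "is_iso (center C) P Q f \<Longrightarrow>
    is_iso C (fst P) (fst Q) f \<and> f \<in> hom (center C) P Q \<and> arr_inv C (fst P) (fst Q) f \<in> hom (center C) Q P"
proof -
  assume "is_iso (center C) P Q f"
  then obtain g where g: "inverses (center C) P Q f g" by (auto simp: is_iso_def)
  then have "inverses C (fst P) (fst Q) f g"
    by (cases P; cases Q) (auto simp: inverses_def center_def)
  then show ?thesis
    using g arr_inv_eq[of "fst P" "fst Q" f g] by (auto simp: is_iso_def inverses_def)
qed

end

locale central_setting = typed_internal_hom V dl ev C G M I R + tensor_category C +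
    G: braided_functor V "center C" G + V: braided_tensor_category V
  for V :: "('k::field, 'v, 'w) brcat"
    and dl :: "'v \<Rightarrow> 'v"
    and ev :: "'v \<Rightarrow> 'w"
    and C :: "('k, 'c, 'e) moncat" (structure)
    and G :: "('v, 'w, 'c \<times> ('c \<Rightarrow> 'e), 'e) monfctr"
    and M :: "('k, 'c, 'e, 'o, 'a) modcat"
    and I :: "('c, 'e, 'o, 'a) ihom"
    and R :: "('o, 'a, 'o, 'a) fctr \<times> ('v \<Rightarrow> 'o \<Rightarrow> 'a) \<Rightarrow> 'c \<times> ('o \<Rightarrow> 'e)" +
  assumes typed_V: "on_types V"
    and duals: "\<And>X. \<exists>coev. left_dual V X (dl X) (ev X) coev"
    and ends: relative_ends
begin

sublocale V: typed_monoidal_category V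
  by unfold_locales (rule typed_V)

section \<open>Half-braidings and monoidal constraints of \<open>G\<close>, read in
  \<open>C\<close>\<close>

lemma half_braiding_G: "half_braiding C (Gob X) (Gbr X)"
  using G.fob_obj[of X] by (auto simp: center_def)

lemma src_Gbr [simp]: "src C (Gbr X Y) = Gob X \<otimes> Y" and trg_Gbr [simp]: "trg C (Gbr X Y) = Y \<otimes> Gob X"
  using half_braiding_types[OF half_braiding_G] by simp_all

lemma Gbr_iso: "is_iso C (Gob X \<otimes> Y) (Y \<otimes> Gob X) (Gbr X Y)"
  using half_braiding_G by (simp add: half_braiding_iff)

definition Gbri :: "'v \<Rightarrow> 'c \<Rightarrow> 'e" where
  "Gbri X Y = arr_inv C (Gob X \<otimes> Y) (Y \<otimes> Gob X) (Gbr X Y)"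

lemma src_Gbri [simp]: "src C (Gbri X Y) = Y \<otimes> Gob X" and trg_Gbri [simp]: "trg C (Gbri X Y) = Gob X \<otimes> Y"
  and Gbri_Gbr [simp]: "Gbri X Y \<cdot> Gbr X Y = idn C (Gob X \<otimes> Y)"
  and Gbr_Gbri [simp]: "Gbr X Y \<cdot> Gbri X Y = idn C (Y \<otimes> Gob X)"
  using Gbr_iso by (simp_all add: Gbri_def)

lemma Gbri_Gbr_assoc [simp]: "trg C h = Gob X \<otimes> Y \<Longrightarrow> Gbri X Y \<cdot> Gbr X Y \<cdot> h = h"
  and Gbr_Gbri_assoc [simp]: "trg C h = Y \<otimes> Gob X \<Longrightarrow> Gbr X Y \<cdot> Gbri X Y \<cdot> h = h"
  using Gbr_iso by (simp_all add: Gbri_def)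

lemma far_G: "far G f \<in> hom (center C) (fob G (src V f)) (fob G (trg V f))"
  by (rule G.far_in) (simp_all add: V.hom_iff)

lemma src_far_G [simp]: "src C (far G f) = Gob (src V f)" and trg_far_G [simp]: "trg C (far G f) = Gob (trg V f)"
  using far_G[of f] by (simp_all add: center_hom_iff)

lemma far_G_idn [simp]: "far G (idn V X) = idn C (Gob X)"
  using G.far_idn[of X] by (simp add: center_def split: prod.splits)

lemma far_G_cmp: "trg V f = src V g \<Longrightarrow> far G (g \<cdot>\<^bsub>V\<^esub> f) = far G g \<cdot> far G f"
  using G.far_cmp[of "src V f" "src V g" "trg V g" f g] by (auto simp: V.hom_iff center_def)

lemma fmul_center_iso:
  "is_iso (center C) (fob G X \<otimes>\<^bsub>center C\<^esub> fob G Y) (fob G (X \<otimes>\<^bsub>V\<^esub> Y)) (fmul G X Y)"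
  by (simp add: G.fmul_iso)

lemma fst_center_tob [simp]: "fst (P \<otimes>\<^bsub>center C\<^esub> Q) = fst P \<otimes> fst Q"
  and snd_center_tob [simp]: "snd (P \<otimes>\<^bsub>center C\<^esub> Q) = (\<lambda>X. (snd P X \<boxtimes> idn C (fst Q)) \<cdot> (idn C (fst P) \<boxtimes> snd Q X))"
  and center_unt [simp]: "unt (center C) = (unt C, \<lambda>X. idn C X)"
  and center_cmp_eq [simp]: "cmp (center C) = cmp C"
  and center_tar_eq [simp]: "tar (center C) = tar C"
  and center_idn_eq [simp]: "idn (center C) P = idn C (fst P)"
  by (simp_all add: center_def split: prod.splits)

lemma fmul_iso: "is_iso C (Gob X \<otimes> Gob Y) (Gob (X \<otimes>\<^bsub>V\<^esub> Y)) (fmul G X Y)"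
  using center_is_iso[OF fmul_center_iso] by simp

lemma src_fmul [simp]: "src C (fmul G X Y) = Gob X \<otimes> Gob Y"
  and trg_fmul [simp]: "trg C (fmul G X Y) = Gob (X \<otimes>\<^bsub>V\<^esub> Y)"
  using src_iso[OF fmul_iso] trg_iso[OF fmul_iso] by simp_all

lemma funt_iso: "is_iso C (unt C) (Gob (unt V)) (funt G)"
  using center_is_iso[OF G.funt_iso] by simp

lemma src_funt [simp]: "src C (funt G) = unt C" and trg_funt [simp]: "trg C (funt G) = Gob (unt V)"
  using src_iso[OF funt_iso] trg_iso[OF funt_iso] by simp_all

abbreviation fmuli :: "'v \<Rightarrow> 'v \<Rightarrow> 'e" where
  "fmuli X Y \<equiv> arr_inv C (Gob X \<otimes> Gob Y) (Gob (X \<otimes>\<^bsub>V\<^esub> Y)) (fmul G X Y)"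

abbreviation funti :: 'e where
  "funti \<equiv> arr_inv C (unt C) (Gob (unt V)) (funt G)"

lemmas inv_simps [simp] =
  src_arr_inv[OF fmul_iso] trg_arr_inv[OF fmul_iso] arr_inv_cmp[OF fmul_iso] cmp_arr_inv[OF fmul_iso]
  arr_inv_cmp_assoc[OF fmul_iso] cmp_arr_inv_assoc[OF fmul_iso]
  src_arr_inv[OF funt_iso] trg_arr_inv[OF funt_iso] arr_inv_cmp[OF funt_iso] cmp_arr_inv[OF funt_iso]
  arr_inv_cmp_assoc[OF funt_iso] cmp_arr_inv_assoc[OF funt_iso]

lemma src_ev [simp]: "src V (ev X) = dl X \<otimes>\<^bsub>V\<^esub> X" and trg_ev [simp]: "trg V (ev X) = unt V"
  using duals[of X] by (auto simp: left_dual_def V.hom_iff)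

lemma src_evG [simp]: "src C (evG X) = Gob (dl X) \<otimes> Gob X" and trg_evG [simp]: "trg C (evG X) = unt C"
  by (simp_all add: evG_def)

text \<open>All three factors of \<open>evG X\<close> are morphisms of the centre, so
  \<open>evG X\<close> slides through the half-braidings of \<open>Gob (dl X)\<close> and
  \<open>Gob X\<close>; these are then inverted to obtain a rewriting form.\<close>

lemma evG_central: "idn C Y \<boxtimes> evG X = (evG X \<boxtimes> idn C Y) \<cdot> (idn C (Gob (dl X)) \<boxtimes> Gbri X Y) \<cdot> (Gbri (dl X) Y \<boxtimes> idn C (Gob X))"
proof -
  have 1: "far G (ev X) \<in> hom (center C) (fob G (dl X \<otimes>\<^bsub>V\<^esub> X)) (fob G (unt V))"
    using far_G[of "ev X"] by simp
  have "far G (ev X) \<cdot> fmul G (dl X) X \<in> hom (center C) (fob G (dl X) \<otimes>\<^bsub>center C\<^esub> fob G X) (fob G (unt V))"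
    by (rule center_cmp[OF _ 1]) (use center_is_iso[OF fmul_center_iso[of "dl X" X]] in simp_all)
  then have "evG X \<in> hom (center C) (fob G (dl X) \<otimes>\<^bsub>center C\<^esub> fob G X) (unt (center C))"
    unfolding evG_def by (rule center_cmp) (use center_is_iso[OF G.funt_iso] in simp_all)
  then have "(idn C Y \<boxtimes> evG X) \<cdot> (Gbr (dl X) Y \<boxtimes> idn C (Gob X)) \<cdot> (idn C (Gob (dl X)) \<boxtimes> Gbr X Y) = evG X \<boxtimes> idn C Y"
    by (simp add: center_hom_iff)
  then have "((idn C Y \<boxtimes> evG X) \<cdot> (Gbr (dl X) Y \<boxtimes> idn C (Gob X)) \<cdot> (idn C (Gob (dl X)) \<boxtimes> Gbr X Y)) \<cdot>
      (idn C (Gob (dl X)) \<boxtimes> Gbri X Y) \<cdot> (Gbri (dl X) Y \<boxtimes> idn C (Gob X)) =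
      (evG X \<boxtimes> idn C Y) \<cdot> (idn C (Gob (dl X)) \<boxtimes> Gbri X Y) \<cdot> (Gbri (dl X) Y \<boxtimes> idn C (Gob X))"
    by simp
  then show ?thesis
    by (simp add: tar_cmp_typed_assoc) (simp add: tar_cmp_typed)
qed

lemma fmul_Gbri:
  "(fmul G X Y \<boxtimes> idn C Z) \<cdot> (idn C (Gob X) \<boxtimes> Gbri Y Z) \<cdot> (Gbri X Z \<boxtimes> idn C (Gob Y)) =
   Gbri (X \<otimes>\<^bsub>V\<^esub> Y) Z \<cdot> (idn C Z \<boxtimes> fmul G X Y)"
proof -
  let ?b = "(Gbr X Z \<boxtimes> idn C (Gob Y)) \<cdot> (idn C (Gob X) \<boxtimes> Gbr Y Z)"
  let ?i = "(idn C (Gob X) \<boxtimes> Gbri Y Z) \<cdot> (Gbri X Z \<boxtimes> idn C (Gob Y))"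
  have "fmul G X Y \<in> hom (center C) (fob G X \<otimes>\<^bsub>center C\<^esub> fob G Y) (fob G (X \<otimes>\<^bsub>V\<^esub> Y))"
    using center_is_iso[OF fmul_center_iso] by blast
  then have "(idn C Z \<boxtimes> fmul G X Y) \<cdot> ?b = Gbr (X \<otimes>\<^bsub>V\<^esub> Y) Z \<cdot> (fmul G X Y \<boxtimes> idn C Z)"
    by (simp add: center_hom_iff)
  then have "Gbri (X \<otimes>\<^bsub>V\<^esub> Y) Z \<cdot> ((idn C Z \<boxtimes> fmul G X Y) \<cdot> ?b) \<cdot> ?i =
      Gbri (X \<otimes>\<^bsub>V\<^esub> Y) Z \<cdot> (Gbr (X \<otimes>\<^bsub>V\<^esub> Y) Z \<cdot> (fmul G X Y \<boxtimes> idn C Z)) \<cdot> ?i"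
    by simp
  moreover have "?b \<cdot> ?i = idn C (Z \<otimes> Gob X \<otimes> Gob Y)"
    by (simp add: tar_cmp_typed_assoc) (simp add: tar_cmp_typed)
  ultimately show ?thesis by simp
qed

lemma funt_Gbri: "Gbri (unt V) Z \<cdot> (idn C Z \<boxtimes> funt G) = funt G \<boxtimes> idn C Z"
proof -
  have "idn C Z \<boxtimes> funt G = Gbr (unt V) Z \<cdot> (funt G \<boxtimes> idn C Z)"
    using center_is_iso[OF G.funt_iso] by (simp add: center_hom_iff)
  then show ?thesis by simp
qed

lemma far_G_Gbri: "Gbri (trg V f) Z \<cdot> (idn C Z \<boxtimes> far G f) = (far G f \<boxtimes> idn C Z) \<cdot> Gbri (src V f) Z"
proof -
  have *: "(idn C Z \<boxtimes> far G f) \<cdot> Gbr (src V f) Z = Gbr (trg V f) Z \<cdot> (far G f \<boxtimes> idn C Z)"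
    using far_G[of f] by (simp add: center_hom_iff)
  have "Gbri (trg V f) Z \<cdot> ((idn C Z \<boxtimes> far G f) \<cdot> Gbr (src V f) Z) \<cdot> Gbri (src V f) Z =
      (far G f \<boxtimes> idn C Z) \<cdot> Gbri (src V f) Z"
    unfolding * by simp
  then show ?thesis by simp
qed

text \<open>A monoidal functor preserves duals: the coevaluation of \<open>V\<close> is carried over
  with \<open>funt G\<close> and the inverse of \<open>fmul G\<close>.\<close>

lemma zigzag_G: "\<exists>co. src C co = unt C \<and> trg C co = Gob X \<otimes> Gob (dl X) \<and>
    (idn C (Gob X) \<boxtimes> evG X) \<cdot> (co \<boxtimes> idn C (Gob X)) = idn C (Gob X)"
proof -
  obtain co where "left_dual V X (dl X) (ev X) co" using duals by blast
  then have co: "src V co = unt V" "trg V co = X \<otimes>\<^bsub>V\<^esub> dl X"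
    "(idn V X \<boxtimes>\<^bsub>V\<^esub> ev X) \<cdot>\<^bsub>V\<^esub> (co \<boxtimes>\<^bsub>V\<^esub> idn V X) = idn V X"
    by (auto simp: left_dual_def V.hom_iff)
  let ?g = "idn C (Gob X)" and ?c = "fmuli X (dl X) \<cdot> far G co \<cdot> funt G"
  \<comment> \<open>The unit axiom of \<open>G\<close> identifies the inverse of
    \<open>funt G\<close>, tensored with \<open>Gob X\<close>, with a component of
    \<open>fmul G\<close>. This removes the inverse hidden in \<open>evG\<close>.\<close>
  have u: "?g \<boxtimes> funti = fmul G X (unt V)"
  proof (rule cmp_right_cancel_iso[OF is_iso_tar[OF is_iso_idn funt_iso]])
    show "(?g \<boxtimes> funti) \<cdot> (?g \<boxtimes> funt G) = fmul G X (unt V) \<cdot> (?g \<boxtimes> funt G)"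
      using G.fmul_unit(2)[of X] by (simp add: tar_cmp_typed)
  qed (simp_all)
  have nat: "fmul G (trg V p) (trg V q) \<cdot> (far G p \<boxtimes> far G q) = far G (p \<boxtimes>\<^bsub>V\<^esub> q) \<cdot> fmul G (src V p) (src V q)" for p q
    using G.fmul_natural[of "src V p" "trg V p" "src V q" "trg V q" p q] by (simp add: V.hom_iff)
  have 1: "?g \<boxtimes> evG X = far G (idn V X \<boxtimes>\<^bsub>V\<^esub> ev X) \<cdot> fmul G (X \<otimes>\<^bsub>V\<^esub> dl X) X \<cdot> (fmul G X (dl X) \<boxtimes> ?g)"
  proof -
    have "?g \<boxtimes> evG X = (?g \<boxtimes> funti) \<cdot> (?g \<boxtimes> far G (ev X)) \<cdot> (?g \<boxtimes> fmul G (dl X) X)"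
      by (simp add: evG_def tar_cmp_typed)
    also have "\<dots> = (fmul G X (unt V) \<cdot> (?g \<boxtimes> far G (ev X))) \<cdot> (?g \<boxtimes> fmul G (dl X) X)"
      unfolding u by simp
    also have "\<dots> = far G (idn V X \<boxtimes>\<^bsub>V\<^esub> ev X) \<cdot> (fmul G X (dl X \<otimes>\<^bsub>V\<^esub> X) \<cdot> (?g \<boxtimes> fmul G (dl X) X))"
      using nat[of "idn V X" "ev X"] by simp
    also have "fmul G X (dl X \<otimes>\<^bsub>V\<^esub> X) \<cdot> (?g \<boxtimes> fmul G (dl X) X) =
        fmul G (X \<otimes>\<^bsub>V\<^esub> dl X) X \<cdot> (fmul G X (dl X) \<boxtimes> ?g)"
      using G.fmul_assoc[of X "dl X" X] by simp
    finally show ?thesis .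
  qed
  have "(?g \<boxtimes> evG X) \<cdot> (?c \<boxtimes> ?g) = far G (idn V X \<boxtimes>\<^bsub>V\<^esub> ev X) \<cdot> fmul G (X \<otimes>\<^bsub>V\<^esub> dl X) X \<cdot>
      ((far G co \<boxtimes> ?g) \<cdot> (funt G \<boxtimes> ?g))"
    unfolding 1 by (simp add: tar_cmp_typed co)
  also have "\<dots> = far G (idn V X \<boxtimes>\<^bsub>V\<^esub> ev X) \<cdot> (fmul G (X \<otimes>\<^bsub>V\<^esub> dl X) X \<cdot> (far G co \<boxtimes> ?g)) \<cdot> (funt G \<boxtimes> ?g)"
    by (simp add: co)
  also have "fmul G (X \<otimes>\<^bsub>V\<^esub> dl X) X \<cdot> (far G co \<boxtimes> ?g) = far G (co \<boxtimes>\<^bsub>V\<^esub> idn V X) \<cdot> fmul G (unt V) X"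
    using nat[of co "idn V X"] by (simp add: co)
  also have "far G (idn V X \<boxtimes>\<^bsub>V\<^esub> ev X) \<cdot> (far G (co \<boxtimes>\<^bsub>V\<^esub> idn V X) \<cdot> fmul G (unt V) X) \<cdot> (funt G \<boxtimes> ?g) =
      (far G (idn V X \<boxtimes>\<^bsub>V\<^esub> ev X) \<cdot> far G (co \<boxtimes>\<^bsub>V\<^esub> idn V X)) \<cdot> fmul G (unt V) X \<cdot> (funt G \<boxtimes> ?g)"
    by (simp add: co)
  also have "\<dots> = ?g"
    using co G.fmul_unit(1)[of X] by (simp flip: far_G_cmp)
  finally show ?thesis
    by (intro exI[of _ ?c]) (simp add: co)
qed

section \<open>Interchanging the action of \<open>Gob X\<close> with that of an object of
  \<open>C\<close>\<close>

lemma swap_eq: "swap X Y N = asc M (Gob X) Y N \<bullet> (Gbri X Y \<odot> idn M N) \<bullet> asci Y (Gob X) N"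
  by (simp add: swap_def asci_def Gbri_def)

lemma src_swap [simp]: "src M (swap X Y N) = Y \<ast> Gob X \<ast> N"
  and trg_swap [simp]: "trg M (swap X Y N) = Gob X \<ast> Y \<ast> N"
  by (simp_all add: swap_eq)

lemma swap_iso: "is_iso M (Y \<ast> Gob X \<ast> N) (Gob X \<ast> Y \<ast> N) (swap X Y N)"
  by (rule M.is_isoI[of _ _ _ "asc M Y (Gob X) N \<bullet> (Gbr X Y \<odot> idn M N) \<bullet> asci (Gob X) Y N"])
    (simp_all add: swap_eq aar_cmp_typed_assoc)

lemma Gbri_natural: "Gbri X (trg C f) \<cdot> (f \<boxtimes> idn C (Gob X)) = (idn C (Gob X) \<boxtimes> f) \<cdot> Gbri X (src C f)"
proof -
  have *: "Gbr X (trg C f) \<cdot> (idn C (Gob X) \<boxtimes> f) = (f \<boxtimes> idn C (Gob X)) \<cdot> Gbr X (src C f)"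
    using half_braiding_G[of X] by (simp add: half_braiding_iff)
  have "Gbri X (trg C f) \<cdot> ((f \<boxtimes> idn C (Gob X)) \<cdot> Gbr X (src C f)) \<cdot> Gbri X (src C f) =
      (idn C (Gob X) \<boxtimes> f) \<cdot> Gbri X (src C f)"
    unfolding *[symmetric] by simp
  then show ?thesis by simp
qed

lemma swap_natural: "swap X Y (trg M f) \<bullet> (idn C Y \<odot> idn C (Gob X) \<odot> f) =
    (idn C (Gob X) \<odot> idn C Y \<odot> f) \<bullet> swap X Y (src M f)"
proof -
  have "swap X Y (trg M f) \<bullet> (idn C Y \<odot> idn C (Gob X) \<odot> f) =
      asc M (Gob X) Y (trg M f) \<bullet> ((Gbri X Y \<odot> idn M (trg M f)) \<bullet> (idn C (Y \<otimes> Gob X) \<odot> f)) \<bullet> asci Y (Gob X) (src M f)"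
    by (simp add: swap_eq asci_nat_id)
  also have "\<dots> = (asc M (Gob X) Y (trg M f) \<bullet> (idn C (Gob X \<otimes> Y) \<odot> f)) \<bullet> (Gbri X Y \<odot> idn M (src M f)) \<bullet> asci Y (Gob X) (src M f)"
    using exchange[of "Gbri X Y" f] by simp
  finally show ?thesis unfolding asc_nat_id by (simp add: swap_eq)
qed

lemma swap_natural_left: "swap X (trg C f) N \<bullet> (f \<odot> idn M (Gob X \<ast> N)) =
    (idn C (Gob X) \<odot> f \<odot> idn M N) \<bullet> swap X (src C f) N"
proof -
  have *: "(Gbri X (trg C f) \<odot> idn M N) \<bullet> ((f \<boxtimes> idn C (Gob X)) \<odot> idn M N) \<bullet> h =
      ((idn C (Gob X) \<boxtimes> f) \<odot> idn M N) \<bullet> (Gbri X (src C f) \<odot> idn M N) \<bullet> h"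
    if "trg M h = (src C f \<otimes> Gob X) \<ast> N" for h
    using that by (simp add: aar_cmp_typed_assoc Gbri_natural)
  show ?thesis by (simp add: swap_eq act_act act_tob *)
qed

abbreviation evact :: "'v \<Rightarrow> 'o \<Rightarrow> 'a" where
  "evact X N \<equiv> evalact (Gob X) (Gob (dl X)) (evG X) N"

text \<open>The naturality of the half-braidings \<open>Gbr\<close> along the evaluation.\<close>

lemma evact_swap:
  "evact X (Y \<ast> N) \<bullet> (idn C (Gob (dl X)) \<odot> swap X Y N) \<bullet> swap (dl X) Y (Gob X \<ast> N) =
   idn C Y \<odot> evact X N"
  by (simp add: evalact_def swap_eq strictify evG_central)

lemma evact_inject:
  assumes "src M f = src M g" "trg M f = Gob X \<ast> Q" "trg M g = Gob X \<ast> Q"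
    and "evact X Q \<bullet> (idn C (Gob (dl X)) \<odot> f) = evact X Q \<bullet> (idn C (Gob (dl X)) \<odot> g)"
  shows "f = g"
  using zigzag_G[of X] assms evalact_inject[OF src_evG trg_evG] by blast

subsection \<open>The restricted module category\<close>

lemma restrict_simps [simp]:
  "obj MV = obj M" "hom MV = hom M" "idn MV = idn M" "cmp MV = cmp M" "zer MV = zer M" "pls MV = pls M" "scl MV = scl M"
  "X \<rhd>\<^bsub>MV\<^esub> N = Gob X \<ast> N" "u \<unrhd>\<^bsub>MV\<^esub> f = far G u \<odot> f"
  "asc MV X Y N = asc M (Gob X) (Gob Y) N \<bullet> (fmuli X Y \<odot> idn M N)"
  "lun MV N = lun M N \<bullet> (funti \<odot> idn M N)"
  by (simp_all add: restrict_module_def)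

lemma restrict_is_iso [simp]: "is_iso MV = is_iso M" and restrict_arr_inv [simp]: "arr_inv MV = arr_inv M"
  by (simp_all add: fun_eq_iff is_iso_def arr_inv_def inverses_def)

text \<open>Restriction along \<open>G\<close> puts the inverses of \<open>fmul G\<close> and
  \<open>funt G\<close> into the associators and unitors of \<open>MV\<close>. Inverting the
  associator brings back \<open>fmul G\<close>, and with \<open>far G (ev X)\<close> the pieces
  assemble to \<open>evG X\<close>.\<close>

lemma ev_act_MV: "ev_act V MV (dl X) X (ev X) N = evact X N"
proof -
  have "arr_inv M (Gob (dl X \<otimes>\<^bsub>V\<^esub> X) \<ast> N) (Gob (dl X) \<ast> Gob X \<ast> N)
      (asc M (Gob (dl X)) (Gob X) N \<bullet> (fmuli (dl X) X \<odot> idn M N)) =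
      (fmul G (dl X) X \<odot> idn M N) \<bullet> asci (Gob (dl X)) (Gob X) N"
    by (rule M.arr_inv_eq) (simp add: M.inverses_iff aar_cmp_typed aar_cmp_typed_assoc)
  then show ?thesis
    by (simp add: ev_act_def evalact_def evG_def aar_cmp_typed aar_cmp_typed_assoc)
qed

lemma EndV_D:
  assumes "(F, d) \<in> EndV"
  shows "src M (far F f) = fob F (src M f)" "trg M (far F f) = fob F (trg M f)"
    and "src M (d X N) = fob F (Gob X \<ast> N)" "trg M (d X N) = Gob X \<ast> fob F N"
proof -
  interpret F: module_functor V MV MV F d using assms by (simp add: EndV_def)
  show "src M (far F f) = fob F (src M f)" "trg M (far F f) = fob F (trg M f)"
    using F.far_in[of "src M f" "trg M f" f] by (simp_all add: M.hom_iff)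
  show "src M (d X N) = fob F (Gob X \<ast> N)" "trg M (d X N) = Gob X \<ast> fob F N"
    using M.src_iso M.trg_iso F.str_iso[of X N] by simp_all
qed

lemma gam_eq: "gam (F, d) X Y N K f = evact X (fob F K) \<bullet> (idn C (Gob (dl X)) \<odot> (d X K \<bullet> f)) \<bullet> swap (dl X) Y N"
  if "src M (d X K) = fob F (Gob X \<ast> K)" "trg M (d X K) = Gob X \<ast> fob F K" "trg M f = fob F (Gob X \<ast> K)"
    "src M f = Y \<ast> N"
  using that by (simp add: gam_def evalact_def flip: asci_def)

lemma
  assumes Fd: "(F, d) \<in> EndV"
  shows src_bet: "src C (bet (F, d) X N K) = ih I N (fob F (Gob X \<ast> K))"
    and trg_bet: "trg C (bet (F, d) X N K) = ih I (Gob (dl X) \<ast> N) (fob F K)"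
  by (simp_all add: bet_def Let_def gam_eq EndV_D[OF Fd])

text \<open>\<open>bet\<close> is prescribed by its value on the universal arrow \<open>iev\<close>;
  naturality of \<open>swap\<close> in the acting object extends the formula to every
  \<open>g\<close>.\<close>

lemma phi_bet:
  assumes Fd: "(F, d) \<in> EndV" and g: "trg C g = ih I N (fob F (Gob X \<ast> K))" "src C g = Y"
  shows "phi I Y (Gob (dl X) \<ast> N) (fob F K) (bet (F, d) X N K \<cdot> g) =
    gam (F, d) X Y N K (phi I Y N (fob F (Gob X \<ast> K)) g)"
proof -
  note [simp] = EndV_D[OF Fd] g and t = src_bet[OF Fd] trg_bet[OF Fd]
  let ?L = "fob F (Gob X \<ast> K)" and ?D = "Gob (dl X)"
  have "phi I Y (?D \<ast> N) (fob F K) (bet (F, d) X N K \<cdot> g) =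
      evact X (fob F K) \<bullet> (idn C ?D \<odot> (d X K \<bullet> iev N ?L)) \<bullet> swap (dl X) (ih I N ?L) N \<bullet>
        (g \<odot> idn M (?D \<ast> N))"
    by (simp add: t) (simp add: bet_def Let_def gam_eq)
  also have "\<dots> = evact X (fob F K) \<bullet> ((idn C ?D \<odot> (d X K \<bullet> iev N ?L)) \<bullet> (idn C ?D \<odot> g \<odot> idn M N)) \<bullet>
      swap (dl X) Y N"
    using swap_natural_left[of "dl X" g N] by simp
  also have "\<dots> = gam (F, d) X Y N K (phi I Y N ?L g)"
    by (simp add: gam_eq phi_eq_iev[OF g] flip: act_cmp)
  finally show "phi I Y (?D \<ast> N) (fob F K) (bet (F, d) X N K \<cdot> g) = gam (F, d) X Y N K (phi I Y N ?L g)" .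
qed

text \<open>The \<open>V\<close>-module natural transformations from \<open>rho Y\<close> to \<open>(F, d)\<close>.\<close>

definition natto :: "('o, 'a, 'o, 'a) fctr \<times> ('v \<Rightarrow> 'o \<Rightarrow> 'a) \<Rightarrow> 'c \<Rightarrow> ('o \<Rightarrow> 'a) \<Rightarrow> bool" where
  "natto = (\<lambda>(F, d) Y \<alpha>. (\<forall>N. src M (\<alpha> N) = Y \<ast> N \<and> trg M (\<alpha> N) = fob F N) \<and>
     (\<forall>f. \<alpha> (trg M f) \<bullet> (idn C Y \<odot> f) = far F f \<bullet> \<alpha> (src M f)) \<and>
     (\<forall>X N. d X N \<bullet> \<alpha> (Gob X \<ast> N) = (idn C (Gob X) \<odot> \<alpha> N) \<bullet> swap X Y N))"

text \<open>The two conditions are transposes of each other under the duality of \<open>X\<close> and \<open>dl X\<close>.\<close>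

lemma balanced_iff:
  assumes Fd: "(F, d) \<in> EndV" and \<alpha>: "\<And>N. src M (\<alpha> N) = Y \<ast> N" "\<And>N. trg M (\<alpha> N) = fob F N"
  shows "\<alpha> N \<bullet> (idn C Y \<odot> evact X N) = gam (F, d) X Y (Gob X \<ast> N) N (\<alpha> (Gob X \<ast> N)) \<longleftrightarrow>
    d X N \<bullet> \<alpha> (Gob X \<ast> N) = (idn C (Gob X) \<odot> \<alpha> N) \<bullet> swap X Y N" (is "?W \<longleftrightarrow> ?l = ?r")
proof -
  note [simp] = EndV_D[OF Fd] \<alpha>
  let ?g = "Gob X" and ?D = "Gob (dl X)"
  \<comment> \<open>By \<open>evact_swap\<close> the left side is rewritten so that both sides share
    the outer evaluation and the inner \<open>swap\<close>.\<close>
  have "\<alpha> N \<bullet> (idn C Y \<odot> evact X N) = (\<alpha> N \<bullet> evact X (Y \<ast> N)) \<bullet> (idn C ?D \<odot> swap X Y N) \<bullet> swap (dl X) Y (?g \<ast> N)"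
    by (simp add: evact_swap)
  also have "\<alpha> N \<bullet> evact X (Y \<ast> N) = evact X (fob F N) \<bullet> (idn C ?D \<odot> idn C ?g \<odot> \<alpha> N)"
    using evalact_natural[OF src_evG trg_evG, of X "\<alpha> N"] by simp
  finally have 1: "\<alpha> N \<bullet> (idn C Y \<odot> evact X N) =
      (evact X (fob F N) \<bullet> (idn C ?D \<odot> ?r)) \<bullet> swap (dl X) Y (?g \<ast> N)"
    by (simp add: act_cmp)
  have 2: "gam (F, d) X Y (?g \<ast> N) N (\<alpha> (?g \<ast> N)) =
      (evact X (fob F N) \<bullet> (idn C ?D \<odot> ?l)) \<bullet> swap (dl X) Y (?g \<ast> N)"
    by (simp add: gam_eq)
  show ?thesis
  proof
    assume ?W
    then have "(evact X (fob F N) \<bullet> (idn C ?D \<odot> ?l)) \<bullet> swap (dl X) Y (?g \<ast> N) =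
        (evact X (fob F N) \<bullet> (idn C ?D \<odot> ?r)) \<bullet> swap (dl X) Y (?g \<ast> N)"
      by (simp only: 1 2)
    \<comment> \<open>Invertibility of \<open>swap\<close> cancels it on the right; what remains is
      an equality of transposes under duality.\<close>
    then have "evact X (fob F N) \<bullet> (idn C ?D \<odot> ?l) = evact X (fob F N) \<bullet> (idn C ?D \<odot> ?r)"
      by (rule M.cmp_right_cancel_iso[OF swap_iso, rotated -1]) simp_all
    then show "?l = ?r" by (rule evact_inject[rotated -1]) simp_all
  qed (simp only: 1 2)
qed

text \<open>As \<open>phi\<close> is injective, each wedge equation may be tested after
  transposition: dinaturality becomes naturality, and the balancing condition becomes compatibility
  with \<open>d\<close> by \<open>balanced_iff\<close>.\<close>

lemma relative_wedge_iff:
  assumes Fd: "(F, d) \<in> EndV" and \<pi>: "\<And>N. src C (\<pi> N) = E" "\<And>N. trg C (\<pi> N) = ih I N (fob F N)"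
  shows "relative_wedge V dl ev MV C (hom_bifctr F) (bet (F, d)) (E, \<pi>) \<longleftrightarrow>
    natto (F, d) E (\<lambda>N. phi I E N (fob F N) (\<pi> N))"
proof -
  note [simp] = EndV_D[OF Fd] \<pi> src_bet[OF Fd] trg_bet[OF Fd]
  have dinat: "ipost N (fob F N) (fob F K) (far F f) \<cdot> \<pi> N = ipre N K (fob F K) f \<cdot> \<pi> K \<longleftrightarrow>
      phi I E K (fob F K) (\<pi> K) \<bullet> (idn C E \<odot> f) = far F f \<bullet> phi I E N (fob F N) (\<pi> N)"
    if "src M f = N" "trg M f = K" for N K f
  proof -
    have 1: "phi I E N (fob F K) (ipost N (fob F N) (fob F K) (far F f) \<cdot> \<pi> N) = far F f \<bullet> phi I E N (fob F N) (\<pi> N)"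
      using that by (subst phi_ipost) simp_all
    have 2: "phi I E N (fob F K) (ipre N K (fob F K) f \<cdot> \<pi> K) = phi I E K (fob F K) (\<pi> K) \<bullet> (idn C E \<odot> f)"
      using that by (subst phi_ipre) simp_all
    have 3: "ipost N (fob F N) (fob F K) (far F f) \<cdot> \<pi> N = ipre N K (fob F K) f \<cdot> \<pi> K \<longleftrightarrow>
        phi I E N (fob F K) (ipost N (fob F N) (fob F K) (far F f) \<cdot> \<pi> N) =
        phi I E N (fob F K) (ipre N K (fob F K) f \<cdot> \<pi> K)"
      using that phi_inject[of "ipost N (fob F N) (fob F K) (far F f) \<cdot> \<pi> N" N "fob F K" "ipre N K (fob F K) f \<cdot> \<pi> K" E]
      by (auto simp del: phi_cmp)
    show ?thesis unfolding 3 unfolding 1 2 by auto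
  qed
  have bal: "ipre (Gob (dl X) \<ast> Gob X \<ast> N) N (fob F N) (evact X N) \<cdot> \<pi> N =
      bet (F, d) X (Gob X \<ast> N) N \<cdot> \<pi> (Gob X \<ast> N) \<longleftrightarrow>
      d X N \<bullet> phi I E (Gob X \<ast> N) (fob F (Gob X \<ast> N)) (\<pi> (Gob X \<ast> N)) =
      (idn C (Gob X) \<odot> phi I E N (fob F N) (\<pi> N)) \<bullet> swap X E N" (is "?l = ?r \<longleftrightarrow> _") for X N
  proof -
    let ?N = "Gob (dl X) \<ast> Gob X \<ast> N"
    have 1: "phi I E ?N (fob F N) ?l = phi I E N (fob F N) (\<pi> N) \<bullet> (idn C E \<odot> evact X N)"
      by (subst phi_ipre) simp_all
    have 2: "phi I E ?N (fob F N) ?r =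
        gam (F, d) X E (Gob X \<ast> N) N (phi I E (Gob X \<ast> N) (fob F (Gob X \<ast> N)) (\<pi> (Gob X \<ast> N)))"
      by (rule phi_bet[OF Fd]) simp_all
    have 3: "?l = ?r \<longleftrightarrow> phi I E ?N (fob F N) ?l = phi I E ?N (fob F N) ?r"
      using phi_inject[of ?l ?N "fob F N" ?r E] by (auto simp del: phi_cmp)
    show ?thesis
      unfolding 3 unfolding 1 2 by (rule balanced_iff[OF Fd]) simp_all
  qed
  show ?thesis
    by (auto simp: relative_wedge_def natto_def hom_bifctr_def hom_iff M.hom_iff ev_act_MV dinat bal)
qed

end

section \<open>The universal property of the right adjoint\<close>

context central_setting
begin

lemma fmuli_Gbri: "(idn C (Gob X) \<boxtimes> Gbri Y Z) \<cdot> (Gbri X Z \<boxtimes> idn C (Gob Y)) \<cdot> (idn C Z \<boxtimes> fmuli X Y) =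
    (fmuli X Y \<boxtimes> idn C Z) \<cdot> Gbri (X \<otimes>\<^bsub>V\<^esub> Y) Z"
proof -
  have "(fmuli X Y \<boxtimes> idn C Z) \<cdot> ((fmul G X Y \<boxtimes> idn C Z) \<cdot> (idn C (Gob X) \<boxtimes> Gbri Y Z) \<cdot> (Gbri X Z \<boxtimes> idn C (Gob Y))) \<cdot> (idn C Z \<boxtimes> fmuli X Y) =
      (fmuli X Y \<boxtimes> idn C Z) \<cdot> Gbri (X \<otimes>\<^bsub>V\<^esub> Y) Z"
    unfolding fmul_Gbri by (simp add: tar_cmp_typed)
  then show ?thesis
    by (simp add: tar_cmp_typed_assoc[of "fmul G X Y"])
qed

lemma funti_Gbri: "(funti \<boxtimes> idn C Z) \<cdot> Gbri (unt V) Z = idn C Z \<boxtimes> funti"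
proof -
  have "(funti \<boxtimes> idn C Z) \<cdot> (Gbri (unt V) Z \<cdot> (idn C Z \<boxtimes> funt G)) \<cdot> (idn C Z \<boxtimes> funti) = (funti \<boxtimes> idn C Z) \<cdot> Gbri (unt V) Z"
    by (simp add: tar_cmp_typed)
  moreover have "(funti \<boxtimes> idn C Z) \<cdot> (funt G \<boxtimes> idn C Z) \<cdot> (idn C Z \<boxtimes> funti) = idn C Z \<boxtimes> funti"
    by (simp add: tar_cmp_typed_assoc[of "funt G"])
  ultimately show ?thesis unfolding funt_Gbri by simp
qed

text \<open>The constraint laws reduce to properties of \<open>Gbri\<close>: naturality along
  \<open>far G\<close>, compatibility with \<open>fmul G\<close> and with \<open>funt G\<close>.
  Right exactness holds because right rigidity makes \<open>Z\<close> a left dual, so that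
  \<open>Z \<rhd> -\<close> is a left adjoint.\<close>

lemma rho_EndV: "rho Z \<in> EndV"
proof -
  let ?F = "\<lparr>fob = (\<lambda>N. Z \<ast> N), far = (\<lambda>f. idn C Z \<odot> f)\<rparr>"
  have "module_functor V MV MV ?F (\<lambda>X N. swap X Z N)"
  proof unfold_locales
    fix X X' K K' f g assume "f \<in> hom V X X'" "g \<in> hom MV K K'"
    then have [simp]: "src V f = X" "trg V f = X'" "src M g = K" "trg M g = K'" by (simp_all add: V.hom_iff M.hom_iff)
    have *: "(Gbri X' Z \<odot> idn M K') \<bullet> ((idn C Z \<boxtimes> far G f) \<odot> idn M K') \<bullet> h =
        ((far G f \<boxtimes> idn C Z) \<odot> idn M K') \<bullet> (Gbri X Z \<odot> idn M K') \<bullet> h"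
      if "trg M h = (Z \<otimes> Gob X) \<ast> K'" for h
      using that far_G_Gbri[of f Z] by (simp add: aar_cmp_typed_assoc)
    have 1: "swap X' Z K' \<bullet> (idn C Z \<odot> far G f \<odot> idn M K') = (far G f \<odot> idn M (Z \<ast> K')) \<bullet> swap X Z K'"
      by (simp add: swap_eq act_act act_tob *)
    have "swap X' Z K' \<bullet> (idn C Z \<odot> far G f \<odot> g) =
        (swap X' Z K' \<bullet> (idn C Z \<odot> far G f \<odot> idn M K')) \<bullet> (idn C Z \<odot> idn C (Gob X) \<odot> g)"
      by (simp add: aar_cmp_typed)
    also have "\<dots> = (far G f \<odot> idn M (Z \<ast> K')) \<bullet> swap X Z K' \<bullet> (idn C Z \<odot> idn C (Gob X) \<odot> g)"
      unfolding 1 by simp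
    also have "\<dots> = (far G f \<odot> idn C Z \<odot> g) \<bullet> swap X Z K"
      using swap_natural[of X Z g] by (simp add: aar_cmp_typed_assoc)
    finally show "swap X' Z K' \<cdot>\<^bsub>MV\<^esub> far ?F (f \<unrhd>\<^bsub>MV\<^esub> g) = (f \<unrhd>\<^bsub>MV\<^esub> far ?F g) \<cdot>\<^bsub>MV\<^esub> swap X Z K"
      by simp
  next
    fix X Y K
    have *: "((idn C (Gob X) \<boxtimes> Gbri Y Z) \<odot> idn M K) \<bullet> ((Gbri X Z \<boxtimes> idn C (Gob Y)) \<odot> idn M K) \<bullet>
        ((idn C Z \<boxtimes> fmuli X Y) \<odot> idn M K) \<bullet> h =
        ((fmuli X Y \<boxtimes> idn C Z) \<odot> idn M K) \<bullet> (Gbri (X \<otimes>\<^bsub>V\<^esub> Y) Z \<odot> idn M K) \<bullet> h"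
      if "trg M h = (Z \<otimes> Gob (X \<otimes>\<^bsub>V\<^esub> Y)) \<ast> K" for h
      using that fmuli_Gbri[of X Y Z] by (simp add: aar_cmp_typed_assoc)
    show "(idn V X \<unrhd>\<^bsub>MV\<^esub> swap Y Z K) \<cdot>\<^bsub>MV\<^esub> swap X Z (Y \<rhd>\<^bsub>MV\<^esub> K) \<cdot>\<^bsub>MV\<^esub> far ?F (asc MV X Y K) =
        asc MV X Y (fob ?F K) \<cdot>\<^bsub>MV\<^esub> swap (X \<otimes>\<^bsub>V\<^esub> Y) Z K"
      by (simp add: swap_eq strictify *)
  next
    fix K
    have *: "((funti \<boxtimes> idn C Z) \<odot> idn M K) \<bullet> (Gbri (unt V) Z \<odot> idn M K) \<bullet> h = ((idn C Z \<boxtimes> funti) \<odot> idn M K) \<bullet> h"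
      if "trg M h = (Z \<otimes> Gob (unt V)) \<ast> K" for h
      using that funti_Gbri[of Z] by (simp add: aar_cmp_typed_assoc)
    show "lun MV (fob ?F K) \<cdot>\<^bsub>MV\<^esub> swap (unt V) Z K = far ?F (lun MV K)"
      by (simp add: swap_eq strictify *)
  qed (auto simp: M.hom_iff aar_pls_right aar_scl_right hom_iff act_cmp swap_iso)
  moreover have "right_exact M M ?F"
  proof -
    obtain D ev co where "left_dual C D Z ev co" using right_rigid[of Z] by auto
    then show ?thesis
      using act_cokernel by (auto simp: right_exact_def M.hom_iff)
  qed
  ultimately show ?thesis
    by (simp add: EndV_def rho_def)
qed

lemma IdV_EndV: "IdV \<in> EndV"
proof -
  have "module_functor V MV MV \<lparr>fob = (\<lambda>N. N), far = (\<lambda>f. f)\<rparr> (\<lambda>X N. idn M (Gob X \<ast> N))"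
    by unfold_locales (auto simp: M.hom_iff V.hom_iff aar_cmp_typed)
  then show ?thesis
    by (simp add: EndV_def IdV_def right_exact_def)
qed

lemma src_end_pi: "Fd \<in> EndV \<Longrightarrow> src C (end_pi Fd N) = rho_bar Fd"
  and trg_end_pi: "Fd \<in> EndV \<Longrightarrow> trg C (end_pi Fd N) = ih I N (fob (fst Fd) N)"
  using ends by (auto simp: relative_ends_def relative_end_def relative_wedge_def rho_bar_def end_pi_def
      hom_iff hom_bifctr_def case_prod_beta)

lemma natto_counit: "Fd \<in> EndV \<Longrightarrow> natto Fd (rho_bar Fd) (adj_counit Fd)"
proof -
  assume Fd: "Fd \<in> EndV"
  obtain F d where [simp]: "Fd = (F, d)" by (cases Fd)
  have "relative_wedge V dl ev MV C (hom_bifctr F) (bet (F, d)) (rho_bar (F, d), end_pi (F, d))"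
    using ends Fd by (auto simp: relative_ends_def relative_end_def rho_bar_def end_pi_def case_prod_beta)
  then show ?thesis
    using Fd src_end_pi[OF Fd] trg_end_pi[OF Fd]
    by (subst (asm) relative_wedge_iff) (simp_all add: adj_counit_def[abs_def])
qed

lemma natto_types: "natto Fd Y \<alpha> \<Longrightarrow> src M (\<alpha> N) = Y \<ast> N" "natto Fd Y \<alpha> \<Longrightarrow> trg M (\<alpha> N) = fob (fst Fd) N"
  by (auto simp: natto_def split: prod.splits)

text \<open>Transposition replaces the projections of the end by the counit, whose components are
  arrows of \<open>M\<close>.\<close>

lemma end_pi_cmp_eq_iff:
  assumes Fd: "Fd \<in> EndV" and f: "trg C f = rho_bar Fd" and g: "src C g = src C f" "trg C g = ih I N (fob (fst Fd) N)"
  shows "end_pi Fd N \<cdot> f = g \<longleftrightarrow> adj_counit Fd N \<bullet> (f \<odot> idn M N) = phi I (src C f) N (fob (fst Fd) N) g"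
proof -
  note [simp] = src_end_pi[OF Fd] trg_end_pi[OF Fd]
  have "phi I (src C f) N (fob (fst Fd) N) (end_pi Fd N \<cdot> f) = adj_counit Fd N \<bullet> (f \<odot> idn M N)"
    using f by (simp add: adj_counit_def)
  then show ?thesis
    using phi_inject[of "end_pi Fd N \<cdot> f" N "fob (fst Fd) N" g "src C f"] f g by auto
qed

text \<open>A transformation out of \<open>rho Y\<close> and a relative wedge with vertex
  \<open>Y\<close> are the same data via \<open>psi\<close>, so the universal property of the end
  becomes representability.\<close>

lemma natto_universal:
  assumes Fd: "Fd \<in> EndV" and \<alpha>: "natto Fd Y \<alpha>"
  shows "\<exists>!f. src C f = Y \<and> trg C f = rho_bar Fd \<and> (\<forall>N. adj_counit Fd N \<bullet> (f \<odot> idn M N) = \<alpha> N)"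
proof -
  obtain F d where [simp]: "Fd = (F, d)" by (cases Fd)
  let ?p = "\<lambda>N. psi Y N (fob F N) (\<alpha> N)"
  note [simp] = natto_types[OF \<alpha>]
  have "relative_wedge V dl ev MV C (hom_bifctr F) (bet (F, d)) (Y, ?p)"
    using Fd \<alpha> by (subst relative_wedge_iff) simp_all
  then have "\<exists>!f. f \<in> hom C Y (rho_bar Fd) \<and> (\<forall>N\<in>obj MV. end_pi Fd N \<cdot> f = ?p N)"
    using ends Fd by (auto simp: relative_ends_def relative_end_def rho_bar_def end_pi_def case_prod_beta)
  moreover have "f \<in> hom C Y (rho_bar Fd) \<and> (\<forall>N\<in>obj MV. end_pi Fd N \<cdot> f = ?p N) \<longleftrightarrow>
      src C f = Y \<and> trg C f = rho_bar Fd \<and> (\<forall>N. adj_counit Fd N \<bullet> (f \<odot> idn M N) = \<alpha> N)" for f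
    using end_pi_cmp_eq_iff[OF Fd, of f] by (auto simp: hom_iff)
  ultimately show ?thesis by simp
qed

lemma natto_rho_comp:
  assumes Fd: "Fd \<in> EndV" and \<beta>: "natto Fd Z \<beta>" and \<gamma>: "natto (rho Z) Y \<gamma>"
  shows "natto Fd Y (\<lambda>N. \<beta> N \<bullet> \<gamma> N)"
proof -
  obtain F d where eq: "Fd = (F, d)" by (cases Fd)
  have fst_rho: "fob (fst (rho Z)) N = Z \<ast> N" for N by (simp add: rho_def)
  note [simp] = natto_types[OF \<beta>] natto_types[OF \<gamma>] EndV_D[OF Fd[unfolded eq]] fst_rho
  have n1: "\<beta> (trg M f) \<bullet> (idn C Z \<odot> f) = far F f \<bullet> \<beta> (src M f)"
    and v1: "d X N \<bullet> \<beta> (Gob X \<ast> N) = (idn C (Gob X) \<odot> \<beta> N) \<bullet> swap X Z N"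
    and n2: "\<gamma> (trg M f) \<bullet> (idn C Y \<odot> f) = (idn C Z \<odot> f) \<bullet> \<gamma> (src M f)"
    and v2: "swap X Z N \<bullet> \<gamma> (Gob X \<ast> N) = (idn C (Gob X) \<odot> \<gamma> N) \<bullet> swap X Y N" for f X N
    using \<beta> \<gamma> by (simp_all add: natto_def eq rho_def)
  have "(\<beta> (trg M f) \<bullet> \<gamma> (trg M f)) \<bullet> (idn C Y \<odot> f) = far F f \<bullet> \<beta> (src M f) \<bullet> \<gamma> (src M f)" for f
  proof -
    have "(\<beta> (trg M f) \<bullet> \<gamma> (trg M f)) \<bullet> (idn C Y \<odot> f) = (\<beta> (trg M f) \<bullet> (idn C Z \<odot> f)) \<bullet> \<gamma> (src M f)"
      by (simp add: n2)
    then show ?thesis unfolding n1 by (simp add: eq)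
  qed
  moreover have "d X N \<bullet> \<beta> (Gob X \<ast> N) \<bullet> \<gamma> (Gob X \<ast> N) = (idn C (Gob X) \<odot> (\<beta> N \<bullet> \<gamma> N)) \<bullet> swap X Y N" for X N
  proof -
    have "d X N \<bullet> \<beta> (Gob X \<ast> N) \<bullet> \<gamma> (Gob X \<ast> N) = (d X N \<bullet> \<beta> (Gob X \<ast> N)) \<bullet> \<gamma> (Gob X \<ast> N)"
      by (simp add: eq)
    then show ?thesis unfolding v1 by (simp add: v2 act_cmp)
  qed
  ultimately show ?thesis by (simp add: natto_def eq)
qed

lemma fob_rho [simp]: "fob (fst (rho Z)) N = Z \<ast> N" and fob_IdV [simp]: "fob (fst IdV) N = N"
  by (simp_all add: rho_def IdV_def)

lemma natto_rho_idn: "natto (rho Z) Z (\<lambda>N. idn M (Z \<ast> N))"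
  by (simp add: natto_def rho_def)

lemma natto_rho_act: "natto (rho (trg C g)) (src C g) (\<lambda>N. g \<odot> idn M N)"
  using exchange[of g] swap_natural_left[of _ g] by (simp add: natto_def rho_def)

lemma counit_cancel:
  assumes Fd: "Fd \<in> EndV" and fg: "src C f = src C g" "trg C f = rho_bar Fd" "trg C g = rho_bar Fd"
    and eq: "\<And>N. adj_counit Fd N \<bullet> (f \<odot> idn M N) = adj_counit Fd N \<bullet> (g \<odot> idn M N)"
  shows "f = g"
proof -
  have "natto Fd (src C g) (\<lambda>N. adj_counit Fd N \<bullet> (g \<odot> idn M N))"
    using natto_rho_comp[OF Fd natto_counit[OF Fd]] natto_rho_act[of g] fg by simp
  from natto_universal[OF Fd this] show ?thesis
    using fg eq by blast
qed

text \<open>Here and in the next lemma a definite description is evaluated by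
  \<open>natto_universal\<close>, after its defining condition is rewritten in terms of the
  counit.\<close>

lemma
  shows src_adj_unit [simp]: "src C (adj_unit Z) = Z"
    and trg_adj_unit [simp]: "trg C (adj_unit Z) = rho_bar (rho Z)"
    and counit_adj_unit: "adj_counit (rho Z) N \<bullet> (adj_unit Z \<odot> idn M N) = idn M (Z \<ast> N)"
proof -
  have *: "f \<in> hom C Z (rho_bar (rho Z)) \<and> (\<forall>N\<in>obj M. end_pi (rho Z) N \<cdot> f = icoev Z N) \<longleftrightarrow>
      src C f = Z \<and> trg C f = rho_bar (rho Z) \<and> (\<forall>N. adj_counit (rho Z) N \<bullet> (f \<odot> idn M N) = idn M (Z \<ast> N))" for f
    using end_pi_cmp_eq_iff[OF rho_EndV, of f Z "icoev Z _"] by (auto simp: hom_iff)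
  have "src C (adj_unit Z) = Z \<and> trg C (adj_unit Z) = rho_bar (rho Z) \<and>
      (\<forall>N. adj_counit (rho Z) N \<bullet> (adj_unit Z \<odot> idn M N) = idn M (Z \<ast> N))"
    unfolding adj_unit_def * by (rule theI'[OF natto_universal[OF rho_EndV natto_rho_idn]])
  then show "src C (adj_unit Z) = Z" "trg C (adj_unit Z) = rho_bar (rho Z)"
    "adj_counit (rho Z) N \<bullet> (adj_unit Z \<odot> idn M N) = idn M (Z \<ast> N)" by blast+
qed

text \<open>Compatibility of \<open>\<beta>\<close> is asked only after composition with the counit,
  the form in which \<open>natto_universal\<close> applies.\<close>

lemma
  assumes Fd: "Fd \<in> EndV" and Fd': "Fd' \<in> EndV" and \<beta>: "natto Fd' (rho_bar Fd) (\<lambda>N. \<beta> N \<bullet> adj_counit Fd N)"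
    and ty: "\<And>N. src M (\<beta> N) = fob (fst Fd) N" "\<And>N. trg M (\<beta> N) = fob (fst Fd') N"
  shows src_rho_bar_map: "src C (rho_bar_map Fd Fd' \<beta>) = rho_bar Fd"
    and trg_rho_bar_map: "trg C (rho_bar_map Fd Fd' \<beta>) = rho_bar Fd'"
    and counit_rho_bar_map: "adj_counit Fd' N \<bullet> (rho_bar_map Fd Fd' \<beta> \<odot> idn M N) = \<beta> N \<bullet> adj_counit Fd N"
proof -
  note [simp] = ty src_end_pi[OF Fd] trg_end_pi[OF Fd]
  let ?g = "\<lambda>N. ipost N (fob (fst Fd) N) (fob (fst Fd') N) (\<beta> N) \<cdot> end_pi Fd N"
  have p: "phi I (rho_bar Fd) N (fob (fst Fd') N) (?g N) = \<beta> N \<bullet> adj_counit Fd N" for N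
    by (subst phi_ipost) (simp_all add: adj_counit_def)
  have *: "f \<in> hom C (rho_bar Fd) (rho_bar Fd') \<and> (\<forall>N\<in>obj M. end_pi Fd' N \<cdot> f = ?g N) \<longleftrightarrow>
      src C f = rho_bar Fd \<and> trg C f = rho_bar Fd' \<and> (\<forall>N. adj_counit Fd' N \<bullet> (f \<odot> idn M N) = \<beta> N \<bullet> adj_counit Fd N)" for f
    using end_pi_cmp_eq_iff[OF Fd', of f "?g _"] p by (auto simp: hom_iff simp del: phi_cmp)
  have "src C (rho_bar_map Fd Fd' \<beta>) = rho_bar Fd \<and> trg C (rho_bar_map Fd Fd' \<beta>) = rho_bar Fd' \<and>
      (\<forall>N. adj_counit Fd' N \<bullet> (rho_bar_map Fd Fd' \<beta> \<odot> idn M N) = \<beta> N \<bullet> adj_counit Fd N)"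
    unfolding rho_bar_map_def * by (rule theI'[OF natto_universal[OF Fd' \<beta>]])
  then show "src C (rho_bar_map Fd Fd' \<beta>) = rho_bar Fd" "trg C (rho_bar_map Fd Fd' \<beta>) = rho_bar Fd'"
    "adj_counit Fd' N \<bullet> (rho_bar_map Fd Fd' \<beta> \<odot> idn M N) = \<beta> N \<bullet> adj_counit Fd N" by blast+
qed

text \<open>All structure morphisms of \<open>rho_bar\<close> are transposes of this form.\<close>

lemma
  assumes Fd: "Fd \<in> EndV" and \<beta>: "natto Fd Z \<beta>"
  shows src_mate: "src C (rho_bar_map (rho Z) Fd \<beta> \<cdot> adj_unit Z) = Z"
    and trg_mate: "trg C (rho_bar_map (rho Z) Fd \<beta> \<cdot> adj_unit Z) = rho_bar Fd"
    and counit_mate: "adj_counit Fd N \<bullet> ((rho_bar_map (rho Z) Fd \<beta> \<cdot> adj_unit Z) \<odot> idn M N) = \<beta> N"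
proof -
  have n: "natto Fd (rho_bar (rho Z)) (\<lambda>N. \<beta> N \<bullet> adj_counit (rho Z) N)"
    by (rule natto_rho_comp[OF Fd \<beta> natto_counit[OF rho_EndV]])
  have ty: "src M (\<beta> N) = fob (fst (rho Z)) N" "trg M (\<beta> N) = fob (fst Fd) N" for N
    by (simp_all add: natto_types[OF \<beta>])
  note m [simp] = src_rho_bar_map[OF rho_EndV Fd n ty] trg_rho_bar_map[OF rho_EndV Fd n ty]
  note [simp] = natto_types[OF \<beta>] natto_types[OF natto_counit[OF rho_EndV]] natto_types[OF natto_counit[OF Fd]]
  show "src C (rho_bar_map (rho Z) Fd \<beta> \<cdot> adj_unit Z) = Z"
    "trg C (rho_bar_map (rho Z) Fd \<beta> \<cdot> adj_unit Z) = rho_bar Fd" by simp_all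
  have "adj_counit Fd N \<bullet> ((rho_bar_map (rho Z) Fd \<beta> \<cdot> adj_unit Z) \<odot> idn M N) =
      (adj_counit Fd N \<bullet> (rho_bar_map (rho Z) Fd \<beta> \<odot> idn M N)) \<bullet> (adj_unit Z \<odot> idn M N)"
    by (simp add: cmp_act)
  also have "\<dots> = \<beta> N"
    unfolding counit_rho_bar_map[OF rho_EndV Fd n ty] by (simp add: counit_adj_unit)
  finally show "adj_counit Fd N \<bullet> ((rho_bar_map (rho Z) Fd \<beta> \<cdot> adj_unit Z) \<odot> idn M N) = \<beta> N" .
qed

end

section \<open>The algebra\<close>

context central_setting
begin

sublocale nat: tensor_extension C natfam fst "\<lambda>f. fst (snd f)" natcmp natten natact
  by (rule tensor_extension_natfam)

abbreviation cen :: "'c \<times> 'c \<times> ('o \<Rightarrow> 'a) \<Rightarrow> bool" where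
  "cen \<equiv> nat.central_arr Gob Gbr"

text \<open>The two equations differ by conjugation with associators and half-braidings. This links
  abstract centrality to the transformations represented by the end.\<close>

lemma cen_iff: "cen (Y, Z, \<alpha>) \<longleftrightarrow> natto (rho Z) Y \<alpha>"
proof -
  have "natcmp (natact (Gbr X Z)) (natten (natact (idn C (Gob X))) (Y, Z, \<alpha>)) =
      natcmp (natten (Y, Z, \<alpha>) (natact (idn C (Gob X)))) (natact (Gbr X Y)) \<longleftrightarrow>
      (\<forall>N. swap X Z N \<bullet> \<alpha> (Gob X \<ast> N) = (idn C (Gob X) \<odot> \<alpha> N) \<bullet> swap X Y N)"
    if ty: "\<And>N. src M (\<alpha> N) = Y \<ast> N" "\<And>N. trg M (\<alpha> N) = Z \<ast> N" for X
  proof -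
    note [simp] = ty
    let ?g = "Gob X"
    have "(Gbr X Z \<odot> idn M N) \<bullet> asci ?g Z N \<bullet> (idn C ?g \<odot> \<alpha> N) \<bullet> asc M ?g Y N =
        asci Z ?g N \<bullet> \<alpha> (?g \<ast> N) \<bullet> asc M Y ?g N \<bullet> (Gbr X Y \<odot> idn M N) \<longleftrightarrow>
        swap X Z N \<bullet> \<alpha> (?g \<ast> N) = (idn C ?g \<odot> \<alpha> N) \<bullet> swap X Y N" (is "?L = ?R \<longleftrightarrow> ?l = ?r") for N
    proof -
      let ?p = "asc M ?g Z N \<bullet> (Gbri X Z \<odot> idn M N)" and ?q = "(Gbri X Y \<odot> idn M N) \<bullet> asci Y ?g N"
      let ?p' = "(Gbr X Z \<odot> idn M N) \<bullet> asci ?g Z N" and ?q' = "asc M Y ?g N \<bullet> (Gbr X Y \<odot> idn M N)"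
      \<comment> \<open>In either direction both sides arise by composing with the same outer
        arrows, so each equation implies the other.\<close>
      have "?r = ?p \<bullet> ?L \<bullet> ?q" "?l = ?p \<bullet> ?R \<bullet> ?q" "?L = ?p' \<bullet> ?r \<bullet> ?q'" "?R = ?p' \<bullet> ?l \<bullet> ?q'"
        by (simp_all add: swap_eq aar_cmp_typed aar_cmp_typed_assoc)
      then show ?thesis by metis
    qed
    then show ?thesis
      by (simp add: natact_def natten_def natcmp_def fun_eq_iff)
  qed
  moreover have "cen (Y, Z, \<alpha>) \<longleftrightarrow> natfam (Y, Z, \<alpha>) \<and> (\<forall>X. natcmp (natact (Gbr X Z)) (natten (natact (idn C (Gob X))) (Y, Z, \<alpha>)) =
      natcmp (natten (Y, Z, \<alpha>) (natact (idn C (Gob X)))) (natact (Gbr X Y)))"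
    by (simp add: nat.central_arr_def)
  ultimately show ?thesis
    unfolding natto_def natfam_def rho_def by auto
qed

lemma swap_unit: "(idn C (Gob X) \<odot> lun M N) \<bullet> swap X (unt C) N = lun M (Gob X \<ast> N)"
proof -
  have "Gbri X (unt C) = idn C (Gob X)"
    using Gbr_Gbri[of X "unt C"] by (simp add: half_braiding_unit[OF half_braiding_G])
  then show ?thesis
    by (simp add: swap_eq flip: asci_unit_right asci_unit_left)
qed

lemma natto_lun: "natto IdV (unt C) (lun M)"
  using swap_unit lun_nat by (simp add: natto_def IdV_def)

text \<open>The identity functor is not literally the action of the unit object. The inverse unitor
  moves the target from \<open>N\<close> to \<open>1 \<rhd> N\<close>, as an arrow of the extension
  requires.\<close>

lemma natto_IdV_imp_cen:
  assumes "natto IdV Y \<alpha>" shows "cen (Y, unt C, \<lambda>N. luni N \<bullet> \<alpha> N)"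
proof -
  note [simp] = natto_types[OF assms]
  have n: "\<alpha> (trg M f) \<bullet> (idn C Y \<odot> f) = f \<bullet> \<alpha> (src M f)" for f
    using assms by (simp add: natto_def IdV_def)
  have v: "\<alpha> (Gob X \<ast> N) = (idn C (Gob X) \<odot> \<alpha> N) \<bullet> swap X Y N" for X N
    using assms by (simp add: natto_def IdV_def)
  have s: "swap X (unt C) N \<bullet> luni (Gob X \<ast> N) = idn C (Gob X) \<odot> luni N" for X N
  proof -
    have "(idn C (Gob X) \<odot> luni N) \<bullet> ((idn C (Gob X) \<odot> lun M N) \<bullet> swap X (unt C) N) \<bullet> luni (Gob X \<ast> N) =
        idn C (Gob X) \<odot> luni N"
      unfolding swap_unit by simp
    then show ?thesis by (simp add: aar_cmp_typed_assoc)
  qed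
  have "luni (trg M f) \<bullet> f \<bullet> \<alpha> (src M f) = (idn C (unt C) \<odot> f) \<bullet> luni (src M f) \<bullet> \<alpha> (src M f)" for f
    using luni_nat[of f] by (simp flip: M.cmp_assoc_typed)
  moreover have "swap X (unt C) N \<bullet> luni (Gob X \<ast> N) \<bullet> \<alpha> (Gob X \<ast> N) =
      (idn C (Gob X) \<odot> (luni N \<bullet> \<alpha> N)) \<bullet> swap X Y N" for X N
  proof -
    have "swap X (unt C) N \<bullet> luni (Gob X \<ast> N) \<bullet> \<alpha> (Gob X \<ast> N) =
        (swap X (unt C) N \<bullet> luni (Gob X \<ast> N)) \<bullet> \<alpha> (Gob X \<ast> N)"
      by simp
    then show ?thesis unfolding s by (simp add: v act_cmp)
  qed
  ultimately show ?thesis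
    unfolding cen_iff by (simp add: natto_def rho_def n)
qed

lemma cen_imp_natto_IdV: "cen (Y, unt C, \<beta>) \<Longrightarrow> natto IdV Y (\<lambda>N. lun M N \<bullet> \<beta> N)"
  unfolding cen_iff by (rule natto_rho_comp[OF IdV_EndV natto_lun])

abbreviation (input) A0 :: 'c where "A0 \<equiv> rho_bar IdV"

abbreviation (input) e0 :: "'o \<Rightarrow> 'a" where "e0 \<equiv> adj_counit IdV"

lemma src_e0 [simp]: "src M (adj_counit IdV N) = rho_bar IdV \<ast> N" and trg_e0 [simp]: "trg M (adj_counit IdV N) = N"
  using natto_types[OF natto_counit[OF IdV_EndV]] by simp_all

lemma e0_natural: "e0 (trg M f) \<bullet> (idn C A0 \<odot> f) = f \<bullet> e0 (src M f)"
  using natto_counit[OF IdV_EndV] by (simp add: natto_def IdV_def)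

abbreviation (input) efam :: "'c \<times> 'c \<times> ('o \<Rightarrow> 'a)" where
  "efam \<equiv> (A0, unt C, \<lambda>N. luni N \<bullet> e0 N)"

text \<open>The universal arrow is the counit at the identity functor followed by the inverse
  unitor; stripping the unitor turns universality into \<open>natto_universal\<close>.\<close>

sublocale cen: unit_coreflection C cen fst "\<lambda>f. fst (snd f)" natcmp natten natact "rho_bar IdV"
  "(rho_bar IdV, unt C, \<lambda>N. luni N \<bullet> adj_counit IdV N)"
proof (intro unit_coreflection.intro unit_coreflection_axioms.intro)
  show "tensor_extension C cen fst (\<lambda>f. fst (snd f)) natcmp natten natact"
    by (rule nat.tensor_extension_central_arr[OF half_braiding_G])
  show "tensor_category C" by unfold_locales
  show "cen efam" by (rule natto_IdV_imp_cen[OF natto_counit[OF IdV_EndV]])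
  fix a assume "cen a" "fst (snd a) = unt C"
  then obtain Y \<beta> where a: "a = (Y, unt C, \<beta>)" and \<beta>: "cen (Y, unt C, \<beta>)" by (cases a) auto
  have [simp]: "trg M (\<beta> N) = unt C \<ast> N" "src M (\<beta> N) = Y \<ast> N" for N
    using natto_types[OF \<beta>[unfolded cen_iff]] by simp_all
  have "(\<forall>N. luni N \<bullet> e0 N \<bullet> (f \<odot> idn M N) = \<beta> N) \<longleftrightarrow> (\<forall>N. e0 N \<bullet> (f \<odot> idn M N) = lun M N \<bullet> \<beta> N)"
    if [simp]: "trg C f = A0" for f
  proof -
    have "luni N \<bullet> e0 N \<bullet> (f \<odot> idn M N) = \<beta> N \<longleftrightarrow> e0 N \<bullet> (f \<odot> idn M N) = lun M N \<bullet> \<beta> N" for N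
    proof
      assume "luni N \<bullet> e0 N \<bullet> (f \<odot> idn M N) = \<beta> N"
      then have "lun M N \<bullet> luni N \<bullet> e0 N \<bullet> (f \<odot> idn M N) = lun M N \<bullet> \<beta> N" by simp
      then show "e0 N \<bullet> (f \<odot> idn M N) = lun M N \<bullet> \<beta> N" by simp
    qed simp
    then show ?thesis by blast
  qed
  then have "src C f = fst a \<and> trg C f = A0 \<and> natcmp efam (natact f) = a \<longleftrightarrow>
      src C f = Y \<and> trg C f = A0 \<and> (\<forall>N. e0 N \<bullet> (f \<odot> idn M N) = lun M N \<bullet> \<beta> N)" for f
    by (auto simp: a natcmp_def natact_def fun_eq_iff)
  then show "\<exists>!f. src C f = fst a \<and> trg C f = A0 \<and> natcmp efam (natact f) = a"
    using natto_universal[OF IdV_EndV cen_imp_natto_IdV[OF \<beta>]] by simp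
qed simp_all

lemma e_left_component:
  "natten (natact (idn C Y)) efam = (Y \<otimes> A0, Y, \<lambda>N. (idn C Y \<odot> e0 N) \<bullet> asc M Y A0 N)"
  by (simp add: natact_def natten_def asci_unit_right fun_eq_iff aar_cmp_typed_assoc)

lemma e_right_component:
  "natten efam (natact (idn C Y)) = (A0 \<otimes> Y, Y, \<lambda>N. e0 (Y \<ast> N) \<bullet> asc M A0 Y N)"
  by (simp add: natact_def natten_def asci_unit_left fun_eq_iff)

lemma e_e_component:
  "natten efam efam = (A0 \<otimes> A0, unt C, \<lambda>N. luni N \<bullet> e0 N \<bullet> (idn C A0 \<odot> e0 N) \<bullet> asc M A0 A0 N)"
proof -
  have "e0 (unt C \<ast> N) \<bullet> (idn C A0 \<odot> (luni N \<bullet> e0 N)) \<bullet> asc M A0 A0 N =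
      luni N \<bullet> e0 N \<bullet> (idn C A0 \<odot> e0 N) \<bullet> asc M A0 A0 N" for N
  proof -
    have "e0 (unt C \<ast> N) \<bullet> (idn C A0 \<odot> (luni N \<bullet> e0 N)) \<bullet> asc M A0 A0 N =
        (e0 (unt C \<ast> N) \<bullet> (idn C A0 \<odot> luni N)) \<bullet> (idn C A0 \<odot> e0 N) \<bullet> asc M A0 A0 N"
      by (simp add: act_cmp)
    \<comment> \<open>Naturality of \<open>e0\<close>, applied to the arrow
      \<open>luni N\<close>.\<close>
    also have "e0 (unt C \<ast> N) \<bullet> (idn C A0 \<odot> luni N) = luni N \<bullet> e0 N"
      using e0_natural[of "luni N"] by simp
    finally show ?thesis by simp
  qed
  then show ?thesis
    by (simp add: natten_def asci_unit_left fun_eq_iff)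
qed

text \<open>The family is a tensor product of two arrows of the central extension and inherits its
  \<open>V\<close>-compatibility from them.\<close>

lemma natto_left: "natto (rho Y) (Y \<otimes> A0) (\<lambda>N. (idn C Y \<odot> e0 N) \<bullet> asc M Y A0 N)"
  using cen.ten_arr[OF cen.J_arr[of "idn C Y"] cen.e_arr] unfolding e_left_component cen_iff .

lemma natto_right: "natto (rho Y) (A0 \<otimes> Y) (\<lambda>N. e0 (Y \<ast> N) \<bullet> asc M A0 Y N)"
  using cen.ten_arr[OF cen.e_arr cen.J_arr[of "idn C Y"]] unfolding e_right_component cen_iff .

lemma natto_mult: "natto IdV (A0 \<otimes> A0) (\<lambda>N. e0 N \<bullet> (idn C A0 \<odot> e0 N) \<bullet> asc M A0 A0 N)"
  using cen_imp_natto_IdV[OF cen.ten_arr[OF cen.e_arr cen.e_arr, unfolded e_e_component]] by simp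

text \<open>With identity constraints the one-sided actions on \<open>IdV\<close> are equal to
  \<open>rho Y\<close>, not merely isomorphic. Hence \<open>l_inv\<close> and \<open>r_inv\<close>
  have the same target, and the middle factor of the half-braiding is an identity.\<close>

lemma ractV_IdV: "ractV IdV Y = rho Y" and lactV_IdV: "lactV Y IdV = rho Y" and compV_IdV: "compV IdV IdV = IdV"
  by (simp_all add: ractV_def lactV_def compV_def IdV_def rho_def)

lemma src_lax_mult: "src C (lax_mult IdV IdV) = A0 \<otimes> A0"
  and trg_lax_mult: "trg C (lax_mult IdV IdV) = A0"
  and counit_lax_mult: "e0 N \<bullet> (lax_mult IdV IdV \<odot> idn M N) = e0 N \<bullet> (idn C A0 \<odot> e0 N) \<bullet> asc M A0 A0 N"
  using src_mate[OF IdV_EndV natto_mult] trg_mate[OF IdV_EndV natto_mult] counit_mate[OF IdV_EndV natto_mult]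
  by (simp_all add: lax_mult_def compV_IdV)

lemma src_lax_unit: "src C lax_unit = unt C"
  and trg_lax_unit: "trg C lax_unit = A0"
  and counit_lax_unit: "e0 N \<bullet> (lax_unit \<odot> idn M N) = lun M N"
  using src_mate[OF IdV_EndV natto_lun] trg_mate[OF IdV_EndV natto_lun] counit_mate[OF IdV_EndV natto_lun]
  by (simp_all add: lax_unit_def)

lemma rho_bar_map_idn: "rho_bar_map (rho Y) (rho Y) (\<lambda>N. idn M (Y \<ast> N)) = idn C (rho_bar (rho Y))"
proof -
  note c = natto_counit[OF rho_EndV] and [simp] = natto_types[OF natto_counit[OF rho_EndV]]
  have n: "natto (rho Y) (rho_bar (rho Y)) (\<lambda>N. idn M (Y \<ast> N) \<bullet> adj_counit (rho Y) N)"
    using c[of Y] by (simp cong: if_cong)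
  have ty: "src M (idn M (Y \<ast> N)) = fob (fst (rho Y)) N" "trg M (idn M (Y \<ast> N)) = fob (fst (rho Y)) N" for N
    by simp_all
  note m = src_rho_bar_map[OF rho_EndV rho_EndV n ty] trg_rho_bar_map[OF rho_EndV rho_EndV n ty]
    counit_rho_bar_map[OF rho_EndV rho_EndV n ty]
  show ?thesis
  proof (rule counit_cancel[OF rho_EndV])
    show "adj_counit (rho Y) N \<bullet> (rho_bar_map (rho Y) (rho Y) (\<lambda>N. idn M (Y \<ast> N)) \<odot> idn M N) =
        adj_counit (rho Y) N \<bullet> (idn C (rho_bar (rho Y)) \<odot> idn M N)" for N
      unfolding m(3) by simp
  qed (simp_all add: m(1,2))
qed

text \<open>\<open>l_mor\<close> is given by \<open>arr_inv\<close>, so \<open>l_inv\<close> must be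
  shown invertible. Its inverse \<open>g\<close> comes from factoring the counit of
  \<open>rho Y\<close> through \<open>Y \<otimes> e\<close>; the half-braiding is then
  \<open>g\<close> composed with \<open>r_inv\<close>, both known through their counits.\<close>

lemma
  shows src_hb: "src C (snd (Z_rho_bar IdCVM) Y) = A0 \<otimes> Y"
    and trg_hb: "trg C (snd (Z_rho_bar IdCVM) Y) = Y \<otimes> A0"
    and counit_hb: "(idn C Y \<odot> e0 N) \<bullet> asc M Y A0 N \<bullet> (snd (Z_rho_bar IdCVM) Y \<odot> idn M N) =
      e0 (Y \<ast> N) \<bullet> asc M A0 Y N"
proof -
  let ?B = "rho_bar (rho Y)" and ?b = "adj_counit (rho Y)" and ?l = "l_inv Y IdV" and ?r = "r_inv IdV Y"
  note c = natto_counit[OF rho_EndV, of Y] and [simp] = natto_types[OF natto_counit[OF rho_EndV]]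
  have l: "src C ?l = Y \<otimes> A0" "trg C ?l = ?B" "\<And>N. ?b N \<bullet> (?l \<odot> idn M N) = (idn C Y \<odot> e0 N) \<bullet> asc M Y A0 N"
    using src_mate[OF rho_EndV natto_left] trg_mate[OF rho_EndV natto_left] counit_mate[OF rho_EndV natto_left]
    by (simp_all add: l_inv_def lactV_IdV)
  have r: "src C ?r = A0 \<otimes> Y" "trg C ?r = ?B" "\<And>N. ?b N \<bullet> (?r \<odot> idn M N) = e0 (Y \<ast> N) \<bullet> asc M A0 Y N"
    using src_mate[OF rho_EndV natto_right] trg_mate[OF rho_EndV natto_right] counit_mate[OF rho_EndV natto_right]
    by (simp_all add: r_inv_def ractV_IdV)
  have "cen (?B, Y, ?b)" using c by (simp add: cen_iff)
  then obtain g where g0: "src C g = ?B" "trg C g = Y \<otimes> A0" "natcmp (natten (natact (idn C Y)) efam) (natact g) = (?B, Y, ?b)"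
    using cen.universal_left[of "(?B, Y, ?b)" Y] by auto
  have g3: "(idn C Y \<odot> e0 N) \<bullet> asc M Y A0 N \<bullet> (g \<odot> idn M N) = ?b N" for N
    using g0 unfolding e_left_component unfolding natcmp_def natact_def by (auto dest: fun_cong[of _ _ N])
  note g = g0(1,2) g3
  have lg: "?l \<cdot> g = idn C ?B"
  proof (rule counit_cancel[OF rho_EndV])
    fix N
    have "?b N \<bullet> ((?l \<cdot> g) \<odot> idn M N) = (?b N \<bullet> (?l \<odot> idn M N)) \<bullet> (g \<odot> idn M N)"
      using g(1,2) l(1,2) by (simp add: cmp_act)
    then show "?b N \<bullet> ((?l \<cdot> g) \<odot> idn M N) = ?b N \<bullet> (idn C ?B \<odot> idn M N)"
      unfolding l(3) using g by simp
  qed (use g(1,2) l(1,2) in simp_all)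
  have hg: "(idn C Y \<odot> e0 N) \<bullet> asc M Y A0 N \<bullet> ((g \<cdot> h) \<odot> idn M N) = ?b N \<bullet> (h \<odot> idn M N)"
    if "trg C h = ?B" for h N
  proof -
    have "(idn C Y \<odot> e0 N) \<bullet> asc M Y A0 N \<bullet> ((g \<cdot> h) \<odot> idn M N) =
        ((idn C Y \<odot> e0 N) \<bullet> asc M Y A0 N \<bullet> (g \<odot> idn M N)) \<bullet> (h \<odot> idn M N)"
      using g(1,2) that by (simp add: cmp_act)
    then show ?thesis unfolding g(3) .
  qed
  have gl: "g \<cdot> ?l = idn C (Y \<otimes> A0)"
  proof (rule cen.e_cancel_left[of _ _ Y])
    show "natcmp (natten (natact (idn C Y)) efam) (natact (g \<cdot> ?l)) = natcmp (natten (natact (idn C Y)) efam) (natact (idn C (Y \<otimes> A0)))"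
      unfolding e_left_component unfolding natcmp_def natact_def
      using g(1,2) l hg[of ?l] by (simp add: fun_eq_iff)
  qed (use g(1,2) l(1,2) in simp_all)
  have lm: "l_mor Y IdV = g"
    unfolding l_mor_def lactV_IdV by (rule arr_inv_eq) (use g(1,2) l(1,2) lg gl in \<open>simp add: inverses_iff\<close>)
  have hb: "snd (Z_rho_bar IdCVM) Y = g \<cdot> ?r"
    using r(2) lm by (simp add: Z_rho_bar_def IdCVM_def ractV_IdV lactV_IdV rho_bar_map_idn)
  show "src C (snd (Z_rho_bar IdCVM) Y) = A0 \<otimes> Y" "trg C (snd (Z_rho_bar IdCVM) Y) = Y \<otimes> A0"
    using g(1,2) r(1,2) by (simp_all add: hb)
  show "(idn C Y \<odot> e0 N) \<bullet> asc M Y A0 N \<bullet> (snd (Z_rho_bar IdCVM) Y \<odot> idn M N) =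
      e0 (Y \<ast> N) \<bullet> asc M A0 Y N"
    unfolding hb using hg[of ?r N] r by simp
qed

sublocale alg: coreflection_algebra C cen fst "\<lambda>f. fst (snd f)" natcmp natten natact "rho_bar IdV"
  "(rho_bar IdV, unt C, \<lambda>N. luni N \<bullet> adj_counit IdV N)" "snd (Z_rho_bar IdCVM)" "lax_mult IdV IdV" "lax_unit"
proof (intro coreflection_algebra.intro coreflection_algebra_axioms.intro)
  show "unit_coreflection C cen fst (\<lambda>f. fst (snd f)) natcmp natten natact A0 efam" by (rule cen.unit_coreflection_axioms)
  show "natcmp (natten (natact (idn C X)) efam) (natact (snd (Z_rho_bar IdCVM) X)) = natten efam (natact (idn C X))" for X
    unfolding e_left_component e_right_component unfolding natcmp_def natact_def
    using counit_hb[of X] by (simp add: src_hb trg_hb fun_eq_iff)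
  show "natcmp efam (natact (lax_mult IdV IdV)) = natten efam efam"
    unfolding e_e_component unfolding natcmp_def natact_def
    by (simp add: src_lax_mult trg_lax_mult fun_eq_iff counit_lax_mult)
  show "natcmp efam (natact lax_unit) = natact (idn C (unt C))"
    unfolding natcmp_def natact_def
    by (simp add: src_lax_unit trg_lax_unit fun_eq_iff counit_lax_unit)
qed (rule src_hb trg_hb src_lax_mult trg_lax_mult src_lax_unit trg_lax_unit)+

lemma Z_rho_bar_IdCVM: "Z_rho_bar IdCVM = (A0, snd (Z_rho_bar IdCVM))"
  by (simp add: Z_rho_bar_def IdCVM_def IdV_def)

theorem algebra_relative_center:
  "is_algebra (relative_center V C G) (Z_rho_bar IdCVM) (lax_mult IdV IdV) lax_unit"
  "is_commutative_algebra (relative_center V C G) (Z_rho_bar IdCVM) (lax_mult IdV IdV) lax_unit"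
proof -
  let ?A = "Z_rho_bar IdCVM"
  have "is_algebra (center C) ?A (lax_mult IdV IdV) lax_unit"
    using alg.is_algebra_center Z_rho_bar_IdCVM by simp
  moreover have "brd (center C) (fob G X) ?A \<cdot> brd (center C) ?A (fob G X) =
     idn (center C) (?A \<otimes>\<^bsub>center C\<^esub> fob G X)" for X
  proof -
    have "Gbr X A0 \<cdot> snd ?A (Gob X) = idn C (A0 \<otimes> Gob X)"
      by (rule alg.braiding_inverse[OF half_braiding_G])
        (use cen.e_arr in \<open>simp add: nat.central_arr_def\<close>)
    then show ?thesis
      by (cases "fob G X"; subst (1 2 3) Z_rho_bar_IdCVM) (simp add: center_def)
  qed
  ultimately show alg: "is_algebra (relative_center V C G) ?A (lax_mult IdV IdV) lax_unit"
    by (simp add: is_algebra_def relative_center_def)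
  have "lax_mult IdV IdV \<cdot>\<^bsub>relative_center V C G\<^esub> brd (relative_center V C G) ?A ?A = lax_mult IdV IdV"
    using alg.\<mu>_commutative by (subst (1 2) Z_rho_bar_IdCVM) (simp add: relative_center_def center_def)
  then show "is_commutative_algebra (relative_center V C G) ?A (lax_mult IdV IdV) lax_unit"
    using alg by (simp add: is_commutative_algebra_def)
qed

text \<open>Under \<open>phi\<close> the morphisms \<open>ia_inv\<close> and \<open>ib\<close> turn
  into associators with evaluations, and the projections become the counit; the claim is then
  \<open>counit_hb\<close>.\<close>

theorem half_braiding_dinatural:
  "ia_inv X N N \<cdot> (idn C X \<boxtimes> end_pi IdV N) \<cdot> snd (Z_rho_bar IdCVM) X = ib X N (X \<ast> N) \<cdot> (end_pi IdV (X \<ast> N) \<boxtimes> idn C X)"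
proof (rule phi_inject[of _ N "X \<ast> N" _ "A0 \<otimes> X"])
  note [simp] = src_end_pi[OF IdV_EndV] trg_end_pi[OF IdV_EndV] src_hb trg_hb
  have e: "e0 K = iev K K \<bullet> (end_pi IdV K \<odot> idn M K)" for K
    by (simp add: adj_counit_def phi_eq_iev)
  show "phi I (A0 \<otimes> X) N (X \<ast> N) (ia_inv X N N \<cdot> (idn C X \<boxtimes> end_pi IdV N) \<cdot> snd (Z_rho_bar IdCVM) X) =
      phi I (A0 \<otimes> X) N (X \<ast> N) (ib X N (X \<ast> N) \<cdot> (end_pi IdV (X \<ast> N) \<boxtimes> idn C X))"
    (is "?L = ?R")
  proof -
    have "?L = (idn C X \<odot> iev N N) \<bullet> (asc M X (ih I N N) N \<bullet> ((idn C X \<boxtimes> end_pi IdV N) \<odot> idn M N)) \<bullet> (snd (Z_rho_bar IdCVM) X \<odot> idn M N)"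
      by (simp add: phi_ia_inv cmp_act)
    also have "\<dots> = (idn C X \<odot> e0 N) \<bullet> asc M X A0 N \<bullet> (snd (Z_rho_bar IdCVM) X \<odot> idn M N)"
      by (subst asc_nat[of _ X X _ A0 "ih I N N" _ N N]) (simp_all add: e act_cmp)
    also have "\<dots> = iev (X \<ast> N) (X \<ast> N) \<bullet> (end_pi IdV (X \<ast> N) \<odot> idn M (X \<ast> N)) \<bullet> asc M A0 X N"
      unfolding counit_hb by (simp add: e)
    also have "\<dots> = iev (X \<ast> N) (X \<ast> N) \<bullet> asc M (ih I (X \<ast> N) (X \<ast> N)) X N \<bullet> ((end_pi IdV (X \<ast> N) \<boxtimes> idn C X) \<odot> idn M N)"
      by (simp add: act_tob)
    also have "\<dots> = ?R"
      by (simp add: phi_ib)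
    finally show ?thesis .
  qed
qed (simp_all add: src_end_pi[OF IdV_EndV] trg_end_pi[OF IdV_EndV] src_hb trg_hb)

end

section \<open>Additive structure\<close>

context typed_category
begin

lemma pls_assoc_typed: "\<lbrakk>src C f = src C g; trg C f = trg C g; src C g = src C h; trg C g = trg C h\<rbrakk> \<Longrightarrow>
    (f \<oplus> g) \<oplus> h = f \<oplus> (g \<oplus> h)"
  by (rule pls_assoc[of "src C h" "trg C h"]) (simp_all add: hom_iff)

lemma pls_comm_typed: "\<lbrakk>src C f = src C g; trg C f = trg C g\<rbrakk> \<Longrightarrow> f \<oplus> g = g \<oplus> f"
  by (rule pls_comm[of "src C g" "trg C g"]) (simp_all add: hom_iff)

lemma pls_swap_typed: "\<lbrakk>src C a = src C d; trg C a = trg C d; src C b = src C d; trg C b = trg C d;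
    src C c = src C d; trg C c = trg C d\<rbrakk> \<Longrightarrow> (a \<oplus> b) \<oplus> (c \<oplus> d) = (a \<oplus> c) \<oplus> (b \<oplus> d)"
  by (metis pls_assoc_typed pls_comm_typed src_pls trg_pls)

lemma zer_pls_typed [simp]: "\<lbrakk>src C f = X; trg C f = Y\<rbrakk> \<Longrightarrow> zer C X Y \<oplus> f = f"
  by (rule zer_pls[of X Y]) (simp_all add: hom_iff)

lemma pls_zer_typed [simp]: "\<lbrakk>src C f = X; trg C f = Y\<rbrakk> \<Longrightarrow> f \<oplus> zer C X Y = f"
  using pls_comm_typed[of f "zer C X Y"] by simp

lemma scl_1 [simp]: "scl C 1 f = f"
  by (rule scl_one[of "src C f" "trg C f"]) (simp_all add: hom_iff)

lemma scl_scl: "scl C a (scl C b f) = scl C (a * b) f"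
  by (rule scl_mult[symmetric, of "src C f" "trg C f"]) (simp_all add: hom_iff)

lemma scl_plus: "scl C (a + b) f = scl C a f \<oplus> scl C b f"
  by (rule scl_add[of "src C f" "trg C f"]) (simp_all add: hom_iff)

lemma scl_pls_typed: "\<lbrakk>src C f = src C g; trg C f = trg C g\<rbrakk> \<Longrightarrow> scl C a (f \<oplus> g) = scl C a f \<oplus> scl C a g"
  by (rule scl_pls[of "src C g" "trg C g"]) (simp_all add: hom_iff)

lemma scl_zer [simp]: "scl C a (zer C X Y) = zer C X Y"
  using scl_scl[of a 0 "zer C X Y"] by (simp add: scl_0)

lemma pls_cmp: "\<lbrakk>src C g = src C h; trg C g = trg C h; trg C f = src C h\<rbrakk> \<Longrightarrow> (g \<oplus> h) \<cdot> f = g \<cdot> f \<oplus> h \<cdot> f"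
  by (rule cmp_pls_left[of "src C f" "src C h" "trg C h"]) (simp_all add: hom_iff)

lemma cmp_pls: "\<lbrakk>src C f = src C g; trg C f = trg C g; trg C g = src C h\<rbrakk> \<Longrightarrow> h \<cdot> (f \<oplus> g) = h \<cdot> f \<oplus> h \<cdot> g"
  by (rule cmp_pls_right[of "src C g" "trg C g" "trg C h"]) (simp_all add: hom_iff)

text \<open>The record carries no negation; the scalar \<open>-1\<close> supplies
  differences.\<close>

definition mns :: "'a \<Rightarrow> 'a \<Rightarrow> 'a" where
  "mns f g = f \<oplus> scl C (- 1) g"

lemma src_mns [simp]: "\<lbrakk>src C f = src C g; trg C f = trg C g\<rbrakk> \<Longrightarrow> src C (mns f g) = src C g"
  and trg_mns [simp]: "\<lbrakk>src C f = src C g; trg C f = trg C g\<rbrakk> \<Longrightarrow> trg C (mns f g) = trg C g"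
  by (simp_all add: mns_def)

lemma mns_self: "mns f f = zer C (src C f) (trg C f)"
  using scl_plus[of 1 "-1" f] by (simp add: mns_def scl_0)

lemma mns_pls: "\<lbrakk>src C f = src C g; trg C f = trg C g\<rbrakk> \<Longrightarrow> mns f g \<oplus> g = f"
  using pls_assoc_typed[of f "scl C (-1) g" g] scl_plus[of "-1" 1 g, symmetric] by (simp add: mns_def scl_0)

lemma mns_eq_zer: "\<lbrakk>src C f = src C g; trg C f = trg C g; mns f g = zer C (src C g) (trg C g)\<rbrakk> \<Longrightarrow> f = g"
  using mns_pls[of f g] by simp

lemma mns_cmp: "\<lbrakk>src C g = src C h; trg C g = trg C h; trg C f = src C h\<rbrakk> \<Longrightarrow> mns g h \<cdot> f = mns (g \<cdot> f) (h \<cdot> f)"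
  by (simp add: mns_def pls_cmp scl_cmp)

lemma cmp_mns: "\<lbrakk>src C f = src C g; trg C f = trg C g; trg C g = src C h\<rbrakk> \<Longrightarrow> h \<cdot> mns f g = mns (h \<cdot> f) (h \<cdot> g)"
  by (simp add: mns_def cmp_pls cmp_scl)

lemma is_mono_iff: "is_mono C X Y f \<longleftrightarrow> src C f = X \<and> trg C f = Y \<and>
    (\<forall>g h. trg C g = X \<longrightarrow> trg C h = X \<longrightarrow> src C g = src C h \<longrightarrow> f \<cdot> g = f \<cdot> h \<longrightarrow> g = h)"
  unfolding is_mono_def by (auto simp: hom_iff)

lemma is_epi_iff: "is_epi C X Y f \<longleftrightarrow> src C f = X \<and> trg C f = Y \<and>
    (\<forall>g h. src C g = Y \<longrightarrow> src C h = Y \<longrightarrow> trg C g = trg C h \<longrightarrow> g \<cdot> f = h \<cdot> f \<longrightarrow> g = h)"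
  unfolding is_epi_def by (auto simp: hom_iff)

lemma is_kernelD:
  assumes "is_kernel C K X Y k f"
  shows "src C k = K" "trg C k = X" "f \<cdot> k = zer C K Y"
    and "\<lbrakk>trg C g = X; f \<cdot> g = zer C (src C g) Y\<rbrakk> \<Longrightarrow> \<exists>u. src C u = src C g \<and> trg C u = K \<and> k \<cdot> u = g"
proof -
  show "src C k = K" "trg C k = X" "f \<cdot> k = zer C K Y" using assms by (auto simp: is_kernel_def hom_iff)
  assume "trg C g = X" "f \<cdot> g = zer C (src C g) Y"
  then have "\<exists>!u. u \<in> hom C (src C g) K \<and> k \<cdot> u = g"
    using assms by (simp add: is_kernel_def hom_iff)
  then show "\<exists>u. src C u = src C g \<and> trg C u = K \<and> k \<cdot> u = g" unfolding hom_iff by blast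
qed

lemma is_kernel_mono:
  assumes k: "is_kernel C K X Y k f" and f: "src C f = X" "trg C f = Y"
  shows "is_mono C K X k"
proof -
  note [simp] = is_kernelD(1-3)[OF k] f
  have "g = h" if gh: "trg C g = K" "trg C h = K" "src C g = src C h" "k \<cdot> g = k \<cdot> h" for g h
  proof -
    have "f \<cdot> (k \<cdot> h) = (f \<cdot> k) \<cdot> h" by (rule cmp_assoc_typed[symmetric]) (simp_all add: gh)
    then have "f \<cdot> (k \<cdot> h) = zer C (src C h) Y" using gh by (simp del: cmp_assoc_typed)
    then have "\<exists>!u. u \<in> hom C (src C h) K \<and> k \<cdot> u = k \<cdot> h"
      using k gh by (simp add: is_kernel_def hom_iff)
    then show ?thesis using gh unfolding hom_iff by blast
  qed
  then show ?thesis by (simp add: is_mono_iff)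
qed

lemma is_cokernelD:
  assumes "is_cokernel C X Y Q f q"
  shows "src C q = Y" "trg C q = Q" "q \<cdot> f = zer C X Q"
    and "\<lbrakk>src C g = Y; g \<cdot> f = zer C X (trg C g)\<rbrakk> \<Longrightarrow> \<exists>u. src C u = Q \<and> trg C u = trg C g \<and> u \<cdot> q = g"
proof -
  show "src C q = Y" "trg C q = Q" "q \<cdot> f = zer C X Q" using assms by (auto simp: is_cokernel_def hom_iff)
  assume "src C g = Y" "g \<cdot> f = zer C X (trg C g)"
  then have "\<exists>!u. u \<in> hom C Q (trg C g) \<and> u \<cdot> q = g"
    using assms by (simp add: is_cokernel_def hom_iff)
  then show "\<exists>u. src C u = Q \<and> trg C u = trg C g \<and> u \<cdot> q = g" unfolding hom_iff by blast
qed

lemma is_cokernel_epi: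
  assumes q: "is_cokernel C X Y Q f q" and f: "src C f = X" "trg C f = Y"
  shows "is_epi C Y Q q"
proof -
  note [simp] = is_cokernelD(1-3)[OF q] f
  have "g = h" if gh: "src C g = Q" "src C h = Q" "trg C g = trg C h" "g \<cdot> q = h \<cdot> q" for g h
  proof -
    have "(h \<cdot> q) \<cdot> f = zer C X (trg C h)" by (simp add: gh(1-3))
    then have "\<exists>!u. u \<in> hom C Q (trg C h) \<and> u \<cdot> q = h \<cdot> q"
      using q gh by (simp add: is_cokernel_def hom_iff)
    then show ?thesis using gh unfolding hom_iff by blast
  qed
  then show ?thesis by (simp add: is_epi_iff)
qed

lemma zero_object_iff: "zero_object C X \<longleftrightarrow> idn C X = zer C X X"
  by (simp add: zero_object_def)

lemma zero_objectD: "zero_object C X \<Longrightarrow> src C f = X \<Longrightarrow> f = zer C X (trg C f)"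
  using cmp_idn[of f X] cmp_zer[of f X X] by (simp add: zero_object_iff del: cmp_idn)

end

section \<open>Endomorphisms of simple objects\<close>

context typed_category
begin

lemma lincomb_types:
  assumes "\<And>i. i < n \<Longrightarrow> src C (b i) = X" "\<And>i. i < n \<Longrightarrow> trg C (b i) = Y"
  shows "src C (lincomb C X Y n a b) = X" "trg C (lincomb C X Y n a b) = Y"
  using assms by (induction n) simp_all

lemma lincomb_add:
  assumes "\<And>i. i < n \<Longrightarrow> src C (b i) = X" "\<And>i. i < n \<Longrightarrow> trg C (b i) = Y"
  shows "lincomb C X Y n (\<lambda>i. a i + a' i) b = lincomb C X Y n a b \<oplus> lincomb C X Y n a' b"
  using assms
proof (induction n)
  case (Suc n)
  note t = lincomb_types[of n b X Y, OF Suc.prems(1) Suc.prems(2)]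
  show ?case
    using Suc by (simp add: scl_plus) (rule pls_swap_typed, simp_all add: t)
qed simp

lemma lincomb_scl:
  assumes "\<And>i. i < n \<Longrightarrow> src C (b i) = X" "\<And>i. i < n \<Longrightarrow> trg C (b i) = Y"
  shows "lincomb C X Y n (\<lambda>i. c * a i) b = scl C c (lincomb C X Y n a b)"
  using assms
proof (induction n)
  case (Suc n)
  note t = lincomb_types[of n b X Y, OF Suc.prems(1) Suc.prems(2)]
  show ?case
    using Suc by (simp add: t scl_pls_typed scl_scl)
qed simp

lemma lincomb_zero: "lincomb C X Y n (\<lambda>i. 0) b = zer C X Y"
  if "\<And>i. i < n \<Longrightarrow> src C (b i) = X" "\<And>i. i < n \<Longrightarrow> trg C (b i) = Y"
  using that by (induction n) (simp_all add: scl_0)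

text \<open>Horner scheme for the polynomial \<open>p\<close> evaluated at the endomorphism
  \<open>f\<close>.\<close>

definition pev :: "'a \<Rightarrow> 'k poly \<Rightarrow> 'a" where
  "pev f p = fold_coeffs (\<lambda>c g. scl C c (idn C (src C f)) \<oplus> f \<cdot> g) p (zer C (src C f) (src C f))"

context
  fixes f X assumes f [simp]: "src C f = X" "trg C f = X"
begin

lemma pev_0 [simp]: "pev f 0 = zer C X X"
  by (simp add: pev_def)

lemma src_pev [simp]: "src C (pev f p) = X" and trg_pev [simp]: "trg C (pev f p) = X"
proof -
  have "src C (foldr (\<lambda>c g. scl C c (idn C X) \<oplus> f \<cdot> g) cs (zer C X X)) = X \<and>
      trg C (foldr (\<lambda>c g. scl C c (idn C X) \<oplus> f \<cdot> g) cs (zer C X X)) = X" for cs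
    by (induction cs) simp_all
  then show "src C (pev f p) = X" "trg C (pev f p) = X" by (simp_all add: pev_def fold_coeffs_def)
qed

lemma pev_pCons: "pev f (pCons c p) = scl C c (idn C X) \<oplus> f \<cdot> pev f p"
\<comment> \<open>\<open>pCons 0 0\<close> is the zero polynomial with empty coefficient list, where
  the fold takes no step.\<close>
proof (cases "c = 0 \<and> p = 0")
  case False
  then show ?thesis by (auto simp: pev_def)
qed (simp add: scl_0)

lemma pev_add: "pev f (p + q) = pev f p \<oplus> pev f q"
proof (induction p arbitrary: q)
  case (pCons c p)
  obtain d q' where q: "q = pCons d q'" by (cases q)
  have "pev f (pCons c p + q) = (scl C c (idn C X) \<oplus> scl C d (idn C X)) \<oplus> (f \<cdot> pev f p \<oplus> f \<cdot> pev f q')"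
    by (simp add: q pev_pCons pCons scl_plus cmp_pls)
  also have "\<dots> = pev f (pCons c p) \<oplus> pev f q"
    unfolding q pev_pCons by (rule pls_swap_typed) simp_all
  finally show ?case .
qed simp

lemma pev_smult: "pev f (smult c p) = scl C c (pev f p)"
  by (induction p) (simp_all add: pev_pCons scl_scl cmp_scl scl_pls_typed)

lemma pev_linear_factor: "pev f ([:- c, 1:] * q) = mns f (scl C c (idn C X)) \<cdot> pev f q"
proof -
  have "[:- c, 1:] * q = pCons 0 q + smult (- c) q" by simp
  then have "pev f ([:- c, 1:] * q) = pev f (pCons 0 q) \<oplus> pev f (smult (- c) q)" by (metis pev_add)
  then show ?thesis
    unfolding pev_smult by (simp add: pev_pCons mns_def pls_cmp scl_cmp scl_scl scl_0 del: mult_pCons_left)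
qed

text \<open>A linear functional on a space of polynomials of unbounded degree has a kernel of unbounded
  degree; hence finitely many functionals have a common nonzero zero.\<close>

lemma exists_annihilating_poly:
  assumes "has_hom_dim C X X n"
  shows "\<exists>p. p \<noteq> 0 \<and> pev f p = zer C X X"
proof -
  obtain b where b0: "\<forall>i<n. b i \<in> hom C X X"
    and un0: "\<forall>g\<in>hom C X X. \<exists>!a. (\<forall>i\<ge>n. a i = 0) \<and> lincomb C X X n a b = g"
    using assms unfolding has_hom_dim_def by (elim exE conjE)
  have b: "\<And>i. i < n \<Longrightarrow> src C (b i) = X" "\<And>i. i < n \<Longrightarrow> trg C (b i) = X"
    using b0 by (simp_all add: hom_iff)
  have un: "\<exists>!a. (\<forall>i\<ge>n. a i = 0) \<and> lincomb C X X n a b = g" if "src C g = X" "trg C g = X" for g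
    using un0 that by (simp add: hom_iff)
  \<comment> \<open>The coordinates of \<open>pev f p\<close> in the basis. They vanish from index
    \<open>n\<close> on, so \<open>n\<close> conditions detect whether \<open>pev f p\<close> is
    zero.\<close>
  define co where "co p = (THE a. (\<forall>i\<ge>n. a i = 0) \<and> lincomb C X X n a b = pev f p)" for p
  have co: "\<forall>i\<ge>n. co p i = 0" "lincomb C X X n (co p) b = pev f p" for p
    using theI'[OF un[of "pev f p"]] by (simp_all add: co_def)
  have co_eq: "a = co p" if "\<forall>i\<ge>n. a i = 0" "lincomb C X X n a b = pev f p" for a p
    using un[of "pev f p"] that co by auto
  have co_add: "co (p + q) = (\<lambda>i. co p i + co q i)" for p q
    using co b by (intro co_eq[symmetric]) (simp_all add: lincomb_add pev_add)
  have co_smult: "co (smult c p) = (\<lambda>i. c * co p i)" for c p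
    using co b by (intro co_eq[symmetric]) (simp_all add: lincomb_scl pev_smult)
  \<comment> \<open>The bound \<open>d\<close> is arbitrary so that the induction hypothesis also
    yields a second polynomial of larger degree than the first.\<close>
  have "\<exists>p. degree p > d \<and> (\<forall>i<m. co p i = 0)" for m d
  proof (induction m arbitrary: d)
    case 0
    show ?case by (intro exI[of _ "monom 1 (Suc d)"]) (simp add: degree_monom_eq)
  next
    case (Suc m)
    obtain p where p: "degree p > d" "\<forall>i<m. co p i = 0" using Suc by blast
    obtain q where q: "degree q > degree p" "\<forall>i<m. co q i = 0" using Suc by blast
    show ?case
    proof (cases "co p m = 0")
      case True
      then show ?thesis using p by (intro exI[of _ p]) (auto simp: less_Suc_eq)
    next
      case False
      \<comment> \<open>This factor cancels coordinate \<open>m\<close>; since \<open>q\<close> has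
        the larger degree, the combination keeps the degree of \<open>q\<close>.\<close>
      define c where "c = - (co q m / co p m)"
      let ?r = "q + smult c p"
      have "degree ?r = degree q" using q(1) by (intro degree_add_eq_left) (auto intro: le_less_trans[OF degree_smult_le])
      moreover have "co ?r i = 0" if "i < Suc m" for i
      proof -
        have "co ?r i = co q i + c * co p i" by (simp add: co_add co_smult)
        then show ?thesis using that p(2) q(2) False by (auto simp: c_def less_Suc_eq)
      qed
      ultimately show ?thesis using p(1) q(1) by (intro exI[of _ ?r]) auto
    qed
  qed
  then obtain p where p: "degree p > 0" "\<forall>i<n. co p i = 0" by blast
  then have "co p = (\<lambda>i. 0)" using co(1)[of p] by (auto simp: fun_eq_iff) (metis not_le)
  then have "pev f p = zer C X X" using co(2)[of p] lincomb_zero[of n b X X] b by simp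
  then show ?thesis using p(1) by (intro exI[of _ p]) auto
qed

end

end

text \<open>If every \<open>f - c\<close> were invertible, the linear factors of an annihilating
  polynomial could be cancelled one by one until a nonzero constant annihilated the identity. The
  existence of roots is a hypothesis because the scalars here form a general field.\<close>

lemma (in typed_category) exists_eigenvalue:
  fixes f :: 'a
  assumes ac: "\<And>p :: 'k poly. degree p > 0 \<Longrightarrow> \<exists>z. poly p z = 0"
    and f: "src C f = X" "trg C f = X" and p: "p \<noteq> 0" "pev f p = zer C X X" and X: "\<not> zero_object C X"
  shows "\<exists>c. \<not> is_iso C X X (mns f (scl C c (idn C X)))"
  using p
proof (induction "degree p" arbitrary: p rule: less_induct)
  case less
  show ?case
  proof (cases "degree p = 0")
    case True
    then obtain c where c: "p = [:c:]" by (auto elim: degree_eq_zeroE)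
    then have "scl C c (idn C X) = zer C X X" "c \<noteq> 0"
      using less.prems f by (auto simp: pev_pCons)
    then have "scl C (inverse c) (scl C c (idn C X)) = zer C X X" by simp
    then show ?thesis using \<open>c \<noteq> 0\<close> X by (simp add: scl_scl zero_object_iff)
  next
    case False
    then obtain c where "poly p c = 0" using ac by auto
    then obtain q where q: "p = [:- c, 1:] * q" by (auto simp: poly_eq_0_iff_dvd elim: dvdE)
    then have q0: "q \<noteq> 0" using less.prems by auto
    have dq: "degree q < degree p" using q q0 by (simp add: degree_mult_eq del: mult_pCons_left)
    show ?thesis
    proof (cases "is_iso C X X (mns f (scl C c (idn C X)))")
      case iso: True
      have "mns f (scl C c (idn C X)) \<cdot> pev f q = mns f (scl C c (idn C X)) \<cdot> zer C X X"
        using less.prems(2) f unfolding q by (simp add: pev_linear_factor del: mult_pCons_left)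
      then have "pev f q = zer C X X"
        by (rule cmp_left_cancel_iso[OF iso, rotated -1]) (simp_all add: f)
      then show ?thesis using less.hyps[OF dq q0] by blast
    qed blast
  qed
qed

locale typed_finite_category = finite_category C + typed_category C
  for C :: "('k::field, 'o, 'a, 'z) lincat_scheme" (structure)
begin

text \<open>Schur's lemma. The kernel of \<open>f\<close> is a subobject of \<open>S\<close>: if it
  is everything, \<open>f\<close> vanishes; if it is zero, \<open>f\<close> is mono and simplicity
  makes it invertible.\<close>

lemma simple_endo_zero:
  assumes S: "simple_object C S" and f: "src C f = S" "trg C f = S" and ni: "\<not> is_iso C S S f"
  shows "f = zer C S S"
proof -
  obtain K k where k: "is_kernel C K S S k f" using has_kernels[of S S f] f by (auto simp: hom_iff)
  note [simp] = f is_kernelD(1-3)[OF k]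
  have "zero_object C K \<or> is_iso C K S k"
    using S is_kernel_mono[OF k f] by (simp add: simple_object_def)
  then show ?thesis
  proof
    assume iso: "is_iso C K S k"
    have "f \<cdot> k = zer C S S \<cdot> k" by simp
    then show ?thesis by (rule cmp_right_cancel_iso[OF iso, rotated -1]) simp_all
  next
    assume K: "zero_object C K"
    have "is_mono C S S f"
      unfolding is_mono_iff
    proof (intro conjI allI impI)
      fix g h assume gh [simp]: "trg C g = S" "trg C h = S" "src C g = src C h" and eq: "f \<cdot> g = f \<cdot> h"
      have "f \<cdot> mns g h = zer C (src C h) S"
        using eq by (simp add: cmp_mns mns_self)
      then obtain u where u: "src C u = src C h" "trg C u = K" "k \<cdot> u = mns g h"
        using is_kernelD(4)[OF k, of "mns g h"] by auto
      have "mns g h = zer C (src C h) S"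
        using zero_objectD[OF K, of k] u(1,2) unfolding u(3)[symmetric] by simp
      then have "mns g h = zer C (src C h) (trg C h)" by simp
      then show "g = h" by (rule mns_eq_zer[rotated 2]) simp_all
    qed simp_all
    then show ?thesis using S ni by (auto simp: simple_object_def)
  qed
qed

lemma simple_endo_scalar:
  assumes ac: "\<And>p :: 'k poly. degree p > 0 \<Longrightarrow> \<exists>z. poly p z = 0"
    and S: "simple_object C S" and f [simp]: "src C f = S" "trg C f = S"
  shows "\<exists>c. f = scl C c (idn C S)"
proof -
  obtain n where "has_hom_dim C S S n" using finite_homs[of S S] by auto
  then obtain p where p: "p \<noteq> 0" "pev f p = zer C S S" using exists_annihilating_poly[OF f] by blast
  have "\<not> zero_object C S" using S by (simp add: simple_object_def)
  then obtain c where "\<not> is_iso C S S (mns f (scl C c (idn C S)))"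
    using exists_eigenvalue[OF ac f p] by blast
  then have "mns f (scl C c (idn C S)) = zer C S S"
    by (intro simple_endo_zero[OF S]) simp_all
  then have "mns f (scl C c (idn C S)) = zer C (src C (scl C c (idn C S))) (trg C (scl C c (idn C S)))" by simp
  then have "f = scl C c (idn C S)" by (rule mns_eq_zer[rotated 2]) simp_all
  then show ?thesis by blast
qed

end

section \<open>Module endomorphisms of the identity functor\<close>

text \<open>Full subcategories are formed by shrinking the object set alone, which keeps the types
  of the category.\<close>

lemma (in linear_category) linear_category_restrict:
  assumes "S \<subseteq> obj C" shows "linear_category (C\<lparr>obj := S\<rparr>)"
proof -
  note S = subsetD[OF assms]
  show ?thesis
    by (unfold_locales; simp; (rule idn_in cmp_in cmp_assoc idn_left idn_right zer_in pls_in scl_in pls_assoc pls_comm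
      zer_pls scl_zero scl_one scl_mult scl_add scl_pls cmp_pls_left cmp_pls_right cmp_scl_left cmp_scl_right;
      (assumption | erule S)))
qed

lemma (in typed_category) is_monoD:
  "\<lbrakk>is_mono C X Y f; f \<cdot> g = f \<cdot> h; trg C g = X; trg C h = X; src C g = src C h\<rbrakk> \<Longrightarrow> g = h"
  unfolding is_mono_iff by blast

lemma (in typed_category) is_epiD:
  "\<lbrakk>is_epi C X Y f; g \<cdot> f = h \<cdot> f; src C g = Y; src C h = Y; trg C g = trg C h\<rbrakk> \<Longrightarrow> g = h"
  unfolding is_epi_iff by blast

lemma lincomb_restrict [simp]: "lincomb (C\<lparr>obj := S\<rparr>) X Y n a b = lincomb C X Y n a b"
  by (induction n) simp_all

context typed_module_category
begin

sublocale M: typed_finite_category M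
  by unfold_locales

text \<open>Endomorphisms of the identity as a module functor; with identity constraints the module
  condition is the last equation.\<close>

definition mod_end :: "('o \<Rightarrow> 'a) \<Rightarrow> bool" where
  "mod_end \<phi> \<longleftrightarrow> (\<forall>N. src M (\<phi> N) = N \<and> trg M (\<phi> N) = N) \<and>
     (\<forall>f. \<phi> (trg M f) \<bullet> f = f \<bullet> \<phi> (src M f)) \<and>
     (\<forall>X N. \<phi> (X \<ast> N) = idn C X \<odot> \<phi> N)"

lemma mod_endD:
  assumes "mod_end \<phi>"
  shows "src M (\<phi> N) = N" "trg M (\<phi> N) = N"
    and "\<lbrakk>src M f = N; trg M f = K\<rbrakk> \<Longrightarrow> \<phi> K \<bullet> f = f \<bullet> \<phi> N"
    and "\<phi> (X \<ast> N) = idn C X \<odot> \<phi> N"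
  using assms by (auto simp: mod_end_def)

lemma mod_end_idn: "mod_end (idn M)"
  by (simp add: mod_end_def)

lemma mod_end_cmp: "mod_end \<phi> \<Longrightarrow> mod_end \<psi> \<Longrightarrow> mod_end (\<lambda>N. \<phi> N \<bullet> \<psi> N)"
proof -
  assume \<phi>: "mod_end \<phi>" and \<psi>: "mod_end \<psi>"
  note [simp] = mod_endD(1,2)[OF \<phi>] mod_endD(1,2)[OF \<psi>]
  have "\<phi> (trg M f) \<bullet> f \<bullet> \<psi> (src M f) = f \<bullet> \<phi> (src M f) \<bullet> \<psi> (src M f)" for f
    using mod_endD(3)[OF \<phi>, of f] by (simp flip: M.cmp_assoc_typed)
  then show ?thesis
    using mod_endD(4)[OF \<phi>] mod_endD(4)[OF \<psi>] by (simp add: mod_end_def mod_endD(3)[OF \<psi>] act_cmp)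
qed

lemma aar_pls: "\<lbrakk>src M g = src M g'; trg M g = trg M g'\<rbrakk> \<Longrightarrow> f \<odot> (g \<oplus>\<^bsub>M\<^esub> g') = (f \<odot> g) \<oplus>\<^bsub>M\<^esub> (f \<odot> g')"
  by (rule aar_pls_right[of "src C f" "trg C f" "src M g'" "trg M g'"]) (simp_all add: hom_iff M.hom_iff)

lemma aar_scl: "f \<odot> scl M a g = scl M a (f \<odot> g)"
  by (rule aar_scl_right[of "src C f" "trg C f" "src M g" "trg M g"]) (simp_all add: hom_iff M.hom_iff)

lemma mod_end_scl: "mod_end \<phi> \<Longrightarrow> mod_end (\<lambda>N. scl M a (\<phi> N))"
  by (simp add: mod_end_def M.scl_cmp M.cmp_scl aar_scl)

lemma mod_end_mns: "mod_end \<phi> \<Longrightarrow> mod_end \<psi> \<Longrightarrow> mod_end (\<lambda>N. M.mns (\<phi> N) (\<psi> N))"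
  by (simp add: mod_end_def M.mns_cmp M.cmp_mns) (simp add: M.mns_def aar_pls aar_scl)

end

subsection \<open>The decomposition defined by an idempotent\<close>

locale idempotent_endo = typed_module_category C M
  for C :: "('k::field, 'c, 'e, 'z) moncat_scheme" (structure)
    and M :: "('k, 'c, 'e, 'o, 'a) modcat" +
  fixes e :: "'o \<Rightarrow> 'a"
  assumes e_mod: "mod_end e" and idem: "e N \<bullet> e N = e N"
begin

lemma src_e [simp]: "src M (e N) = N" and trg_e [simp]: "trg M (e N) = N" and e_idem [simp]: "e N \<bullet> e N = e N"
  using mod_endD(1,2)[OF e_mod] idem by simp_all

lemma e_nat: "\<lbrakk>src M f = N; trg M f = K\<rbrakk> \<Longrightarrow> e K \<bullet> f = f \<bullet> e N"
  by (rule mod_endD(3)[OF e_mod])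

lemma e_act: "e (X \<ast> N) = idn C X \<odot> e N"
  by (rule mod_endD(4)[OF e_mod])

text \<open>The image of \<open>e\<close>, taken as the full subcategory on which \<open>e\<close>
  is the identity.\<close>

abbreviation Fix :: "'o set" where
  "Fix \<equiv> {N. e N = idn M N}"

abbreviation MF :: "('k, 'c, 'e, 'o, 'a) modcat" where
  "MF \<equiv> M\<lparr>obj := Fix\<rparr>"

text \<open>In an abelian category an idempotent splits through the kernel of \<open>1 - e\<close>;
  naturality of \<open>e\<close> along the inclusion puts that kernel into
  \<open>Fix\<close>.\<close>

lemma split_exists: "\<exists>K i p. e K = idn M K \<and> src M i = K \<and> trg M i = N \<and> src M p = N \<and> trg M p = K \<and>
    p \<bullet> i = idn M K \<and> i \<bullet> p = e N"
proof -
  let ?g = "M.mns (idn M N) (e N)"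
  have "?g \<in> hom M N N" by (simp add: M.hom_iff)
  then obtain K i where i: "is_kernel M K N N i ?g" using M.has_kernels by (metis M.obj_UNIV)
  note [simp] = M.is_kernelD(1,2)[OF i]
  have "M.mns i (e N \<bullet> i) = zer M K N"
    using M.is_kernelD(3)[OF i] by (simp add: M.mns_cmp)
  then have "i = e N \<bullet> i" by (intro M.mns_eq_zer[of i "e N \<bullet> i"]) simp_all
  then have ei: "e N \<bullet> i = i" by simp
  have "?g \<bullet> e N = zer M N N" by (simp add: M.mns_cmp M.mns_self)
  then obtain p where p [simp]: "src M p = N" "trg M p = K" "i \<bullet> p = e N"
    using M.is_kernelD(4)[OF i, of "e N"] by auto
  have mono: "g = h" if "trg M g = K" "trg M h = K" "src M g = src M h" "i \<bullet> g = i \<bullet> h" for g h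
    using M.is_kernel_mono[OF i] that by (simp add: M.is_mono_iff)
  have "i \<bullet> (p \<bullet> i) = (i \<bullet> p) \<bullet> i" by (rule M.cmp_assoc_typed[symmetric]) simp_all
  then have "p \<bullet> i = idn M K" by (intro mono[of "p \<bullet> i"]) (simp_all add: ei)
  moreover have "e K = idn M K" using e_nat[of i K N] ei by (intro mono[of "e K"]) simp_all
  ultimately show ?thesis using p by (intro exI[of _ K] exI[of _ i] exI[of _ p]) simp
qed

definition "splitting N = (SOME t. case t of (K, i, p) \<Rightarrow> e K = idn M K \<and> src M i = K \<and> trg M i = N \<and> src M p = N \<and>
    trg M p = K \<and> p \<bullet> i = idn M K \<and> i \<bullet> p = e N)"

definition part :: "'o \<Rightarrow> 'o" where "part N = fst (splitting N)"
definition inc :: "'o \<Rightarrow> 'a" where "inc N = fst (snd (splitting N))"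
definition prj :: "'o \<Rightarrow> 'a" where "prj N = snd (snd (splitting N))"

lemma splitting: "e (part N) = idn M (part N) \<and> src M (inc N) = part N \<and> trg M (inc N) = N \<and> src M (prj N) = N \<and>
    trg M (prj N) = part N \<and> prj N \<bullet> inc N = idn M (part N) \<and> inc N \<bullet> prj N = e N"
proof -
  have "\<exists>t. case t of (K, i, p) \<Rightarrow> e K = idn M K \<and> src M i = K \<and> trg M i = N \<and> src M p = N \<and>
    trg M p = K \<and> p \<bullet> i = idn M K \<and> i \<bullet> p = e N"
    using split_exists[of N] by auto
  from someI_ex[OF this] show ?thesis
    unfolding part_def inc_def prj_def splitting_def[symmetric] by (auto simp: case_prod_beta)
qed

lemma e_part [simp]: "e (part N) = idn M (part N)"
  and src_inc [simp]: "src M (inc N) = part N" and trg_inc [simp]: "trg M (inc N) = N"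
  and src_prj [simp]: "src M (prj N) = N" and trg_prj [simp]: "trg M (prj N) = part N"
  and prj_inc [simp]: "prj N \<bullet> inc N = idn M (part N)" and inc_prj [simp]: "inc N \<bullet> prj N = e N"
  using splitting by simp_all

lemma prj_inc_assoc [simp]: "trg M h = part N \<Longrightarrow> prj N \<bullet> inc N \<bullet> h = h"
  and inc_prj_assoc: "trg M h = N \<Longrightarrow> inc N \<bullet> prj N \<bullet> h = e N \<bullet> h"
  by (simp_all flip: M.cmp_assoc_typed)

lemma e_inc [simp]: "e N \<bullet> inc N = inc N" and prj_e [simp]: "prj N \<bullet> e N = prj N"
  using e_nat[of "inc N" "part N" N] e_nat[of "prj N" N "part N"] by simp_all

lemma e_nat_assoc: "\<lbrakk>src M f = N; trg M f = K; trg M h = N\<rbrakk> \<Longrightarrow> e K \<bullet> f \<bullet> h = f \<bullet> e N \<bullet> h"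
  using e_nat[of f N K] by (simp flip: M.cmp_assoc_typed)

lemma prj_e_assoc [simp]: "trg M h = N \<Longrightarrow> prj N \<bullet> e N \<bullet> h = prj N \<bullet> h"
  by (simp flip: M.cmp_assoc_typed)

lemma Fix_left: "\<lbrakk>e (trg M f) = idn M (trg M f)\<rbrakk> \<Longrightarrow> f \<bullet> e (src M f) = f"
  using e_nat[of f "src M f" "trg M f"] by simp

lemma Fix_right: "\<lbrakk>e (src M f) = idn M (src M f)\<rbrakk> \<Longrightarrow> e (trg M f) \<bullet> f = f"
  using e_nat[of f "src M f" "trg M f"] by simp

text \<open>Naturality gives \<open>k \<bullet> e K = e X \<bullet> k = k\<close>, and
  \<open>k\<close> is mono. The dual argument treats quotients.\<close>

lemma kernel_Fix: "is_kernel M K X Y k f \<Longrightarrow> src M f = X \<Longrightarrow> trg M f = Y \<Longrightarrow> X \<in> Fix \<Longrightarrow> K \<in> Fix"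
proof -
  assume k: "is_kernel M K X Y k f" and f: "src M f = X" "trg M f = Y" and X: "X \<in> Fix"
  note [simp] = M.is_kernelD(1,2)[OF k]
  have "k \<bullet> e K = k \<bullet> idn M K" using X e_nat[of k K X] by simp
  then have "e K = idn M K"
    by (rule M.is_monoD[OF M.is_kernel_mono[OF k f]]) simp_all
  then show ?thesis by simp
qed

lemma epi_Fix: "is_epi M X Q q \<Longrightarrow> X \<in> Fix \<Longrightarrow> Q \<in> Fix"
proof -
  assume q: "is_epi M X Q q" and X: "X \<in> Fix"
  have [simp]: "src M q = X" "trg M q = Q" using q by (simp_all add: M.is_epi_iff)
  have "e Q \<bullet> q = idn M Q \<bullet> q" using X e_nat[of q X Q] by simp
  then have "e Q = idn M Q"
    by (rule M.is_epiD[OF q]) simp_all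
  then show ?thesis by simp
qed

lemma restrict_is_kernel: "is_kernel M K X Y k f \<Longrightarrow> K \<in> Fix \<Longrightarrow> is_kernel MF K X Y k f"
  by (simp add: is_kernel_def)

lemma restrict_is_cokernel: "is_cokernel M X Y Q f q \<Longrightarrow> Q \<in> Fix \<Longrightarrow> is_cokernel MF X Y Q f q"
  by (simp add: is_cokernel_def)

lemma restrict_zero_object [simp]: "zero_object MF X \<longleftrightarrow> X \<in> Fix \<and> zero_object M X"
  by (auto simp: zero_object_def)

lemma is_iso_MF [simp]: "is_iso MF = is_iso M"
  by (simp add: fun_eq_iff is_iso_def inverses_def)

text \<open>Test objects outside \<open>Fix\<close> can be replaced by their parts: an arrow into an
  object of \<open>Fix\<close> absorbs \<open>e\<close>, hence factors through
  \<open>prj\<close>.\<close>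

lemma restrict_is_mono: assumes X: "X \<in> Fix" shows "is_mono MF X Y f \<longleftrightarrow> is_mono M X Y f"
proof
  assume m: "is_mono MF X Y f"
  then have f [simp]: "src M f = X" "trg M f = Y" by (auto simp: is_mono_def M.hom_iff)
  have *: "g = h" if "e W = idn M W" "src M g = W" "trg M g = X" "src M h = W" "trg M h = X" "f \<bullet> g = f \<bullet> h" for W g h
    using m that unfolding is_mono_def by (simp add: M.hom_iff)
  show "is_mono M X Y f"
    unfolding M.is_mono_iff
  proof (intro conjI allI impI)
    fix g h assume gh [simp]: "trg M g = X" "trg M h = X" "src M g = src M h" and eq: "f \<bullet> g = f \<bullet> h"
    let ?W = "src M h"
    have "(f \<bullet> g) \<bullet> inc ?W = (f \<bullet> h) \<bullet> inc ?W" by (simp only: eq)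
    then have "g \<bullet> inc ?W = h \<bullet> inc ?W" by (intro *[of "part ?W" "g \<bullet> inc ?W" "h \<bullet> inc ?W"]) simp_all
    then have "(g \<bullet> inc ?W) \<bullet> prj ?W = (h \<bullet> inc ?W) \<bullet> prj ?W" by (simp only:)
    then have "g \<bullet> e ?W = h \<bullet> e ?W" by simp
    moreover have "g \<bullet> e ?W = g" using Fix_left[of g] X by simp
    moreover have "h \<bullet> e ?W = h" using Fix_left[of h] X by simp
    ultimately show "g = h" by metis
  qed simp_all
qed (simp add: is_mono_def)

lemma restrict_is_epi: assumes Y: "Y \<in> Fix" shows "is_epi MF X Y f \<longleftrightarrow> is_epi M X Y f"
proof
  assume m: "is_epi MF X Y f"
  then have f [simp]: "src M f = X" "trg M f = Y" by (auto simp: is_epi_def M.hom_iff)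
  have *: "g = h" if "e W = idn M W" "trg M g = W" "src M g = Y" "trg M h = W" "src M h = Y" "g \<bullet> f = h \<bullet> f" for W g h
    using m that unfolding is_epi_def by (simp add: M.hom_iff)
  show "is_epi M X Y f"
    unfolding M.is_epi_iff
  proof (intro conjI allI impI)
    fix g h assume gh [simp]: "src M g = Y" "src M h = Y" "trg M g = trg M h" and eq: "g \<bullet> f = h \<bullet> f"
    let ?W = "trg M h"
    have "prj ?W \<bullet> g = prj ?W \<bullet> h" using eq by (intro *[of "part ?W" "prj ?W \<bullet> g" "prj ?W \<bullet> h"]) simp_all
    then have "inc ?W \<bullet> prj ?W \<bullet> g = inc ?W \<bullet> prj ?W \<bullet> h" by (simp only:)
    then have "e ?W \<bullet> g = e ?W \<bullet> h" by (simp add: inc_prj_assoc)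
    moreover have "e ?W \<bullet> g = g" using Fix_right[of g] Y by simp
    moreover have "e ?W \<bullet> h = h" using Fix_right[of h] Y by simp
    ultimately show "g = h" by metis
  qed simp_all
qed (simp add: is_epi_def)

lemma restrict_simple_object: "S \<in> Fix \<Longrightarrow> simple_object MF S \<longleftrightarrow> simple_object M S"
proof -
  assume S: "S \<in> Fix"
  have "W \<in> Fix" if m: "is_mono M W S f" for W f
  proof -
    have [simp]: "src M f = W" "trg M f = S" using m by (simp_all add: M.is_mono_iff)
    have "f \<bullet> e W = f \<bullet> idn M W" using S e_nat[of f W S] by simp
    then have "e W = idn M W" by (rule M.is_monoD[OF m]) simp_all
    then show ?thesis by simp
  qed
  then show ?thesis
    using S by (simp add: simple_object_def restrict_is_mono Ball_def) blast
qed

lemma abelian_category_restrict: "abelian_category MF"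
proof -
  interpret L: linear_category MF by (rule M.linear_category_restrict) auto
  show ?thesis
  proof
    obtain Z where "zero_object M Z" using M.has_zero by blast
    then show "\<exists>Z. zero_object MF Z"
      using M.zero_objectD[of Z "e Z"] M.zero_objectD[of Z "idn M Z"] by (intro exI[of _ Z]) simp
  next
    fix X Y assume "X \<in> obj MF" "Y \<in> obj MF"
    then have XY [simp]: "e X = idn M X" "e Y = idn M Y" by simp_all
    have "X \<in> obj M" "Y \<in> obj M" by simp_all
    from M.has_biproducts[OF this] obtain S i j p q
      where ij: "i \<in> hom M X S" "j \<in> hom M Y S" "p \<in> hom M S X" "q \<in> hom M S Y"
        and pq: "p \<bullet> i = idn M X" "q \<bullet> j = idn M Y" "p \<bullet> j = zer M Y X" "q \<bullet> i = zer M X Y"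
        and s: "i \<bullet> p \<oplus>\<^bsub>M\<^esub> j \<bullet> q = idn M S" by blast
    note [simp] = ij[unfolded M.hom_iff]
    have "e S = e S \<bullet> (i \<bullet> p \<oplus>\<^bsub>M\<^esub> j \<bullet> q)" by (simp add: s)
    also have "\<dots> = i \<bullet> p \<oplus>\<^bsub>M\<^esub> j \<bullet> q"
      by (simp add: M.cmp_pls e_nat_assoc[of i X S] e_nat_assoc[of j Y S])
    finally have "S \<in> Fix" by (simp add: s)
    then show "\<exists>S\<in>obj MF. \<exists>i\<in>hom MF X S. \<exists>j\<in>hom MF Y S. \<exists>p\<in>hom MF S X. \<exists>q\<in>hom MF S Y.
        p \<cdot>\<^bsub>MF\<^esub> i = idn MF X \<and> q \<cdot>\<^bsub>MF\<^esub> j = idn MF Y \<and> p \<cdot>\<^bsub>MF\<^esub> j = zer MF Y X \<and> q \<cdot>\<^bsub>MF\<^esub> i = zer MF X Y \<and>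
        i \<cdot>\<^bsub>MF\<^esub> p \<oplus>\<^bsub>MF\<^esub> j \<cdot>\<^bsub>MF\<^esub> q = idn MF S"
      using ij pq s by (intro bexI[of _ S] bexI[of _ i] bexI[of _ j] bexI[of _ p] bexI[of _ q]) simp_all
  next
    fix X Y f assume X: "X \<in> obj MF" and f: "f \<in> hom MF X Y"
    obtain K k where k: "is_kernel M K X Y k f" using M.has_kernels[of X Y f] f by auto
    then show "\<exists>K k. is_kernel MF K X Y k f"
      using restrict_is_kernel[OF k] kernel_Fix[OF k] X f by (auto simp: M.hom_iff)
  next
    fix X Y f assume Y: "Y \<in> obj MF" and f: "f \<in> hom MF X Y"
    obtain Q q where q: "is_cokernel M X Y Q f q" using M.has_cokernels[of X Y f] f by auto
    have "is_epi M Y Q q" using M.is_cokernel_epi[OF q] f by (simp add: M.hom_iff)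
    then show "\<exists>Q q. is_cokernel MF X Y Q f q"
      using restrict_is_cokernel[OF q] epi_Fix[of Y Q q] Y by auto
  next
    fix X Y f assume X: "X \<in> obj MF" and Y: "Y \<in> obj MF" and "is_mono MF X Y f"
    then have "is_mono M X Y f" using restrict_is_mono by simp
    then obtain Z g where g: "g \<in> hom M Y Z" and k: "is_kernel M X Y Z f g"
      using M.mono_normal by (metis M.obj_UNIV)
    have XY [simp]: "e X = idn M X" "e Y = idn M Y" using X Y by simp_all
    have gt [simp]: "src M g = Y" "trg M g = Z" using g by (simp_all add: M.hom_iff)
    note [simp] = M.is_kernelD(1-3)[OF k]
    \<comment> \<open>The target \<open>Z\<close> may lie outside \<open>Fix\<close>. Projecting to
      \<open>part Z\<close> loses nothing, since \<open>g\<close> starts in \<open>Fix\<close> and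
      so satisfies \<open>e Z \<bullet> g = g\<close>.\<close>
    have "is_kernel MF X Y (part Z) f (prj Z \<bullet> g)"
      unfolding is_kernel_def
    proof (intro conjI ballI impI)
      fix W h assume h: "h \<in> hom MF W Y" and 0: "(prj Z \<bullet> g) \<cdot>\<^bsub>MF\<^esub> h = zer MF W (part Z)"
      have [simp]: "src M h = W" "trg M h = Y" using h by (simp_all add: M.hom_iff)
      have "inc Z \<bullet> (prj Z \<bullet> g) \<bullet> h = zer M W Z" using 0 by (simp del: M.cmp_assoc_typed)
      then have "g \<bullet> h = zer M W Z"
        by (simp add: inc_prj_assoc e_nat_assoc[of g Y Z])
      then show "\<exists>!u. u \<in> hom MF W X \<and> f \<cdot>\<^bsub>MF\<^esub> u = h"
        using k h unfolding is_kernel_def by simp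
    qed (use X in \<open>simp_all add: M.hom_iff\<close>)
    then show "\<exists>Z\<in>obj MF. \<exists>g\<in>hom MF Y Z. is_kernel MF X Y Z f g"
      by (intro bexI[of _ "part Z"] bexI[of _ "prj Z \<bullet> g"]) (simp_all add: M.hom_iff)
  next
    fix X Y f assume X: "X \<in> obj MF" and Y: "Y \<in> obj MF" and "is_epi MF X Y f"
    then have "is_epi M X Y f" using restrict_is_epi by simp
    then obtain Z g where g: "g \<in> hom M Z X" and k: "is_cokernel M Z X Y g f"
      using M.epi_normal by (metis M.obj_UNIV)
    have XY [simp]: "e X = idn M X" "e Y = idn M Y" using X Y by simp_all
    have gt [simp]: "src M g = Z" "trg M g = X" using g by (simp_all add: M.hom_iff)
    note [simp] = M.is_cokernelD(1,2)[OF k]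
    have fg: "f \<bullet> g \<bullet> inc Z = zer M (part Z) Y"
      using M.is_cokernelD(3)[OF k] by (simp flip: M.cmp_assoc_typed)
    have "is_cokernel MF (part Z) X Y (g \<bullet> inc Z) f"
      unfolding is_cokernel_def
    proof (intro conjI ballI impI)
      fix W h assume h: "h \<in> hom MF X W" and 0: "h \<cdot>\<^bsub>MF\<^esub> (g \<bullet> inc Z) = zer MF (part Z) W"
      have [simp]: "src M h = X" "trg M h = W" using h by (simp_all add: M.hom_iff)
      have "(h \<bullet> (g \<bullet> inc Z)) \<bullet> prj Z = zer M Z W" using 0 by (simp del: M.cmp_assoc_typed)
      then have "h \<bullet> g = zer M Z W"
        using e_nat[of g Z X] by simp
      then show "\<exists>!u. u \<in> hom MF Y W \<and> u \<cdot>\<^bsub>MF\<^esub> f = h"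
        using k h unfolding is_cokernel_def by simp
    qed (use Y fg in \<open>simp_all add: M.hom_iff\<close>)
    then show "\<exists>W\<in>obj MF. \<exists>g\<in>hom MF W X. is_cokernel MF W X Y g f"
      by (intro bexI[of _ "part Z"] bexI[of _ "g \<bullet> inc Z"]) (simp_all add: M.hom_iff)
  qed
qed

lemma finite_length_restrict: "finite_length M N \<Longrightarrow> N \<in> Fix \<Longrightarrow> finite_length MF N"
proof (induction rule: finite_length.induct)
  case (zero X)
  then show ?case by (intro finite_length.zero) simp
next
  case (step K X S p k)
  have p: "src M p = X" "trg M p = S" using step by (simp_all add: M.is_epi_iff)
  have K: "K \<in> Fix" using kernel_Fix[OF step.hyps(5) p step.prems] .
  have S: "S \<in> Fix" using epi_Fix[OF step.hyps(4) step.prems] .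
  show ?case
    by (rule finite_length.step[OF step.IH[OF K]])
      (use step K S p restrict_simple_object[OF S] restrict_is_epi[OF S] restrict_is_kernel[OF step.hyps(5) K] in simp_all)
qed

text \<open>\<open>part P\<close> is a retract of \<open>P\<close>: a lift is found for
  \<open>f \<bullet> prj P\<close> and restricted along \<open>inc P\<close>.\<close>

lemma projective_part:
  assumes P: "projective M P" shows "projective MF (part P)"
  unfolding projective_def
proof (intro conjI ballI allI impI)
  fix X Y q f assume X: "X \<in> obj MF" and Y: "Y \<in> obj MF" and *: "is_epi MF X Y q \<and> f \<in> hom MF (part P) Y"
  then have q: "is_epi M X Y q" and f: "src M f = part P" "trg M f = Y"
    using restrict_is_epi by (simp_all add: M.hom_iff)
  note [simp] = f
  have qt [simp]: "src M q = X" "trg M q = Y" using q by (simp_all add: M.is_epi_iff)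
  have "f \<bullet> prj P \<in> hom M P Y" by (simp add: M.hom_iff)
  then obtain g where g: "g \<in> hom M P X" "q \<bullet> g = f \<bullet> prj P"
    using P q unfolding projective_def by (metis M.obj_UNIV)
  have [simp]: "src M g = P" "trg M g = X" using g by (simp_all add: M.hom_iff)
  have "q \<bullet> (g \<bullet> inc P) = (q \<bullet> g) \<bullet> inc P" by simp
  also have "\<dots> = f" unfolding g(2) by simp
  finally show "\<exists>g\<in>hom MF (part P) X. q \<cdot>\<^bsub>MF\<^esub> g = f"
    by (intro bexI[of _ "g \<bullet> inc P"]) (simp_all add: M.hom_iff)
qed simp

lemma finite_category_restrict: "finite_category MF"
proof -
  interpret A: abelian_category MF by (rule abelian_category_restrict)
  show ?thesis
  proof
    fix X Y assume "X \<in> obj MF" "Y \<in> obj MF"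
    show "\<exists>n. has_hom_dim MF X Y n"
      using M.finite_homs[of X Y] by (simp add: has_hom_dim_def)
  next
    fix X assume "X \<in> obj MF"
    then show "finite_length MF X" using finite_length_restrict M.finite_lengths by simp
  next
    fix X assume X: "X \<in> obj MF"
    then have [simp]: "e X = idn M X" by simp
    obtain P p where P: "projective M P" and p: "is_epi M P X p" using M.enough_projectives[of X] by auto
    have pt [simp]: "src M p = P" "trg M p = X" using p by (simp_all add: M.is_epi_iff)
    \<comment> \<open>The restriction of \<open>p\<close> to \<open>part P\<close> remains epi
      because \<open>p\<close> ends in \<open>Fix\<close> and therefore absorbs
      \<open>e P\<close>.\<close>
    have "is_epi M (part P) X (p \<bullet> inc P)"
      unfolding M.is_epi_iff
    proof (intro conjI allI impI)
      fix g h assume gh [simp]: "src M g = X" "src M h = X" "trg M g = trg M h"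
        and eq: "g \<bullet> p \<bullet> inc P = h \<bullet> p \<bullet> inc P"
      have "(g \<bullet> p \<bullet> inc P) \<bullet> prj P = (h \<bullet> p \<bullet> inc P) \<bullet> prj P" by (simp only: eq)
      then have "g \<bullet> p = h \<bullet> p" using e_nat[of p P X] by simp
      then show "g = h" using p by (simp add: M.is_epi_iff)
    qed simp_all
    then show "\<exists>P p. projective MF P \<and> is_epi MF P X p"
      using projective_part[OF P] restrict_is_epi X by auto
  next
    obtain T where T: "finite T" "\<forall>S. simple_object M S \<longrightarrow> (\<exists>S'\<in>T. \<exists>f. is_iso M S S' f)"
      using M.finitely_many_simples by auto
    \<comment> \<open>Naturality of \<open>e\<close> along the isomorphism puts the representative
      itself into \<open>Fix\<close>.\<close>
    have "\<exists>S'\<in>T \<inter> Fix. \<exists>f. is_iso M S S' f" if S: "simple_object MF S" for S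
    proof -
      have SF: "S \<in> Fix" using S by (simp add: simple_object_def)
      then obtain S' f where f: "S' \<in> T" "is_iso M S S' f" using S T restrict_simple_object by blast
      have [simp]: "src M f = S" "trg M f = S'" using M.src_iso[OF f(2)] M.trg_iso[OF f(2)] by simp_all
      have "e S' \<bullet> f = idn M S' \<bullet> f" using SF e_nat[of f S S'] by simp
      then have "e S' = idn M S'" by (rule M.cmp_right_cancel_iso[OF f(2), rotated -1]) simp_all
      then show ?thesis using f by auto
    qed
    then show "\<exists>T. finite T \<and> T \<subseteq> obj MF \<and> (\<forall>S. simple_object MF S \<longrightarrow> (\<exists>S'\<in>T. \<exists>f. is_iso MF S S' f))"
      using T(1) by (intro exI[of _ "T \<inter> Fix"]) simp
  qed
qed

lemma module_category_restrict: "module_category C MF"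
proof -
  interpret A: finite_category MF by (rule finite_category_restrict)
  show ?thesis
    by (unfold_locales; simp; (simp add: e_act; fail | rule aar_in aar_cmp aar_pls_left aar_pls_right aar_scl_left aar_scl_right
      asc_natural lun_natural; simp; fail | simp add: asc_iso_typed lun_iso_typed pentagon_typed unit_triangle_typed; fail))
qed

text \<open>By \<open>e_act\<close> both \<open>part (X \<rhd> K)\<close> and
  \<open>X \<rhd> part K\<close> split the idempotent \<open>e (X \<rhd> K)\<close>; the constraint
  is the resulting comparison isomorphism.\<close>

lemma module_functor_restrict: "module_functor C M MF
    \<lparr>fob = part, far = (\<lambda>f. prj (trg M f) \<bullet> f \<bullet> inc (src M f))\<rparr>
    (\<lambda>X N. (idn C X \<odot> prj N) \<bullet> inc (X \<ast> N))" (is "module_functor C M MF ?F ?s")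
proof
  fix X Y f g assume "f \<in> hom M X Y" "g \<in> hom M X Y"
  then have [simp]: "src M f = X" "trg M f = Y" "src M g = X" "trg M g = Y" by (simp_all add: M.hom_iff)
  show "far ?F (f \<oplus>\<^bsub>M\<^esub> g) = far ?F f \<oplus>\<^bsub>MF\<^esub> far ?F g"
    by (simp add: M.pls_cmp M.cmp_pls)
next
  fix X Y Z f g assume "f \<in> hom M X Y" "g \<in> hom M Y Z"
  then have [simp]: "src M f = X" "trg M f = Y" "src M g = Y" "trg M g = Z" by (simp_all add: M.hom_iff)
  have "prj Z \<bullet> g \<bullet> inc Y \<bullet> prj Y \<bullet> f \<bullet> inc X = prj Z \<bullet> g \<bullet> f \<bullet> inc X"
    by (simp add: inc_prj_assoc e_nat_assoc[of f X Y])
  then show "far ?F (g \<bullet> f) = far ?F g \<cdot>\<^bsub>MF\<^esub> far ?F f" by simp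
next
  fix X K
  have 1: "prj (X \<ast> K) \<bullet> (idn C X \<odot> inc K) \<bullet> (idn C X \<odot> prj K) \<bullet> inc (X \<ast> K) =
      prj (X \<ast> K) \<bullet> e (X \<ast> K) \<bullet> inc (X \<ast> K)"
    unfolding e_act by (simp add: aar_cmp_typed_assoc)
  have 2: "(idn C X \<odot> prj K) \<bullet> inc (X \<ast> K) \<bullet> prj (X \<ast> K) \<bullet> (idn C X \<odot> inc K) = idn M (X \<ast> part K)"
    by (simp add: inc_prj_assoc e_act aar_cmp_typed aar_cmp_typed_assoc)
  have "is_iso M (part (X \<ast> K)) (X \<ast> part K) ((idn C X \<odot> prj K) \<bullet> inc (X \<ast> K))"
    by (rule M.is_isoI[of _ _ _ "prj (X \<ast> K) \<bullet> (idn C X \<odot> inc K)"]) (simp_all add: 1 2)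
  then show "is_iso MF (fob ?F (X \<ast> K)) (X \<rhd>\<^bsub>MF\<^esub> fob ?F K) ((idn C X \<odot> prj K) \<bullet> inc (X \<ast> K))"
    by simp
next
  fix X X' K K' f g assume "f \<in> hom C X X'" "g \<in> hom M K K'"
  then have [simp]: "src C f = X" "trg C f = X'" "src M g = K" "trg M g = K'" by (simp_all add: hom_iff M.hom_iff)
  have "(idn C X' \<odot> prj K') \<bullet> inc (X' \<ast> K') \<bullet> prj (X' \<ast> K') \<bullet> (f \<odot> g) \<bullet> inc (X \<ast> K) =
      (f \<odot> (prj K' \<bullet> g)) \<bullet> inc (X \<ast> K)"
    by (simp add: inc_prj_assoc e_act aar_cmp_typed_assoc)
  moreover have "(f \<odot> (prj K' \<bullet> g \<bullet> inc K)) \<bullet> (idn C X \<odot> prj K) \<bullet> inc (X \<ast> K) =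
      (f \<odot> (prj K' \<bullet> g)) \<bullet> inc (X \<ast> K)"
    using e_nat[of g K K', symmetric] by (simp add: aar_cmp_typed_assoc)
  ultimately show "((idn C X' \<odot> prj K') \<bullet> inc (X' \<ast> K')) \<cdot>\<^bsub>MF\<^esub> far ?F (f \<odot> g) =
      (f \<unrhd>\<^bsub>MF\<^esub> far ?F g) \<cdot>\<^bsub>MF\<^esub> (idn C X \<odot> prj K) \<bullet> inc (X \<ast> K)"
    by simp
next
  fix X Y K
  let ?YK = "Y \<ast> K" and ?XYK = "X \<ast> Y \<ast> K"
  have "(idn C X \<odot> ((idn C Y \<odot> prj K) \<bullet> inc ?YK)) \<bullet> (idn C X \<odot> prj ?YK) \<bullet> inc ?XYK \<bullet> prj ?XYK \<bullet> asc M X Y K \<bullet> inc ((X \<otimes> Y) \<ast> K) =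
      (idn C X \<odot> idn C Y \<odot> prj K) \<bullet> asc M X Y K \<bullet> inc ((X \<otimes> Y) \<ast> K)"
    by (simp add: inc_prj_assoc e_act aar_cmp_typed_assoc aar_cmp_typed)
  also have "\<dots> = asc M X Y (part K) \<bullet> (idn C (X \<otimes> Y) \<odot> prj K) \<bullet> inc ((X \<otimes> Y) \<ast> K)"
    using asc_nat_id[of X Y "prj K"] by (simp flip: M.cmp_assoc_typed)
  finally show "(idn C X \<unrhd>\<^bsub>MF\<^esub> ((idn C Y \<odot> prj K) \<bullet> inc (Y \<ast> K))) \<cdot>\<^bsub>MF\<^esub>
      ((idn C X \<odot> prj (Y \<ast> K)) \<bullet> inc (X \<ast> Y \<ast> K)) \<cdot>\<^bsub>MF\<^esub> far ?F (asc M X Y K) =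
      asc MF X Y (fob ?F K) \<cdot>\<^bsub>MF\<^esub> (idn C (X \<otimes> Y) \<odot> prj K) \<bullet> inc ((X \<otimes> Y) \<ast> K)"
    by simp
next
  fix K
  show "lun MF (fob ?F K) \<cdot>\<^bsub>MF\<^esub> (idn C (unt C) \<odot> prj K) \<bullet> inc (unt C \<ast> K) = far ?F (lun M K)"
    using lun_nat[of "prj K"] by (simp flip: M.cmp_assoc_typed)
qed (auto simp: M.hom_iff M.scl_cmp M.cmp_scl)

lemma nontrivial_restrict: "e N \<noteq> zer M N N \<Longrightarrow> nontrivial MF"
proof -
  assume e: "e N \<noteq> zer M N N"
  have "\<not> zero_object M (part N)"
  proof
    assume "zero_object M (part N)"
    then have "inc N = zer M (part N) N" using M.zero_objectD[of "part N" "inc N"] by simp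
    then have "inc N \<bullet> prj N = zer M N N" by simp
    then show False using e by simp
  qed
  then show ?thesis unfolding nontrivial_def by (intro bexI[of _ "part N"]) simp_all
qed

end

section \<open>Sums of module categories and the decomposition\<close>

lemma is_iso_module_sum:
  "\<lbrakk>is_iso N1 a b f; is_iso N2 c d g\<rbrakk> \<Longrightarrow> is_iso (module_sum N1 N2) (a, c) (b, d) (f, g)"
  by (fastforce simp: is_iso_def inverses_def module_sum_def)

lemma module_functor_pair:
  assumes "module_functor C M N1 F1 s1" "module_functor C M N2 F2 s2"
  shows "module_functor C M (module_sum N1 N2)
    \<lparr>fob = (\<lambda>N. (fob F1 N, fob F2 N)), far = (\<lambda>f. (far F1 f, far F2 f))\<rparr> (\<lambda>X N. (s1 X N, s2 X N))"
proof -
  interpret F1: module_functor C M N1 F1 s1 by fact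
  interpret F2: module_functor C M N2 F2 s2 by fact
  show ?thesis
  proof
    fix X K assume "X \<in> obj C" "K \<in> obj M"
    then show "is_iso (module_sum N1 N2)
        (fob \<lparr>fob = (\<lambda>N. (fob F1 N, fob F2 N)), far = (\<lambda>f. (far F1 f, far F2 f))\<rparr> (X \<rhd>\<^bsub>M\<^esub> K))
        (X \<rhd>\<^bsub>module_sum N1 N2\<^esub> fob \<lparr>fob = (\<lambda>N. (fob F1 N, fob F2 N)), far = (\<lambda>f. (far F1 f, far F2 f))\<rparr> K)
        (s1 X K, s2 X K)"
      using is_iso_module_sum[OF F1.str_iso F2.str_iso] by (simp add: module_sum_def)
  qed (auto simp: module_sum_def F1.fob_obj F2.fob_obj F1.far_in F2.far_in F1.far_idn F2.far_idn F1.far_cmp F2.far_cmp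
      F1.far_pls F2.far_pls F1.far_scl F2.far_scl F1.str_natural F2.str_natural F1.str_tob F2.str_tob F1.str_unt F2.str_unt)
qed

context idempotent_endo
begin

abbreviation (input) compl :: "'o \<Rightarrow> 'a" where
  "compl \<equiv> (\<lambda>N. M.mns (idn M N) (e N))"

lemma e_compl: "e N \<bullet> M.mns (idn M N) (e N) = zer M N N" and compl_e: "M.mns (idn M N) (e N) \<bullet> e N = zer M N N"
  by (simp_all add: M.cmp_mns M.mns_cmp M.mns_self)

lemma idempotent_endo_compl: "idempotent_endo C M compl"
proof
  show "mod_end compl" by (rule mod_end_mns[OF mod_end_idn e_mod])
  have "M.mns (idn M N) (e N) \<bullet> M.mns (idn M N) (e N) =
      M.mns (M.mns (idn M N) (e N)) (e N \<bullet> M.mns (idn M N) (e N))" for N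
    by (subst M.mns_cmp) simp_all
  then show "compl N \<bullet> compl N = compl N" for N
    unfolding e_compl by (simp add: M.mns_def[of "M.mns _ _"])
qed

text \<open>The equivalence sends \<open>N\<close> to the images of \<open>e\<close> and
  \<open>1 - e\<close>. It is fully faithful because these natural idempotents are orthogonal with
  sum the identity, and essentially surjective because a biproduct of the two summands has them as
  its parts.\<close>

theorem idempotent_decomposes:
  assumes 1: "e N \<noteq> zer M N N" and 2: "e K \<noteq> idn M K"
  shows "\<not> indecomposable C M"
proof -
  interpret c: idempotent_endo C M compl by (rule idempotent_endo_compl)
  have "compl K \<noteq> zer M K K"
    using 2 M.mns_eq_zer[of "idn M K" "e K"] by auto
  then have nt: "nontrivial MF" "nontrivial c.MF"
    using nontrivial_restrict[OF 1] c.nontrivial_restrict by blast+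
  have pi: "prj N \<bullet> c.inc N = zer M (c.part N) (part N)" for N
  proof -
    have "prj N \<bullet> c.inc N = prj N \<bullet> (e N \<bullet> compl N) \<bullet> c.inc N" by simp
    then show ?thesis unfolding e_compl by simp
  qed
  have ip: "c.prj N \<bullet> inc N = zer M (part N) (c.part N)" for N
  proof -
    have "c.prj N \<bullet> inc N = (c.prj N \<bullet> compl N) \<bullet> (e N \<bullet> inc N)" unfolding c.prj_e by simp
    also have "\<dots> = c.prj N \<bullet> (compl N \<bullet> e N) \<bullet> inc N" by (simp del: c.prj_e c.prj_e_assoc e_inc)
    finally show ?thesis unfolding compl_e by simp
  qed
  have pi': "prj N \<bullet> c.inc N \<bullet> h = zer M (src M h) (part N)" if "trg M h = c.part N" for N h
    using that pi[of N] by (simp flip: M.cmp_assoc_typed)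
  have ip': "c.prj N \<bullet> inc N \<bullet> h = zer M (src M h) (c.part N)" if "trg M h = part N" for N h
    using that ip[of N] by (simp flip: M.cmp_assoc_typed)
  have sum: "e N \<oplus>\<^bsub>M\<^esub> compl N = idn M N" for N
    using M.mns_pls[of "idn M N" "e N"] M.pls_comm_typed[of "compl N" "e N"] by simp
  let ?F1 = "\<lparr>fob = part, far = (\<lambda>f. prj (trg M f) \<bullet> f \<bullet> inc (src M f))\<rparr>"
  let ?F2 = "\<lparr>fob = c.part, far = (\<lambda>f. c.prj (trg M f) \<bullet> f \<bullet> c.inc (src M f))\<rparr>"
  let ?F = "\<lparr>fob = (\<lambda>N. (fob ?F1 N, fob ?F2 N)), far = (\<lambda>f. (far ?F1 f, far ?F2 f))\<rparr>"
  note mf = module_functor_pair[OF module_functor_restrict c.module_functor_restrict]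
  have bij: "bij_betw (far ?F) (hom M K L) (hom (module_sum MF c.MF) (fob ?F K) (fob ?F L))" for K L
  proof (rule bij_betw_byWitness[where f' = "\<lambda>(f, g). inc L \<bullet> f \<bullet> prj K \<oplus>\<^bsub>M\<^esub> c.inc L \<bullet> g \<bullet> c.prj K"]; (intro ballI)?)
    show "far ?F ` hom M K L \<subseteq> hom (module_sum MF c.MF) (fob ?F K) (fob ?F L)"
      by (auto simp: module_sum_def M.hom_iff)
    show "(\<lambda>(f, g). inc L \<bullet> f \<bullet> prj K \<oplus>\<^bsub>M\<^esub> c.inc L \<bullet> g \<bullet> c.prj K) `
        hom (module_sum MF c.MF) (fob ?F K) (fob ?F L) \<subseteq> hom M K L"
      by (auto simp: module_sum_def M.hom_iff)
  next
    fix f assume "f \<in> hom M K L"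
    then have [simp]: "src M f = K" "trg M f = L" by (simp_all add: M.hom_iff)
    have "inc L \<bullet> prj L \<bullet> f \<bullet> inc K \<bullet> prj K = e L \<bullet> f"
      using e_nat[of f K L] by (simp add: inc_prj_assoc e_nat_assoc[of f K L])
    moreover have "c.inc L \<bullet> c.prj L \<bullet> f \<bullet> c.inc K \<bullet> c.prj K = compl L \<bullet> f"
      using c.e_nat[of f K L] by (simp add: c.inc_prj_assoc c.e_nat_assoc[of f K L])
    moreover have "e L \<bullet> f \<oplus>\<^bsub>M\<^esub> compl L \<bullet> f = f"
      by (simp add: sum flip: M.pls_cmp)
    ultimately show "(case far ?F f of (f, g) \<Rightarrow> inc L \<bullet> f \<bullet> prj K \<oplus>\<^bsub>M\<^esub> c.inc L \<bullet> g \<bullet> c.prj K) = f"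
      by simp
  next
    fix y assume "y \<in> hom (module_sum MF c.MF) (fob ?F K) (fob ?F L)"
    then obtain f g where y: "y = (f, g)" and [simp]: "src M f = part K" "trg M f = part L" "src M g = c.part K" "trg M g = c.part L"
      by (cases y) (auto simp: module_sum_def M.hom_iff)
    show "far ?F (case y of (f, g) \<Rightarrow> inc L \<bullet> f \<bullet> prj K \<oplus>\<^bsub>M\<^esub> c.inc L \<bullet> g \<bullet> c.prj K) = y"
      by (simp add: y M.pls_cmp M.cmp_pls pi pi' ip ip')
  qed
  have es: "\<exists>S f. is_iso (module_sum MF c.MF) (fob ?F S) L f" if "L \<in> obj (module_sum MF c.MF)" for L
  proof -
    obtain X Y where L: "L = (X, Y)" by (cases L)
    then have X: "e X = idn M X" and Y: "compl Y = idn M Y" using that by (simp_all add: module_sum_def)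
    have eY: "e Y = zer M Y Y" using e_compl[of Y] unfolding Y by simp
    have eX: "compl X = zer M X X" using e_compl[of X] unfolding X by simp
    have "X \<in> obj M" "Y \<in> obj M" by simp_all
    from M.has_biproducts[OF this] obtain S i j p q
      where ij: "i \<in> hom M X S" "j \<in> hom M Y S" "p \<in> hom M S X" "q \<in> hom M S Y"
        and pq: "p \<bullet> i = idn M X" "q \<bullet> j = idn M Y"
        and s: "i \<bullet> p \<oplus>\<^bsub>M\<^esub> j \<bullet> q = idn M S" by blast
    note [simp] = ij[unfolded M.hom_iff]
    \<comment> \<open>\<open>e\<close> is the identity on \<open>X\<close> and zero on
      \<open>Y\<close>, so naturality identifies \<open>e S\<close> with the projection onto the
      summand \<open>X\<close>.\<close>
    have "e S \<bullet> (i \<bullet> p \<oplus>\<^bsub>M\<^esub> j \<bullet> q) = i \<bullet> p"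
      by (simp add: M.cmp_pls e_nat_assoc[of i X S] e_nat_assoc[of j Y S] X eY)
    then have ip_e: "i \<bullet> p = e S" by (simp add: s)
    have "compl S \<bullet> (i \<bullet> p \<oplus>\<^bsub>M\<^esub> j \<bullet> q) = j \<bullet> q"
      by (simp add: M.cmp_pls c.e_nat_assoc[of i X S] c.e_nat_assoc[of j Y S] Y eX)
    then have jq_e: "j \<bullet> q = compl S" by (simp add: s)
    have "is_iso M (part S) X (p \<bullet> inc S)"
    proof (rule M.is_isoI[of _ _ _ "prj S \<bullet> i"])
      have "(prj S \<bullet> i) \<bullet> p \<bullet> inc S = prj S \<bullet> (i \<bullet> p) \<bullet> inc S" by simp
      then show "(prj S \<bullet> i) \<bullet> p \<bullet> inc S = idn M (part S)" unfolding ip_e by simp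
      have "p \<bullet> e S \<bullet> i = (p \<bullet> i) \<bullet> (p \<bullet> i)" by (simp flip: ip_e)
      then show "(p \<bullet> inc S) \<bullet> prj S \<bullet> i = idn M X" unfolding pq by (simp add: inc_prj_assoc)
    qed simp_all
    moreover have "is_iso M (c.part S) Y (q \<bullet> c.inc S)"
    proof (rule M.is_isoI[of _ _ _ "c.prj S \<bullet> j"])
      have "(c.prj S \<bullet> j) \<bullet> q \<bullet> c.inc S = c.prj S \<bullet> (j \<bullet> q) \<bullet> c.inc S" by simp
      then show "(c.prj S \<bullet> j) \<bullet> q \<bullet> c.inc S = idn M (c.part S)" unfolding jq_e by simp
      have "q \<bullet> compl S \<bullet> j = (q \<bullet> j) \<bullet> (q \<bullet> j)" by (simp flip: jq_e)
      then show "(q \<bullet> c.inc S) \<bullet> c.prj S \<bullet> j = idn M Y" unfolding pq by (simp add: c.inc_prj_assoc)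
    qed simp_all
    ultimately have "is_iso (module_sum MF c.MF) (part S, c.part S) (X, Y) (p \<bullet> inc S, q \<bullet> c.inc S)"
      by (intro is_iso_module_sum) simp_all
    then show ?thesis unfolding L by auto
  qed
  have "module_equivalent C M (module_sum MF c.MF)"
    unfolding module_equivalent_def
    by (rule exI, rule exI, rule conjI[OF mf], intro conjI ballI, rule bij) (use es in \<open>simp add: Bex_def\<close>)
  then show ?thesis
    unfolding indecomposable_def using nt module_category_restrict c.module_category_restrict by blast
qed

end

section \<open>Module endomorphisms are scalar\<close>

text \<open>\<open>act_object_epi\<close> is assumed because this part makes no reference to
  internal Homs, which later provide it.\<close>

locale exact_typed_module = typed_module_category C M + tensor_category C
  for C :: "('k::alg_closed_field, 'c, 'e, 'z) moncat_scheme" (structure)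
    and M :: "('k, 'c, 'e, 'o, 'a) modcat" +
  assumes exact: "exact_module C M"
    and indec: "indecomposable C M"
    and act_object_epi: "is_epi C X Y p \<Longrightarrow> is_epi M (X \<ast> N) (Y \<ast> N) (p \<odot> idn M N)"
begin

text \<open>Acting with a projective cover of the unit object splits all extensions by exactness, and acting
  with it is faithful.\<close>

lemma mod_end_zero:
  assumes n: "mod_end n" and simple: "\<And>S. simple_object M S \<Longrightarrow> n S = zer M S S"
  shows "n N = zer M N N"
proof -
  note [simp] = mod_endD(1,2)[OF n]
  obtain P c where P: "projective C P" and c: "is_epi C P (unt C) c" using enough_projectives[of "unt C"] by auto
  have ct [simp]: "src C c = P" "trg C c = unt C"
    using c by (simp_all add: is_epi_iff)
  obtain D1 ev1 co1 where ld: "left_dual C P D1 ev1 co1" using left_rigid[of P] by auto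
  obtain D2 ev2 co2 where rd: "left_dual C D2 P ev2 co2" using right_rigid[of P] by auto
  have "finite_length M N" using M.finite_lengths by simp
  then show ?thesis
  proof (induction rule: finite_length.induct)
    case (zero X)
    then show ?case using M.zero_objectD[of X "n X"] by simp
  next
    case (step K X S p k)
    note epi = step.hyps(4) and ker = step.hyps(5)
    have [simp]: "src M p = X" "trg M p = S" using epi by (simp_all add: M.is_epi_iff)
    note [simp] = M.is_kernelD(1,2)[OF ker]
    let ?act = "\<lambda>f. idn C P \<odot> f"
    have "projective M (P \<ast> S)" using exact P by (simp add: exact_module_def)
    moreover have "is_epi M (P \<ast> X) (P \<ast> S) (?act p)" by (rule act_epi[OF rd epi])
    ultimately obtain s where s: "src M s = P \<ast> S" "trg M s = P \<ast> X" "?act p \<bullet> s = idn M (P \<ast> S)"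
      unfolding projective_def by (metis M.hom_iff M.obj_UNIV M.src_idn M.trg_idn)
    note [simp] = s(1,2)
    \<comment> \<open>The identity of \<open>P \<rhd> X\<close> is \<open>?t\<close> plus
      \<open>s \<bullet> ?act p\<close>. The first summand factors through
      \<open>P \<rhd> K\<close>, the second through \<open>P \<rhd> S\<close>, and \<open>n\<close>
      vanishes at both objects.\<close>
    let ?t = "M.mns (idn M (P \<ast> X)) (s \<bullet> ?act p)"
    have "?act p \<bullet> s \<bullet> ?act p = ?act p"
      using s(3) by (simp flip: M.cmp_assoc_typed)
    then have "?act p \<bullet> ?t = zer M (P \<ast> X) (P \<ast> S)"
      by (simp add: M.cmp_mns M.mns_self)
    then obtain u where u: "src M u = P \<ast> X" "trg M u = P \<ast> K" "?act k \<bullet> u = ?t"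
      using M.is_kernelD(4)[OF act_kernel[OF ld ker], of ?t] by auto
    have "n (P \<ast> X) \<bullet> ?t = (n (P \<ast> X) \<bullet> ?act k) \<bullet> u"
      using u(1,2) by (simp flip: u(3))
    also have "n (P \<ast> X) \<bullet> ?act k = zer M (P \<ast> K) (P \<ast> X)"
      using mod_endD(3)[OF n, of "?act k" "P \<ast> K" "P \<ast> X"] by (simp add: mod_endD(4)[OF n] step.IH)
    finally have 1: "n (P \<ast> X) \<bullet> ?t = zer M (P \<ast> X) (P \<ast> X)" using u(1,2) by simp
    have "n (P \<ast> X) \<bullet> s = zer M (P \<ast> S) (P \<ast> X)"
      using mod_endD(3)[OF n, of s "P \<ast> S" "P \<ast> X"] by (simp add: mod_endD(4)[OF n] simple[OF step.hyps(3)])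
    then have "n (P \<ast> X) \<bullet> s \<bullet> ?act p = zer M (P \<ast> X) (P \<ast> X)"
      by (simp flip: M.cmp_assoc_typed)
    then have "n (P \<ast> X) \<bullet> (?t \<oplus>\<^bsub>M\<^esub> s \<bullet> ?act p) = zer M (P \<ast> X) (P \<ast> X)"
      using 1 by (simp add: M.cmp_pls)
    moreover have "?t \<oplus>\<^bsub>M\<^esub> s \<bullet> ?act p = idn M (P \<ast> X)" by (rule M.mns_pls) simp_all
    ultimately have P0: "?act (n X) = zer M (P \<ast> X) (P \<ast> X)"
      by (simp add: mod_endD(4)[OF n])
    \<comment> \<open>Descent from \<open>P\<close> to the unit object: \<open>c\<close> acting on
      \<open>X\<close> is epi and exchanges \<open>P \<rhd> n X\<close>, which is zero, with the
      unit object acting on \<open>n X\<close>.\<close>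
    have "n X \<bullet> lun M X = zer M (unt C \<ast> X) X"
    proof (rule M.is_epiD[OF act_object_epi[OF c]])
      have "(n X \<bullet> lun M X) \<bullet> (c \<odot> idn M X) = (lun M X \<bullet> (idn C (unt C) \<odot> n X)) \<bullet> (c \<odot> idn M X)"
        using lun_nat[of "n X"] by simp
      also have "\<dots> = lun M X \<bullet> (c \<odot> idn M X) \<bullet> ?act (n X)"
        using exchange[of c "n X"] by simp
      finally show "(n X \<bullet> lun M X) \<bullet> (c \<odot> idn M X) = zer M (unt C \<ast> X) X \<bullet> (c \<odot> idn M X)"
        unfolding P0 by simp
    qed simp_all
    then have "n X \<bullet> lun M X = zer M X X \<bullet> lun M X" by simp
    then show ?case by (rule M.cmp_right_cancel_iso[OF lun_iso_typed, rotated -1]) simp_all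
  qed
qed

lemma mod_end_eqI:
  assumes \<phi>: "mod_end \<phi>" and \<psi>: "mod_end \<psi>" and "\<And>S. simple_object M S \<Longrightarrow> \<phi> S = \<psi> S"
  shows "\<phi> N = \<psi> N"
proof (rule M.mns_eq_zer)
  note [simp] = mod_endD(1,2)[OF \<phi>] mod_endD(1,2)[OF \<psi>]
  show "M.mns (\<phi> N) (\<psi> N) = zer M (src M (\<psi> N)) (trg M (\<psi> N))"
    using mod_end_zero[OF mod_end_mns[OF \<phi> \<psi>]] assms(3) by (simp add: M.mns_self)
qed (simp_all add: mod_endD(1,2)[OF \<phi>] mod_endD(1,2)[OF \<psi>])

text \<open>Values zero and one on simple objects make \<open>\<psi>\<close> idempotent there, hence
  everywhere by \<open>mod_end_eqI\<close>. Being nonzero at \<open>S\<close>, it would decompose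
  \<open>M\<close> unless it were the identity.\<close>

lemma mod_end_idempotent:
  assumes \<psi>: "mod_end \<psi>" and idem: "\<And>S. simple_object M S \<Longrightarrow> \<psi> S = zer M S S \<or> \<psi> S = idn M S"
    and S: "simple_object M S" "\<psi> S = idn M S"
  shows "\<psi> N = idn M N"
proof (rule ccontr)
  assume N: "\<psi> N \<noteq> idn M N"
  have "\<psi> K \<bullet> \<psi> K = \<psi> K" for K
    by (rule mod_end_eqI[OF mod_end_cmp[OF \<psi> \<psi>] \<psi>]) (use idem mod_endD(1,2)[OF \<psi>] in fastforce)
  then interpret idempotent_endo C M \<psi>
    by unfold_locales (rule \<psi>)
  have "\<psi> S \<noteq> zer M S S" using S by (simp add: simple_object_def zero_object_def)
  then show False using idempotent_decomposes N indec by blast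
qed

text \<open>The product of the factors \<open>(\<phi> - b) / (a - b)\<close> over \<open>b\<close>
  in \<open>F\<close>. Its values are stated for an arbitrary scalar \<open>c\<close>, so that no
  eigenvalue function has to be chosen.\<close>

lemma lagrange_mod_end:
  assumes \<phi>: "mod_end \<phi>" and F: "finite F" "a \<notin> F"
  shows "\<exists>\<psi>. mod_end \<psi> \<and> (\<forall>S c. \<phi> S = scl M c (idn M S) \<longrightarrow>
    (c = a \<longrightarrow> \<psi> S = idn M S) \<and> (c \<in> F \<longrightarrow> \<psi> S = zer M S S))"
  using F
proof (induction F rule: finite_induct)
  case empty
  then show ?case by (intro exI[of _ "idn M"]) (simp add: mod_end_idn)
next
  case (insert b F)
  then obtain \<psi> where \<psi>: "mod_end \<psi>" and v: "\<And>S c. \<phi> S = scl M c (idn M S) \<Longrightarrow>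
    (c = a \<longrightarrow> \<psi> S = idn M S) \<and> (c \<in> F \<longrightarrow> \<psi> S = zer M S S)" by auto
  let ?\<chi> = "\<lambda>N. scl M (inverse (a - b)) (M.mns (\<phi> N) (scl M b (idn M N)))"
  have \<chi>: "mod_end ?\<chi>"
    by (intro mod_end_scl mod_end_mns \<phi> mod_end_idn)
  have ab: "a - b \<noteq> 0" using insert by auto
  have \<chi>v: "?\<chi> S = scl M ((c - b) / (a - b)) (idn M S)" if "\<phi> S = scl M c (idn M S)" for S c
    by (simp add: that M.mns_def M.scl_scl flip: M.scl_plus) (simp add: field_simps)
  have "(c = a \<longrightarrow> ?\<chi> S \<bullet> \<psi> S = idn M S) \<and> (c \<in> insert b F \<longrightarrow> ?\<chi> S \<bullet> \<psi> S = zer M S S)"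
    if c: "\<phi> S = scl M c (idn M S)" for S c
    using v[OF c] ab mod_endD(1,2)[OF \<psi>] unfolding \<chi>v[OF c] by (auto simp: M.scl_cmp M.scl_0)
  then show ?case
    using mod_end_cmp[OF \<chi> \<psi>] by blast
qed

theorem mod_end_scalar:
  assumes \<phi>: "mod_end \<phi>"
  shows "\<exists>c. \<forall>N. \<phi> N = scl M c (idn M N)"
proof -
  note [simp] = mod_endD(1,2)[OF \<phi>]
  have ev: "\<exists>c. \<phi> S = scl M c (idn M S)" if "simple_object M S" for S
    by (rule M.simple_endo_scalar[OF _ that]) (simp_all add: alg_closed_imp_poly_has_root)
  have nz: "idn M S \<noteq> zer M S S" if "simple_object M S" for S
    using that by (simp add: simple_object_def zero_object_def)
  have inj: "c = d" if S: "simple_object M S" and "scl M c (idn M S) = scl M d (idn M S)" for S c d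
  proof (rule ccontr)
    assume "c \<noteq> d"
    have "scl M (c - d) (idn M S) = M.mns (scl M c (idn M S)) (scl M d (idn M S))"
      by (simp add: M.mns_def M.scl_scl flip: M.scl_plus)
    then have "scl M (inverse (c - d)) (scl M (c - d) (idn M S)) = zer M S S"
      using that by (simp add: M.mns_self)
    then show False using \<open>c \<noteq> d\<close> nz[OF S] by (simp add: M.scl_scl)
  qed
  obtain N0 where "\<not> zero_object M N0" using indec by (auto simp: indecomposable_def nontrivial_def)
  moreover have "finite_length M N0" using M.finite_lengths by simp
  \<comment> \<open>A nonzero object of finite length has a simple quotient.\<close>
  ultimately obtain S0 where S0: "simple_object M S0" by (auto elim: finite_length.cases)
  obtain a where a: "\<phi> S0 = scl M a (idn M S0)" using ev[OF S0] by blast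
  obtain T where T: "finite T" "\<And>S. simple_object M S \<Longrightarrow> \<exists>S'\<in>T. \<exists>f. is_iso M S S' f"
    using M.finitely_many_simples by blast
  define val where "val S = (SOME c. \<phi> S = scl M c (idn M S))" for S
  \<comment> \<open>The scalars other than \<open>a\<close> on representatives of the simple
    objects. At members of \<open>T\<close> where \<open>\<phi>\<close> is not scalar,
    \<open>val\<close> is arbitrary; this only adds interpolation nodes.\<close>
  let ?F = "val ` T - {a}"
  obtain \<psi> where \<psi>: "mod_end \<psi>" and v: "\<And>S c. \<phi> S = scl M c (idn M S) \<Longrightarrow>
    (c = a \<longrightarrow> \<psi> S = idn M S) \<and> (c \<in> ?F \<longrightarrow> \<psi> S = zer M S S)"
    using lagrange_mod_end[OF \<phi>, of ?F a] T(1) by auto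
  \<comment> \<open>An isomorphism transports the scalar of \<open>S\<close> to its representative
    in \<open>T\<close>, and \<open>inj\<close> identifies it with the chosen value.\<close>
  have in_F: "c \<in> insert a ?F" if S: "simple_object M S" and c: "\<phi> S = scl M c (idn M S)" for S c
  proof -
    obtain S' f where S': "S' \<in> T" and f: "is_iso M S S' f" using T(2)[OF S] by blast
    have [simp]: "src M f = S" "trg M f = S'" using M.src_iso[OF f] M.trg_iso[OF f] by simp_all
    have "\<phi> S' \<bullet> f = scl M c (idn M S') \<bullet> f"
      using mod_endD(3)[OF \<phi>, of f S S'] by (simp add: c M.scl_cmp M.cmp_scl)
    then have 1: "\<phi> S' = scl M c (idn M S')"
      by (rule M.cmp_right_cancel_iso[OF f, rotated -1]) simp_all
    then have 2: "\<phi> S' = scl M (val S') (idn M S')" unfolding val_def by (rule someI)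
    have "\<phi> S = scl M (val S') (idn M S)"
    proof (rule M.cmp_left_cancel_iso[OF f])
      show "f \<bullet> \<phi> S = f \<bullet> scl M (val S') (idn M S)"
        using mod_endD(3)[OF \<phi>, of f S S'] by (simp add: 2 M.scl_cmp M.cmp_scl)
    qed simp_all
    then have "c = val S'" using inj[OF S] c by simp
    then show ?thesis using S' by auto
  qed
  have \<psi>1: "\<psi> N = idn M N" for N
  proof (rule mod_end_idempotent[OF \<psi> _ S0])
    show "\<psi> S0 = idn M S0" using v[OF a] by blast
    fix S assume S: "simple_object M S"
    obtain c where c: "\<phi> S = scl M c (idn M S)" using ev[OF S] by blast
    show "\<psi> S = zer M S S \<or> \<psi> S = idn M S" using v[OF c] in_F[OF S c] by blast
  qed
  have "\<phi> N = scl M a (idn M N)" for N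
  proof (rule mod_end_eqI[OF \<phi> mod_end_scl[OF mod_end_idn]])
    fix S assume S: "simple_object M S"
    obtain c where c: "\<phi> S = scl M c (idn M S)" using ev[OF S] by blast
    \<comment> \<open>A scalar in \<open>?F\<close> would make \<open>\<psi> S\<close> zero, while
      \<open>\<psi>\<close> is the identity.\<close>
    have "c = a" using v[OF c] in_F[OF S c] \<psi>1[of S] nz[OF S] by auto
    then show "\<phi> S = scl M a (idn M S)" using c by simp
  qed
  then show ?thesis by blast
qed

end

section \<open>Connectedness\<close>

text \<open>\<open>- \<rhd> N\<close> is a left adjoint by the internal Hom, so test arrows can be
  transposed and cancelled in \<open>C\<close>.\<close>

lemma (in typed_internal_hom) act_object_epi:
  assumes p: "is_epi C X Y p"
  shows "is_epi M (X \<ast> N) (Y \<ast> N) (p \<odot> idn M N)"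
  unfolding M.is_epi_iff
proof (intro conjI allI impI)
  have [simp]: "src C p = X" "trg C p = Y" using p by (simp_all add: is_epi_iff)
  show "src M (p \<odot> idn M N) = X \<ast> N" "trg M (p \<odot> idn M N) = Y \<ast> N" by simp_all
  fix g h assume gh [simp]: "src M g = Y \<ast> N" "src M h = Y \<ast> N" "trg M g = trg M h"
    and eq: "g \<bullet> (p \<odot> idn M N) = h \<bullet> (p \<odot> idn M N)"
  let ?g = "psi Y N (trg M h) g" and ?h = "psi Y N (trg M h) h"
  have "?g \<cdot> p = ?h \<cdot> p"
    by (rule phi_inject[of _ N "trg M h" _ X]) (simp_all add: eq)
  then have "?g = ?h" by (rule is_epiD[OF p]) simp_all
  then have "phi I Y N (trg M h) ?g = phi I Y N (trg M h) ?h" by simp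
  then show "g = h" by simp
qed

locale exact_central_setting = central_setting V dl ev C G M I R
  for V :: "('k::alg_closed_field, 'v, 'w) brcat"
    and dl :: "'v \<Rightarrow> 'v"
    and ev :: "'v \<Rightarrow> 'w"
    and C :: "('k, 'c, 'e) moncat" (structure)
    and G :: "('v, 'w, 'c \<times> ('c \<Rightarrow> 'e), 'e) monfctr"
    and M :: "('k, 'c, 'e, 'o, 'a) modcat"
    and I :: "('c, 'e, 'o, 'a) ihom"
    and R :: "('o, 'a, 'o, 'a) fctr \<times> ('v \<Rightarrow> 'o \<Rightarrow> 'a) \<Rightarrow> 'c \<times> ('o \<Rightarrow> 'e)" +
  assumes exact: "exact_module C M" and indec: "indecomposable C M"
begin

sublocale exact_typed_module C M
  by unfold_locales (rule exact indec act_object_epi; assumption?)+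

lemma counit_lax_unit_scl: "e0 N \<bullet> (scl C c lax_unit \<odot> idn M N) = scl M c (lun M N)"
proof -
  have "scl C c lax_unit \<odot> idn M N = scl M c (lax_unit \<odot> idn M N)"
    by (rule aar_scl_left[of "unt C" A0 N N]) (simp_all add: hom_iff M.hom_iff)
  then show ?thesis using counit_lax_unit[of N] by (simp add: M.cmp_scl)
qed

lemma center_hom_unit:
  assumes f: "f \<in> hom (center C) (unt (center C)) (Z_rho_bar IdCVM)"
  shows "\<exists>c. f = scl C c lax_unit"
proof -
  have f_types [simp]: "src C f = unt C" "trg C f = A0"
    using f by (simp_all add: center_hom_iff Z_rho_bar_IdCVM[THEN arg_cong[of _ _ fst]])
  have fc: "idn C X \<boxtimes> f = snd (Z_rho_bar IdCVM) X \<cdot> (f \<boxtimes> idn C X)" for X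
    using f by (simp add: center_hom_iff)
  \<comment> \<open>The transformation from \<open>1 \<rhd> -\<close> to the identity corresponding
    to \<open>f\<close>, turned into an endomorphism of the identity by the inverse unitor.\<close>
  define \<phi> where "\<phi> N = e0 N \<bullet> (f \<odot> idn M N) \<bullet> luni N" for N
  have [simp]: "src M (\<phi> N) = N" "trg M (\<phi> N) = N" for N by (simp_all add: \<phi>_def)
  have ef: "natcmp efam (natact f) = (unt C, unt C, \<lambda>N. luni N \<bullet> \<phi> N \<bullet> lun M N)"
    by (simp add: natcmp_def natact_def \<phi>_def)
  have asc_r: "asc M X (unt C) N = idn C X \<odot> luni N" for X N
  proof -
    have "(idn C X \<odot> luni N) \<bullet> asci X (unt C) N \<bullet> asc M X (unt C) N = idn C X \<odot> luni N"
      by simp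
    then show ?thesis
      unfolding asci_unit_right by (simp add: aar_cmp_typed_assoc)
  qed
  have asc_l: "lun M (X \<ast> N) \<bullet> asc M (unt C) X N = idn M (X \<ast> N)" for X N
    by (rule unit_triangle_left)
  have "\<phi> (X \<ast> N) = idn C X \<odot> \<phi> N" for X N
  proof -
    \<comment> \<open>Read through \<open>unit_central_iff\<close>, the centre condition on
      \<open>f\<close> at \<open>X\<close> is the module condition on \<open>\<phi>\<close> up to
      unitors.\<close>
    have "natten (natact (idn C X)) (natcmp efam (natact f)) = natten (natcmp efam (natact f)) (natact (idn C X))"
      using alg.unit_central_iff[of f X] fc by simp
    then have "asci X (unt C) N \<bullet> (idn C X \<odot> (luni N \<bullet> \<phi> N \<bullet> lun M N)) \<bullet> asc M X (unt C) N =
        asci (unt C) X N \<bullet> luni (X \<ast> N) \<bullet> \<phi> (X \<ast> N) \<bullet> lun M (X \<ast> N) \<bullet> asc M (unt C) X N"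
      unfolding ef by (simp add: natten_def natact_def fun_eq_iff)
    then show ?thesis
      by (simp add: asci_unit_right asci_unit_left asc_r asc_l aar_cmp_typed)
  qed
  moreover have "\<phi> (trg M u) \<bullet> u = u \<bullet> \<phi> (src M u)" for u
  proof -
    have "\<phi> (trg M u) \<bullet> u = e0 (trg M u) \<bullet> ((f \<odot> idn M (trg M u)) \<bullet> (idn C (unt C) \<odot> u)) \<bullet> luni (src M u)"
      by (simp add: \<phi>_def luni_nat)
    also have "\<dots> = (e0 (trg M u) \<bullet> (idn C A0 \<odot> u)) \<bullet> (f \<odot> idn M (src M u)) \<bullet> luni (src M u)"
      using exchange[of f u] by simp
    finally show ?thesis unfolding e0_natural by (simp add: \<phi>_def)
  qed
  ultimately have "mod_end \<phi>" by (simp add: mod_end_def)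
  then obtain c where c: "\<And>N. \<phi> N = scl M c (idn M N)" using mod_end_scalar by blast
  have "f = scl C c lax_unit"
  proof (rule counit_cancel[OF IdV_EndV])
    fix N
    have "e0 N \<bullet> (f \<odot> idn M N) = \<phi> N \<bullet> lun M N" by (simp add: \<phi>_def)
    then show "e0 N \<bullet> (f \<odot> idn M N) = e0 N \<bullet> (scl C c lax_unit \<odot> idn M N)"
      unfolding counit_lax_unit_scl by (simp add: c M.scl_cmp)
  qed simp_all
  then show ?thesis by blast
qed

theorem connected: "has_hom_dim (center C) (unt (center C)) (Z_rho_bar IdCVM) 1"
proof -
  let ?U = "unt (center C)" and ?A = "Z_rho_bar IdCVM"
  have lc: "lincomb (center C) ?U ?A 1 a (\<lambda>_. lax_unit) = scl C (a 0) lax_unit" for a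
    by (subst Z_rho_bar_IdCVM) (simp add: center_def)
  \<comment> \<open>Some object of \<open>M\<close> is nonzero, and there the counit turns
    \<open>lax_unit\<close> into the invertible arrow \<open>lun M N\<close>; hence distinct scalars
    give distinct multiples.\<close>
  have inj: "c = d" if eq: "scl C c lax_unit = scl C d lax_unit" for c d
  proof -
    obtain N where N: "\<not> zero_object M N" using indec by (auto simp: indecomposable_def nontrivial_def)
    have "scl M c (lun M N) \<bullet> luni N = scl M d (lun M N) \<bullet> luni N"
      using eq counit_lax_unit_scl[of N] by metis
    then have e: "scl M c (idn M N) = scl M d (idn M N)" by (simp add: M.scl_cmp)
    have "scl M (c - d) (idn M N) = M.mns (scl M c (idn M N)) (scl M d (idn M N))"
      by (simp add: M.mns_def M.scl_scl flip: M.scl_plus)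
    then have *: "scl M (inverse (c - d)) (scl M (c - d) (idn M N)) = zer M N N"
      by (simp add: e M.mns_self)
    show "c = d"
    proof (rule ccontr)
      assume "c \<noteq> d"
      then show False using * N by (simp add: M.scl_scl zero_object_def)
    qed
  qed
  have "\<exists>!a. (\<forall>i\<ge>1. a i = 0) \<and> lincomb (center C) ?U ?A 1 a (\<lambda>_. lax_unit) = f"
    if f: "f \<in> hom (center C) ?U ?A" for f
  proof -
    obtain c where c: "f = scl C c lax_unit" using center_hom_unit[OF f] by blast
    show ?thesis
    proof (rule ex1I[of _ "\<lambda>i. if i = 0 then c else 0"])
      fix a assume a: "(\<forall>i\<ge>1. a i = 0) \<and> lincomb (center C) ?U ?A 1 a (\<lambda>_. lax_unit) = f"
      then have "a 0 = c" using inj unfolding lc c by blast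
      then show "a = (\<lambda>i. if i = 0 then c else 0)" using a by (auto simp: fun_eq_iff)
    qed (unfold lc c, simp)
  qed
  moreover have "lax_unit \<in> hom (center C) ?U ?A"
    using algebra_relative_center(1) by (simp add: is_algebra_def relative_center_def)
  ultimately show ?thesis
    unfolding has_hom_dim_def by (intro exI[of _ "\<lambda>_. lax_unit"]) simp
qed

end

theorem corollary4p12:
  fixes V :: "('k::alg_closed_field, 'v, 'w) brcat"
    and C :: "('k, 'c, 'e) moncat"
    and G :: "('v, 'w, 'c \<times> ('c \<Rightarrow> 'e), 'e) monfctr"
    and M :: "('k, 'c, 'e, 'o, 'a) modcat"
    and dl :: "'v \<Rightarrow> 'v"
    and ev :: "'v \<Rightarrow> 'w"
    and I :: "('c, 'e, 'o, 'a) ihom"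
    and R :: "('o, 'a, 'o, 'a) fctr \<times> ('v \<Rightarrow> 'o \<Rightarrow> 'a) \<Rightarrow> 'c \<times> ('o \<Rightarrow> 'e)"
  assumes "on_types V" and "braided_tensor_category V"
    and "\<forall>X. \<exists>coev. left_dual V X (dl X) (ev X) coev"
    and "on_types C" and "tensor_category C"
    and "braided_functor V (center C) G" and "faithful V G" and "right_exact V (center C) G"
    and "on_types M" and "module_category C M" and "exact_module C M" and "indecomposable C M"
    and "internal_hom C M I"
    and "central_module_data.relative_ends V dl ev C G M I R"
  defines "A \<equiv> central_module_data.Z_rho_bar C G M I R (central_module_data.IdCVM G M)"
    and "\<pi> \<equiv> central_module_data.end_pi R (central_module_data.IdV G M)"
    and "\<mu> \<equiv> central_module_data.lax_mult C G M I R
      (central_module_data.IdV G M) (central_module_data.IdV G M)"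
    and "\<epsilon> \<equiv> central_module_data.lax_unit C G M I R"
  shows "is_algebra (relative_center V C G) A \<mu> \<epsilon> \<and>
    (\<forall>X N. central_module_data.ia_inv C M I X N N \<cdot>\<^bsub>C\<^esub> (idn C X \<boxtimes>\<^bsub>C\<^esub> \<pi> N) \<cdot>\<^bsub>C\<^esub> snd A X =
      central_module_data.ib C M I X N (X \<rhd>\<^bsub>M\<^esub> N) \<cdot>\<^bsub>C\<^esub> (\<pi> (X \<rhd>\<^bsub>M\<^esub> N) \<boxtimes>\<^bsub>C\<^esub> idn C X)) \<and>
    is_commutative_algebra (relative_center V C G) A \<mu> \<epsilon> \<and>
    has_hom_dim (center C) (unt (center C)) A 1"
proof -
  interpret V: braided_tensor_category V by fact
  interpret C: tensor_category C by fact
  interpret M: module_category C M by fact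
  interpret G: braided_functor V "center C" G by fact
  interpret exact_central_setting V dl ev C G M I R
    by unfold_locales (use assms in blast)+
  show ?thesis
    unfolding A_def \<pi>_def \<mu>_def \<epsilon>_def
    using algebra_relative_center half_braiding_dinatural connected by blast
qed

end
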